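(* Consider the quasi-affine control system $\dot x(t)=A(v(t))x(t)+B(v(t))u(t)$, $(u,v)\in\mathcal{U}\times\mathcal{V}$, on $\mathbb{R}^d$, and suppose that: (i) for every periodic $v\in\mathcal{V}$ the periodic linear system $\dot x(t)=A(v(t))x(t)+B(v(t))u(t)$ with unconstrained controls $u\in L^\infty(\mathbb{R},\mathbb{R}^m)$ is controllable; (ii) the quasi-affine system is locally accessible; (iii) for all periodic $v\in\mathcal{V}$ all Floquet exponents of the periodic homogeneous part $\dot x(t)=A(v(t))x(t)$ are different from $0$. Then the quasi-affine system has a unique control set $D$ with nonvoid interior, and it satisfies $$\overline{D}=\overline{\bigcup_{v\in\mathcal{V}\text{ periodic}}\pi_2(\mathrm{int}\,D^a_v)},$$ where, for periodic $v\in\mathcal{V}$, $D^a_v$ is the unique control set with nonvoid interior of the autonomized periodic linear control system on $\mathbb{S}^1\times\mathbb{R}^d$ obtained by fixing $v$, and $\pi_2(\tau,x)=x$.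
   Context: Quasi-affine system. Let $A(v)=A_0+\sum_{i=1}^pv_iA_i$ for $v\in V\subset\mathbb{R}^p$ with $A_0,\ldots,A_p\in\mathbb{R}^{d\times d}$, let $B:V\to\mathbb{R}^{d\times m}$ be continuous, and let $U\times V\subset\mathbb{R}^m\times\mathbb{R}^p$ be a compact convex neighborhood of $(0,0)$. $\mathcal{U}=\{u\in L^\infty(\mathbb{R},\mathbb{R}^m):u(t)\in U\text{ a.e.}\}$, $\mathcal{V}=\{v\in L^\infty(\mathbb{R},\mathbb{R}^p):v(t)\in V\text{ a.e.}\}$. The system is $\dot x(t)=A(v(t))x(t)+B(v(t))u(t)$ with controls $(u,v)\in\mathcal{U}\times\mathcal{V}$; $\psi(t;x_0,u,v)$, $t\in\mathbb{R}$, is the solution with $x(0)=x_0$. For $S>0$ put $\mathbf{R}_{\le S}(x)=\{\psi(t;x,u,v):t\in[0,S],(u,v)\in\mathcal{U}\times\mathcal{V}\}$, $\mathbf{C}_{\le S}(x)=\{y\in\mathbb{R}^d:\exists t\in[0,S],(u,v)\in\mathcal{U}\times\mathcal{V},\ \psi(t;y,u,v)=x\}$ and $\mathbf{R}(x)=\bigcup_{S>0}\mathbf{R}_{\le S}(x)$. The system is locally accessible if $\mathbf{R}_{\le S}(x)$ and $\mathbf{C}_{\le S}(x)$ have nonvoid interior for all $S>0$ and all $x\in\mathbb{R}^d$. Control set. A nonvoid subset $D$ of the state space of an autonomous control system is a control set if (i) for every $p\in D$ there is an admissible control such that the trajectory from $p$ stays in $D$ for all $t\ge0$; (ii) for every $p\in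 D$, $D$ is contained in the closure of the reachable set from $p$; (iii) $D$ is maximal (w.r.t. inclusion) with properties (i) and (ii). For the quasi-affine system the state space is $\mathbb{R}^d$ and admissible controls are $(u,v)\in\mathcal{U}\times\mathcal{V}$. Periodic systems for fixed $v$. For a $T_v$-periodic $v\in\mathcal{V}$ ($T_v>0$), the periodic linear system with unconstrained controls is called controllable if for any $x_1,x_2\in\mathbb{R}^d$ and $t_0\in\mathbb{R}$ there are $t_1>t_0$ and $u\in L^\infty([t_0,t_1],\mathbb{R}^m)$ such that the solution of $\dot x=A(v(t))x+B(v(t))u(t)$ with $x(t_0)=x_1$ satisfies $x(t_1)=x_2$. Parametrize the circle $\mathbb{S}^1$ by $\tau\in[0,T_v)$ (i.e. $\mathbb{R}/T_v\mathbb{Z}$). The autonomized system on $\mathbb{S}^1\times\mathbb{R}^d$ has trajectories $\psi^a_v(t;(\tau_0,x_0),u)=(t+\tau_0\bmod T_v,\ \psi(t;x_0,u,v(\tau_0+\cdot)))$ with controls $u\in\mathcal{U}$, reachable sets $\mathbf{R}^a_v(\tau_0,x_0)=\{\psi^a_v(t;(\tau_0,x_0),u):t\ge0,u\in\mathcal{U}\}$ and controllable sets $\mathbf{C}^a_v(\tau_0,x_0)$ (the points that can be steered to $(\tau_0,x_0)$ in some time $t\ge0$). If the system for $v$ with unconstrained controls is controllable, the autonomized system has exactly one control set $D^a_v$ with nonvoid interior, $D^a_v=\overline{\mathbf{R}^a_v(0,0)}\cap\mathbf{C}^a_v(0,0)$. Floquet exponents of $\dot x=A(v(t))x$ are the numbers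 $\frac{1}{T_v}\log|\mu|$, where $\mu$ runs over the eigenvalues of $X_v(T_v,0)$ and $X_v(t,s)$ is the principal fundamental solution ($X_v(s,s)=I_d$). The map $\pi_2:\mathbb{S}^1\times\mathbb{R}^d\to\mathbb{R}^d$ is $\pi_2(\tau,x)=x$. *)

theory Defs
  imports "HOL-Analysis.Analysis" "HOL-Library.Real_Mod"
begin

section \<open>Controls and trajectories\<close>

text \<open>
  Elements of \<open>L\<^sup>\<infinity>\<close> are represented by Lebesgue measurable functions. Nothing below depends on
  the choice of the representative within its class modulo null sets.
\<close>

definition L_infinity :: "real set \<Rightarrow> (real \<Rightarrow> 'a::euclidean_space) set" where
  "L_infinity J = {f \<in> borel_measurable (lebesgue_on J).
     \<exists>C. AE t in lebesgue_on J. norm (f t) \<le> C}"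

definition controls :: "'a::euclidean_space set \<Rightarrow> (real \<Rightarrow> 'a) set" where
  "controls U = {u \<in> L_infinity UNIV. AE t in lebesgue. u t \<in> U}"

definition periodic_control :: "real \<Rightarrow> (real \<Rightarrow> 'a) \<Rightarrow> bool" where
  "periodic_control T v \<longleftrightarrow> T > 0 \<and> (AE t in lebesgue. v (t + T) = v t)"

text \<open>
  Caratheodory solutions of \<open>x' = f (t, x)\<close> on an interval \<open>J\<close>: \<open>x\<close> is locally absolutely
  continuous and satisfies the equation almost everywhere, equivalently, the integral equation
  with a Lebesgue integral.
\<close>

definition caratheodory_solution ::
  "real set \<Rightarrow> (real \<Rightarrow> 'a \<Rightarrow> 'a) \<Rightarrow> (real \<Rightarrow> 'a::euclidean_space) \<Rightarrow> bool" where
  "caratheodory_solution J f x \<longleftrightarrow>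
     (\<forall>s\<in>J. \<forall>t\<in>J. s \<le> t \<longrightarrow>
        (\<lambda>r. f r (x r)) absolutely_integrable_on {s..t} \<and>
        x t = x s + integral {s..t} (\<lambda>r. f r (x r)))"

definition rhs ::
  "(real^'p \<Rightarrow> real^'d^'d) \<Rightarrow> (real^'p \<Rightarrow> real^'m^'d) \<Rightarrow> (real \<Rightarrow> real^'m) \<Rightarrow> (real \<Rightarrow> real^'p) \<Rightarrow>
   real \<Rightarrow> real^'d \<Rightarrow> real^'d" where
  "rhs A B u v t x = A (v t) *v x + B (v t) *v u t"

text \<open>
  \<open>\<psi>(t; x\<^sub>0, u, v)\<close> for all real \<open>t\<close>. For measurable controls with values in compact sets the equation
  is linear with bounded measurable coefficients, so it has exactly one solution on the real line.
\<close>

definition psi ::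
  "(real^'p \<Rightarrow> real^'d^'d) \<Rightarrow> (real^'p \<Rightarrow> real^'m^'d) \<Rightarrow>
   real \<Rightarrow> real^'d \<Rightarrow> (real \<Rightarrow> real^'m) \<times> (real \<Rightarrow> real^'p) \<Rightarrow> real^'d" where
  "psi A B t x0 w =
     (THE x. caratheodory_solution UNIV (rhs A B (fst w) (snd w)) x \<and> x 0 = x0) t"

section \<open>Control systems\<close>

text \<open>
  A control system is given by its set \<open>Adm\<close> of admissible controls and its trajectories
  \<open>\<phi> t x w\<close> (time, initial state at time 0, control); the topology \<open>X\<close> carries the state space.
\<close>

definition reachable_upto ::
  "'c set \<Rightarrow> (real \<Rightarrow> 's \<Rightarrow> 'c \<Rightarrow> 's) \<Rightarrow> real \<Rightarrow> 's \<Rightarrow> 's set" where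
  "reachable_upto Adm \<phi> S x = {\<phi> t x w | t w. t \<in> {0..S} \<and> w \<in> Adm}"

definition controllable_upto ::
  "'c set \<Rightarrow> (real \<Rightarrow> 's \<Rightarrow> 'c \<Rightarrow> 's) \<Rightarrow> real \<Rightarrow> 's \<Rightarrow> 's set" where
  "controllable_upto Adm \<phi> S x = {y. \<exists>t\<in>{0..S}. \<exists>w\<in>Adm. \<phi> t y w = x}"

definition reachable_set ::
  "'c set \<Rightarrow> (real \<Rightarrow> 's \<Rightarrow> 'c \<Rightarrow> 's) \<Rightarrow> 's \<Rightarrow> 's set" where
  "reachable_set Adm \<phi> x = (\<Union>S\<in>{0<..}. reachable_upto Adm \<phi> S x)"

definition locally_accessible ::
  "'c set \<Rightarrow> (real \<Rightarrow> 's \<Rightarrow> 'c \<Rightarrow> 's::topological_space) \<Rightarrow> bool" where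
  "locally_accessible Adm \<phi> \<longleftrightarrow>
     (\<forall>S>0. \<forall>x. interior (reachable_upto Adm \<phi> S x) \<noteq> {} \<and>
                interior (controllable_upto Adm \<phi> S x) \<noteq> {})"

definition pre_control_set ::
  "'s topology \<Rightarrow> 'c set \<Rightarrow> (real \<Rightarrow> 's \<Rightarrow> 'c \<Rightarrow> 's) \<Rightarrow> 's set \<Rightarrow> bool" where
  "pre_control_set X Adm \<phi> D \<longleftrightarrow>
     D \<noteq> {} \<and> D \<subseteq> topspace X \<and>
     (\<forall>p\<in>D. \<exists>w\<in>Adm. \<forall>t\<ge>0. \<phi> t p w \<in> D) \<and>
     (\<forall>p\<in>D. D \<subseteq> X closure_of reachable_set Adm \<phi> p)"

definition control_set ::
  "'s topology \<Rightarrow> 'c set \<Rightarrow> (real \<Rightarrow> 's \<Rightarrow> 'c \<Rightarrow> 's) \<Rightarrow> 's set \<Rightarrow> bool" where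
  "control_set X Adm \<phi> D \<longleftrightarrow>
     pre_control_set X Adm \<phi> D \<and>
     (\<forall>D'. pre_control_set X Adm \<phi> D' \<and> D \<subseteq> D' \<longrightarrow> D' = D)"

section \<open>Periodic systems for a fixed \<open>v\<close>\<close>

text \<open>Controllability with unconstrained controls; \<open>U\<close> plays no role here.\<close>

definition controllable_unconstrained ::
  "(real^'p \<Rightarrow> real^'d^'d) \<Rightarrow> (real^'p \<Rightarrow> real^'m^'d) \<Rightarrow> (real \<Rightarrow> real^'p) \<Rightarrow> bool" where
  "controllable_unconstrained A B v \<longleftrightarrow>
     (\<forall>x1 x2 t0. \<exists>t1>t0. \<exists>u\<in>L_infinity {t0..t1}. \<exists>x.
        caratheodory_solution {t0..t1} (rhs A B u v) x \<and> x t0 = x1 \<and> x t1 = x2)"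

definition principal_fundamental_solution ::
  "(real^'p \<Rightarrow> real^'d^'d) \<Rightarrow> (real \<Rightarrow> real^'p) \<Rightarrow> real \<Rightarrow> real \<Rightarrow> real^'d^'d" where
  "principal_fundamental_solution A v t s =
     (THE X. caratheodory_solution UNIV (\<lambda>r Y. A (v r) ** Y) X \<and> X s = mat 1) t"

definition complex_eigenvalue :: "real^'n^'n \<Rightarrow> complex \<Rightarrow> bool" where
  "complex_eigenvalue M \<mu> \<longleftrightarrow>
     (\<exists>w::complex^'n. w \<noteq> 0 \<and> map_matrix complex_of_real M *v w = \<mu> *s w)"

definition floquet_exponents ::
  "(real^'p \<Rightarrow> real^'d^'d) \<Rightarrow> real \<Rightarrow> (real \<Rightarrow> real^'p) \<Rightarrow> real set" where
  "floquet_exponents A T v =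
     {1 / T * ln (cmod \<mu>) | \<mu>. complex_eigenvalue (principal_fundamental_solution A v T 0) \<mu>}"

text \<open>
  The circle \<open>\<real>/T\<int>\<close> with underlying set \<open>[0, T)\<close>; it carries the quotient topology, not the subspace
  topology of the interval.
\<close>

definition circle_topology :: "real \<Rightarrow> real topology" where
  "circle_topology T = topology (\<lambda>W. W \<subseteq> {0..<T} \<and> open {t. t rmod T \<in> W})"

lemma openin_circle_topology:
  "openin (circle_topology T) W \<longleftrightarrow> W \<subseteq> {0..<T} \<and> open {t. t rmod T \<in> W}"
proof -
  have "istopology (\<lambda>W. W \<subseteq> {0..<T} \<and> open {t. t rmod T \<in> W})"
    unfolding istopology_def
  proof (intro conjI allI impI)
    fix S W :: "real set"
    assume S: "S \<subseteq> {0..<T} \<and> open {t. t rmod T \<in> S}"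
      and W: "W \<subseteq> {0..<T} \<and> open {t. t rmod T \<in> W}"
    have "{t. t rmod T \<in> S \<inter> W} = {t. t rmod T \<in> S} \<inter> {t. t rmod T \<in> W}"
      by auto
    with S W show "open {t. t rmod T \<in> S \<inter> W}"
      by (simp add: open_Int)
    show "S \<inter> W \<subseteq> {0..<T}"
      using S by blast
  next
    fix \<K> :: "real set set"
    assume K: "\<forall>K\<in>\<K>. K \<subseteq> {0..<T} \<and> open {t. t rmod T \<in> K}"
    have "{t. t rmod T \<in> \<Union>\<K>} = (\<Union>K\<in>\<K>. {t. t rmod T \<in> K})"
      by auto
    with K show "open {t. t rmod T \<in> \<Union>\<K>}"
      by auto
    show "\<Union>\<K> \<subseteq> {0..<T}"
      using K by blast
  qed
  then show ?thesis
    by (simp add: circle_topology_def)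
qed

lemma topspace_circle_topology:
  assumes "T > 0"
  shows "topspace (circle_topology T) = {0..<T}"
proof -
  have "{t. t rmod T \<in> {0..<T}} = UNIV"
    using assms by (auto simp: rmod_less rmod_nonneg)
  then have "openin (circle_topology T) {0..<T}"
    by (simp add: openin_circle_topology)
  then show ?thesis
    by (metis openin_circle_topology openin_subset openin_topspace subset_antisym)
qed

lemma quotient_map_circle_topology:
  assumes "T > 0"
  shows "quotient_map euclideanreal (circle_topology T) (\<lambda>t. t rmod T)"
proof -
  have "x \<in> range (\<lambda>t. t rmod T)" if "x \<in> {0..<T}" for x
    using that assms by (intro image_eqI[of _ _ x]) (auto simp: rmod_idem)
  then have "range (\<lambda>t. t rmod T) = {0..<T}"
    using assms by (auto simp: rmod_less rmod_nonneg)
  then show ?thesis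
    using assms by (auto simp: quotient_map_def topspace_circle_topology openin_circle_topology)
qed

definition autonomized_space :: "real \<Rightarrow> (real \<times> (real^'d)) topology" where
  "autonomized_space T = prod_topology (circle_topology T) euclidean"

definition psi_autonomized ::
  "(real^'p \<Rightarrow> real^'d^'d) \<Rightarrow> (real^'p \<Rightarrow> real^'m^'d) \<Rightarrow> real \<Rightarrow> (real \<Rightarrow> real^'p) \<Rightarrow>
   real \<Rightarrow> real \<times> (real^'d) \<Rightarrow> (real \<Rightarrow> real^'m) \<Rightarrow> real \<times> (real^'d)" where
  "psi_autonomized A B T v t z u =
     ((t + fst z) rmod T, psi A B t (snd z) (u, \<lambda>s. v (fst z + s)))"

text \<open>
  The control set with nonvoid interior of the autonomized system, which is unique if the
  system for \<open>v\<close> with unconstrained controls is controllable.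
\<close>

definition periodic_control_set ::
  "(real^'p \<Rightarrow> real^'d^'d) \<Rightarrow> (real^'p \<Rightarrow> real^'m^'d) \<Rightarrow> (real^'m) set \<Rightarrow>
   real \<Rightarrow> (real \<Rightarrow> real^'p) \<Rightarrow> (real \<times> (real^'d)) set" where
  "periodic_control_set A B U T v =
     (THE D. control_set (autonomized_space T) (controls U) (psi_autonomized A B T v) D \<and>
             autonomized_space T interior_of D \<noteq> {})"

end

theory Submission
  imports Defs
begin

text \<open>
  Let \<open>E\<close> be the set of points that are reachable from \<open>0\<close> and from which \<open>0\<close> is reachable; the control
  set in question is the one containing \<open>E\<close>, and its closure is that of \<open>E\<close>. The link to
  the periodic systems is a scaling argument. Every \<open>x \<in> E\<close> lies on a closed trajectory, whose controls
  \<open>(u, v)\<close> may be continued periodically. For \<open>\<alpha> < 1\<close> the multiple \<open>\<alpha> x\<close> lies on the closed trajectory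
  for \<open>(\<alpha> u, v)\<close>, which leaves room in \<open>U\<close> for the small corrections provided by controllability for
  \<open>v\<close>: these join a whole neighbourhood of \<open>\<alpha> x\<close> to \<open>0\<close> in both directions with \<open>v\<close> kept fixed. So the points
  \<open>(s, \<alpha> x(s))\<close> of the scaled trajectory are interior to \<open>D\<^sup>a\<^sub>v\<close>. The same argument identifies any control set with
  nonvoid interior: an interior point returns to itself, exactly by local accessibility for the
  quasi-affine system, approximately and up to a small final correction for the autonomized one, and
  hence a multiple \<open>\<alpha> x\<close> of it belongs to the core.
\<close>

text \<open>For fixed \<open>v\<close> the equation is linear in the pair of \<open>u\<close> and
  the state, while \<open>v\<close> enters nonlinearly. Hence trajectories may be added and scaled
  only as long as \<open>v\<close> is untouched, and every correction has to be made by
  \<open>u\<close> alone. Convexity of \<open>U\<close> together with a ball around 0 in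
  \<open>U\<close> turns the factor 1 - \<alpha> into room for such corrections. The obstacle is
  that this room is small, whereas \<alpha> x may be far from 0; it is overcome by chaining many
  small steps. For this each step must take a whole number of periods, so that \<open>v\<close>
  restarts at the same phase. The two return arguments differ because local accessibility is given
  for the quasi-affine system only, where the open interior of a controllable set can be entered
  exactly; in the autonomized system the phase advances at unit speed, and approximate reachability
  within a control set is what is at hand. Since \<open>psi\<close> and
  \<open>periodic_control_set\<close> are definite descriptions, existence and uniqueness have to be
  established before anything can be said about them.\<close>

section \<open>Caratheodory solutions of Lipschitz equations\<close>

text \<open>The weight with rate \<open>2 * K\<close> instead of the sharp \<open>K\<close> makes a
  maximum argument sufficient: where \<open>g\<close> attains its maximum \<open>m\<close>, the
  weighted integral term is at most \<open>m / 2\<close>, so \<open>m \<le> c + m / 2\<close>. No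
  differentiation of \<open>z\<close> is involved; the price is the factor 2 and the doubled
  rate.\<close>

lemma gronwall_doubled_rate:
  fixes z :: "real \<Rightarrow> real"
  assumes K: "K > 0" and c: "c \<ge> 0" and cont: "continuous_on {a..b} z"
    and nonneg: "\<And>t. t \<in> {a..b} \<Longrightarrow> 0 \<le> z t"
    and le: "\<And>t. t \<in> {a..b} \<Longrightarrow> z t \<le> c + K * integral {a..t} z"
    and t: "t \<in> {a..b}"
  shows "z t \<le> 2 * c * exp (2 * K * (t - a))"
proof -
  define g where "g t = exp (- 2 * K * (t - a)) * z t" for t
  have "continuous_on {a..b} g"
    unfolding g_def by (intro continuous_intros cont)
  moreover have "{a..b} \<noteq> {}" using t by auto
  ultimately obtain t0 where t0: "t0 \<in> {a..b}" and max: "\<And>r. r \<in> {a..b} \<Longrightarrow> g r \<le> g t0"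
    using continuous_attains_sup[of "{a..b}" g] by auto
  define m where "m = g t0"
  have z_eq: "z r = exp (2 * K * (r - a)) * g r" for r
    by (simp add: g_def exp_minus field_simps flip: exp_add)
  have m0: "m \<ge> 0" using nonneg[OF t0] by (simp add: m_def g_def)
  have hI: "((\<lambda>r. m * exp (2 * K * (r - a))) has_integral
      m / (2*K) * exp (2 * K * (t0 - a)) - m / (2*K) * exp (2 * K * (a - a))) {a..t0}"
    using t0 K
    by (intro fundamental_theorem_of_calculus)
      (auto intro!: derivative_eq_intros simp flip: has_real_derivative_iff_has_vector_derivative)
  have "integral {a..t0} z \<le> m / (2*K) * exp (2 * K * (t0 - a)) - m / (2*K) * exp (2 * K * (a - a))"
  proof (rule has_integral_le[OF integrable_integral hI])
    show "z integrable_on {a..t0}"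
      using cont t0 by (intro integrable_continuous_real) (auto intro: continuous_on_subset)
    fix r assume "r \<in> {a..t0}"
    then have "g r \<le> m" using max[of r] t0 by (auto simp: m_def)
    then show "z r \<le> m * exp (2 * K * (r - a))"
      unfolding z_eq by (simp add: mult.commute)
  qed
  then have "K * integral {a..t0} z \<le> K * (m / (2*K) * exp (2 * K * (t0 - a)) - m / (2*K))"
    using K by (intro mult_left_mono) auto
  also have "\<dots> = m / 2 * exp (2 * K * (t0 - a)) - m / 2"
    using K by (simp add: field_simps)
  finally have "z t0 \<le> c + m / 2 * exp (2 * K * (t0 - a))"
    using le[OF t0] m0 by linarith
  then have "m \<le> exp (- 2 * K * (t0 - a)) * (c + m / 2 * exp (2 * K * (t0 - a)))"
    by (simp add: m_def g_def)
  also have "\<dots> = exp (- 2 * K * (t0 - a)) * c + m / 2"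
    by (simp add: field_simps exp_minus flip: exp_add)
  also have "\<dots> \<le> c + m / 2"
    using c K t0 by (intro add_right_mono mult_left_le_one_le) auto
  finally have "m \<le> 2 * c" by simp
  then have "g t \<le> 2 * c" using max[OF t] by (simp add: m_def)
  then show ?thesis
    unfolding z_eq by (simp add: mult.commute)
qed

lemma caratheodory_solutionD:
  assumes "caratheodory_solution J f x" "s \<in> J" "t \<in> J" "s \<le> t"
  shows "(\<lambda>r. f r (x r)) absolutely_integrable_on {s..t}"
    and "(\<lambda>r. f r (x r)) integrable_on {s..t}"
    and "x t = x s + integral {s..t} (\<lambda>r. f r (x r))"
proof -
  show *: "(\<lambda>r. f r (x r)) absolutely_integrable_on {s..t}" "x t = x s + integral {s..t} (\<lambda>r. f r (x r))"
    using assms unfolding caratheodory_solution_def by blast+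
  show "(\<lambda>r. f r (x r)) integrable_on {s..t}"
    using *(1) by (simp add: absolutely_integrable_on_def)
qed

lemma caratheodory_solution_subset:
  "caratheodory_solution J f x \<Longrightarrow> I \<subseteq> J \<Longrightarrow> caratheodory_solution I f x"
  unfolding caratheodory_solution_def by blast

lemma caratheodory_solution_UNIV_iff:
  "caratheodory_solution UNIV f x \<longleftrightarrow> (\<forall>a b. caratheodory_solution {a..b} f x)"
proof
  assume *: "\<forall>a b. caratheodory_solution {a..b} f x"
  show "caratheodory_solution UNIV f x"
    unfolding caratheodory_solution_def
  proof (intro ballI impI)
    fix s t :: real assume "s \<le> t"
    then show "(\<lambda>r. f r (x r)) absolutely_integrable_on {s..t} \<and>
        x t = x s + integral {s..t} (\<lambda>r. f r (x r))"
      using *[rule_format, of s t] by (auto intro: caratheodory_solutionD)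
  qed
qed (auto intro: caratheodory_solution_subset)

text \<open>The equation is integrated, so a null set of times does not matter; this is what makes
  trajectories insensitive to the representative of a control.\<close>

lemma caratheodory_solution_cong:
  assumes sol: "caratheodory_solution {a..b} f x"
    and xy: "\<And>t. t \<in> {a..b} \<Longrightarrow> x t = y t"
    and ae: "AE t in lebesgue. t \<in> {a..b} \<longrightarrow> f t (y t) = g t (y t)"
  shows "caratheodory_solution {a..b} g y"
  unfolding caratheodory_solution_def
proof (intro ballI impI)
  fix s t assume st: "s \<in> {a..b}" "t \<in> {a..b}" "s \<le> t"
  obtain N where N: "N \<in> null_sets lebesgue" "{t \<in> space lebesgue. \<not> (t \<in> {a..b} \<longrightarrow> f t (y t) = g t (y t))} \<subseteq> N"
    using ae unfolding eventually_ae_filter by blast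
  have neg: "negligible N" using N(1) by (simp add: negligible_iff_null_sets)
  have eq: "g r (y r) = f r (x r)" if "r \<in> {s..t} - N" for r

  proof -
    have "r \<in> {a..b}" "r \<notin> N" using that st by auto
    then have "f r (y r) = g r (y r)" "x r = y r" using N(2) xy by auto
    then show ?thesis by simp
  qed
  note D = caratheodory_solutionD[OF sol st]
  have "integral {s..t} (\<lambda>r. g r (y r)) = integral {s..t} (\<lambda>r. f r (x r))"
    using neg eq by (intro integral_spike) auto
  moreover have "(\<lambda>r. g r (y r)) absolutely_integrable_on {s..t}"
    using absolutely_integrable_spike[OF D(1) neg eq] .
  ultimately show "(\<lambda>r. g r (y r)) absolutely_integrable_on {s..t} \<and>
        y t = y s + integral {s..t} (\<lambda>r. g r (y r))"
    using D(3) xy st by auto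
qed

lemma caratheodory_solution_continuous_on:
  assumes sol: "caratheodory_solution {a..b} f x"
  shows "continuous_on {a..b} x"
proof (cases "a \<le> b")
  case True
  have "continuous_on {a..b} (\<lambda>t. x a + integral {a..t} (\<lambda>r. f r (x r)))"
    using caratheodory_solutionD(2)[OF sol, of a b] True
    by (intro continuous_intros indefinite_integral_continuous_1) auto
  then show ?thesis
    by (rule continuous_on_eq) (use caratheodory_solutionD(3)[OF sol, of a, symmetric] True in auto)
qed auto

lemma continuous_on_UNIV_if_Icc:
  fixes x :: "real \<Rightarrow> 'a::topological_space"
  assumes "\<And>a b. continuous_on {a..b} x"
  shows "continuous_on UNIV x"
proof -
  have "isCont x t" for t
    using assms[of "t - 1" "t + 1"] by (rule continuous_on_interior) auto
  then show ?thesis by (simp add: continuous_at_imp_continuous_on)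
qed

lemma caratheodory_solution_continuous_on_UNIV:
  "caratheodory_solution UNIV f x \<Longrightarrow> continuous_on UNIV x"
  by (meson continuous_on_UNIV_if_Icc caratheodory_solution_continuous_on caratheodory_solution_UNIV_iff)

lemma caratheodory_solution_combine:
  assumes ac: "caratheodory_solution {a..c} f x" and cb: "caratheodory_solution {c..b} f x"
    and "a \<le> c" "c \<le> b"
  shows "caratheodory_solution {a..b} f x"
  unfolding caratheodory_solution_def
proof (intro ballI impI)
  fix s t assume st: "s \<in> {a..b}" "t \<in> {a..b}" "s \<le> t"
  consider "t \<le> c" | "c \<le> s" | "s \<le> c" "c \<le> t" by linarith
  then show "(\<lambda>r. f r (x r)) absolutely_integrable_on {s..t} \<and>
        x t = x s + integral {s..t} (\<lambda>r. f r (x r))"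
  proof cases
    case 1
    then show ?thesis using caratheodory_solutionD[OF ac, of s t] st by auto
  next
    case 2
    then show ?thesis using caratheodory_solutionD[OF cb, of s t] st by auto
  next
    case 3
    note D1 = caratheodory_solutionD[OF ac, of s c] and D2 = caratheodory_solutionD[OF cb, of c t]
    have "(\<lambda>r. f r (x r)) absolutely_integrable_on {s..t}"
      using D1(1) D2(1) st 3 by (auto intro: absolutely_integrable_on_combine)
    moreover from this have "integral {s..c} (\<lambda>r. f r (x r)) + integral {c..t} (\<lambda>r. f r (x r))
        = integral {s..t} (\<lambda>r. f r (x r))"
      using 3 by (intro Henstock_Kurzweil_Integration.integral_combine) (auto simp: absolutely_integrable_on_def)
    ultimately show ?thesis using D1(3) D2(3) st 3 by auto
  qed
qed

text \<open>Time reversal reduces estimates from the right end point to those from the left one, and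
  hence backward uniqueness and bounds around a terminal point to their forward versions.\<close>

lemma caratheodory_solution_reflect:
  assumes sol: "caratheodory_solution {a..b} f x"
  shows "caratheodory_solution {-b..-a} (\<lambda>r y. - f (- r) y) (\<lambda>r. x (- r))"
  unfolding caratheodory_solution_def
proof (intro ballI impI)
  fix s t assume st: "s \<in> {-b..-a}" "t \<in> {-b..-a}" "s \<le> t"
  note D = caratheodory_solutionD[OF sol, of "-t" "-s"]
  have "(\<lambda>r. f r (x r)) absolutely_integrable_on {-t..-s}" using D(1) st by auto
  then have *: "(\<lambda>r. f (-r) (x (-r))) absolutely_integrable_on {s..t}"
    using absolutely_integrable_reflect_real[where f = "\<lambda>r. f r (x r)" and a = "-t" and b = "-s"] by simp
  then have "(\<lambda>r. - f (-r) (x (-r))) absolutely_integrable_on {s..t}"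
    by (simp add: absolutely_integrable_on_def integrable_neg)
  moreover have "integral {s..t} (\<lambda>r. f (-r) (x (-r))) = integral {-t..-s} (\<lambda>r. f r (x r))"
    using Henstock_Kurzweil_Integration.integral_reflect_real[where f = "\<lambda>r. f r (x r)" and a = "-t" and b = "-s"] by simp
  ultimately show "(\<lambda>r. - f (- r) (x (- r))) absolutely_integrable_on {s..t} \<and>
       x (- t) = x (- s) + integral {s..t} (\<lambda>r. - f (- r) (x (- r)))"
    using D(3) st by (auto simp: integral_neg)
qed

lemma caratheodory_forward_estimate:
  assumes x: "caratheodory_solution {a..b} f x" and y: "caratheodory_solution {a..b} f y"
    and K: "K > 0" and lip: "\<And>r p q. norm (f r p - f r q) \<le> K * norm (p - q)"
    and t: "t \<in> {a..b}"
  shows "norm (x t - y t) \<le> 2 * norm (x a - y a) * exp (2 * K * (t - a))"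
proof (rule gronwall_doubled_rate[OF K, of _ a b])
  show c: "continuous_on {a..b} (\<lambda>t. norm (x t - y t))"
    using caratheodory_solution_continuous_on x y by (intro continuous_intros) blast+
  fix s assume s: "s \<in> {a..b}"
  note Dx = caratheodory_solutionD[OF x, of a s] and Dy = caratheodory_solutionD[OF y, of a s]
  have ab: "a \<in> {a..b}" using s by auto
  have eq: "x s - y s = (x a - y a) + integral {a..s} (\<lambda>r. f r (x r) - f r (y r))"
    using Dx(2,3) Dy(2,3) s ab by (auto simp: integral_diff)
  have "norm (integral {a..s} (\<lambda>r. f r (x r) - f r (y r))) \<le> integral {a..s} (\<lambda>r. K * norm (x r - y r))"
  proof (rule integral_norm_bound_integral)
    show "(\<lambda>r. f r (x r) - f r (y r)) integrable_on {a..s}"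
      using Dx(2) Dy(2) s ab by (auto intro: integrable_diff)
    show "(\<lambda>r. K * norm (x r - y r)) integrable_on {a..s}"
      using continuous_on_subset[OF c, of "{a..s}"] s
      by (intro integrable_continuous_real continuous_on_mult continuous_on_const) auto
  qed (use lip in auto)
  then show "norm (x s - y s) \<le> norm (x a - y a) + K * integral {a..s} (\<lambda>r. norm (x r - y r))"
    unfolding eq by (intro order_trans[OF norm_triangle_ineq]) auto
qed (use t in auto)

lemma caratheodory_backward_estimate:
  assumes x: "caratheodory_solution {a..b} f x" and y: "caratheodory_solution {a..b} f y"
    and K: "K > 0" and lip: "\<And>r p q. norm (f r p - f r q) \<le> K * norm (p - q)"
    and t: "t \<in> {a..b}"
  shows "norm (x t - y t) \<le> 2 * norm (x b - y b) * exp (2 * K * (b - t))"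
proof -
  have "norm (- f (-r) p - - f (-r) q) \<le> K * norm (p - q)" for r p q
    using lip[of "-r" p q] by (simp add: norm_minus_commute)
  from caratheodory_forward_estimate[OF caratheodory_solution_reflect[OF x]
      caratheodory_solution_reflect[OF y] K this, of "-t"]
  show ?thesis using t by simp
qed

text \<open>The right-hand side is compared with its size at the fixed point \<open>x a\<close>:
  \<open>C\<close> bounds the speed there, the rest is Lipschitz growth. The result is of order
  \<open>b - a\<close>, so short trajectories do not go far, uniformly in all right-hand sides with
  the same constants.\<close>

lemma caratheodory_displacement_estimate:
  assumes x: "caratheodory_solution {a..b} f x"
    and K: "K > 0" and C: "\<And>r p. norm (f r p) \<le> C + K * norm (p - x a)"
    and t: "t \<in> {a..b}"
  shows "norm (x t - x a) \<le> 2 * (C * (b - a)) * exp (2 * K * (t - a))"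
proof (rule gronwall_doubled_rate[OF K, of _ a b])
  have C0: "C \<ge> 0" using order_trans[OF norm_ge_zero C, of "x a"] by simp
  then show "0 \<le> C * (b - a)" using t by auto
  show c: "continuous_on {a..b} (\<lambda>t. norm (x t - x a))"
    using caratheodory_solution_continuous_on x by (intro continuous_intros) blast+
  fix s assume s: "s \<in> {a..b}"
  note Dx = caratheodory_solutionD[OF x, of a s]
  have ab: "a \<in> {a..b}" using s by auto
  have c': "continuous_on {a..s} (\<lambda>t. norm (x t - x a))"
    using continuous_on_subset[OF c, of "{a..s}"] s by auto
  have "norm (x s - x a) = norm (integral {a..s} (\<lambda>r. f r (x r)))"
    using Dx(3) s ab by auto
  also have "\<dots> \<le> integral {a..s} (\<lambda>r. C + K * norm (x r - x a))"
    using Dx(2) s ab C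
    by (intro integral_norm_bound_integral integrable_continuous_real[OF continuous_on_add]
        continuous_on_mult continuous_on_const c') auto
  also have "\<dots> = C * (s - a) + K * integral {a..s} (\<lambda>r. norm (x r - x a))"
    using s by (subst integral_add) (auto intro!: integrable_continuous_real continuous_intros c')
  also have "\<dots> \<le> C * (b - a) + K * integral {a..s} (\<lambda>r. norm (x r - x a))"
    using C0 s by (intro add_right_mono mult_left_mono) auto
  finally show "norm (x s - x a) \<le> C * (b - a) + K * integral {a..s} (\<lambda>r. norm (x r - x a))" .
qed (use t in auto)

section \<open>Global existence on the real line\<close>

locale lipschitz_field =
  fixes f :: "real \<Rightarrow> 'a::euclidean_space \<Rightarrow> 'a" and K :: real
  assumes K_pos: "K > 0"
    and lip: "\<And>r x y. norm (f r x - f r y) \<le> K * norm (x - y)"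
    and bound_0: "\<And>r. norm (f r 0) \<le> K"
    and meas: "\<And>x. continuous_on UNIV x \<Longrightarrow> (\<lambda>r. f r (x r)) \<in> borel_measurable lebesgue"
begin

lemma norm_le: "norm (f r x) \<le> K * (1 + norm x)"
  using lip[of r x 0] bound_0[of r] norm_triangle_sub[of "f r x" "f r 0"] by (simp add: algebra_simps)

lemma absolutely_integrable:
  assumes x: "continuous_on UNIV x"
  shows "(\<lambda>r. f r (x r)) absolutely_integrable_on {s..t}"
proof (rule measurable_bounded_by_integrable_imp_absolutely_integrable)
  show "(\<lambda>r. f r (x r)) \<in> borel_measurable (lebesgue_on {s..t})"
    using meas[OF x] by (rule measurable_restrict_space1)
  show "(\<lambda>r. K * (1 + norm (x r))) integrable_on {s..t}"
    by (intro integrable_continuous_real continuous_intros continuous_on_subset[OF x]) auto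
qed (use norm_le in auto)

text \<open>The signed integral from \<open>s\<close> to \<open>t\<close>: at most one of the two intervals is nondegenerate.\<close>

definition signed_integral :: "(real \<Rightarrow> 'a) \<Rightarrow> real \<Rightarrow> real \<Rightarrow> 'a" where
  "signed_integral h s t = integral {s..t} h - integral {t..s} h"

lemma signed_integral_diff:
  assumes h: "\<And>a b. h integrable_on {a..b}" and "a \<le> b"
  shows "signed_integral h s b = signed_integral h s a + integral {a..b} h"
proof -
  have c: "integral {p..q} h + integral {q..r} h = integral {p..r} h" if "p \<le> q" "q \<le> r" for p q r
    using Henstock_Kurzweil_Integration.integral_combine[OF that h] .
  have deg: "integral {p..q} h = 0" if "q \<le> p" for p q
    using that by (cases "p = q") auto
  consider "b \<le> s" | "s \<le> a" | "a \<le> s" "s \<le> b" by linarith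
  then show ?thesis
  proof cases
    case 1
    with \<open>a \<le> b\<close> show ?thesis
      unfolding signed_integral_def by (simp add: deg flip: c[of a b s])
  next
    case 2
    with \<open>a \<le> b\<close> show ?thesis
      unfolding signed_integral_def by (simp add: deg flip: c[of s a b])
  next
    case 3
    with \<open>a \<le> b\<close> show ?thesis
      unfolding signed_integral_def by (simp add: deg flip: c[of a s b])
  qed
qed

text \<open>The antiderivative of the exponential bound carries the factor \<open>D / 2\<close> in
  place of \<open>D * K\<close>; this halving is the contraction constant of the Picard
  operator.\<close>

lemma signed_integral_bound:
  assumes h: "\<And>a b. h integrable_on {a..b}" and D: "D \<ge> 0"
    and le: "\<And>r. norm (h r) \<le> D * K * exp (2 * K * \<bar>r - s\<bar>)"
  shows "norm (signed_integral h s t) \<le> D / 2 * exp (2 * K * \<bar>t - s\<bar>)"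
proof -
  have le_right: "norm (integral {s..t} h) \<le> D / 2 * exp (2 * K * (t - s)) - D / 2" if "s \<le> t"
  proof -
    have hI: "((\<lambda>r. D * K * exp (2 * K * (r - s))) has_integral
        D / 2 * exp (2 * K * (t - s)) - D / 2 * exp (2 * K * (s - s))) {s..t}"
      using that K_pos
      by (intro fundamental_theorem_of_calculus)
        (auto intro!: derivative_eq_intros simp flip: has_real_derivative_iff_has_vector_derivative)
    have "norm (integral {s..t} h) \<le> integral {s..t} (\<lambda>r. D * K * exp (2 * K * (r - s)))"
      using le hI by (intro integral_norm_bound_integral h) (auto, metis abs_of_nonneg diff_ge_0_iff_ge)
    then show ?thesis using integral_unique[OF hI] by simp
  qed
  have le_left: "norm (integral {t..s} h) \<le> D / 2 * exp (2 * K * (s - t)) - D / 2" if "t \<le> s"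
  proof -
    have hI: "((\<lambda>r. D * K * exp (2 * K * (s - r))) has_integral
        - (D / 2) * exp (2 * K * (s - s)) - - (D / 2) * exp (2 * K * (s - t))) {t..s}"
      using that K_pos
      by (intro fundamental_theorem_of_calculus)
        (auto intro!: derivative_eq_intros simp flip: has_real_derivative_iff_has_vector_derivative)
    have "norm (h r) \<le> D * K * exp (2 * K * (s - r))" if "r \<in> {t..s}" for r
      using le[of r] that by (simp add: abs_minus_commute)
    then have "norm (integral {t..s} h) \<le> integral {t..s} (\<lambda>r. D * K * exp (2 * K * (s - r)))"
      using hI by (intro integral_norm_bound_integral h) auto
    then show ?thesis using integral_unique[OF hI] by simp
  qed
  show ?thesis
  proof (cases "s \<le> t")
    case True
    then have "integral {t..s} h = 0" by (cases "s = t") auto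
    then show ?thesis using le_right[OF True] True D by (simp add: signed_integral_def)
  next
    case False
    then have "integral {s..t} h = 0" by auto
    then show ?thesis using le_left False D by (simp add: signed_integral_def)
  qed
qed

lemma signed_integral_continuous:
  assumes h: "\<And>a b. h integrable_on {a..b}"
  shows "continuous_on UNIV (signed_integral h s)"
proof (rule continuous_on_UNIV_if_Icc)
  fix a b
  have "continuous_on {a..b} (\<lambda>t. signed_integral h s a + integral {a..t} h)"
    by (intro continuous_intros indefinite_integral_continuous_1 h)
  then show "continuous_on {a..b} (signed_integral h s)"
    by (rule continuous_on_eq) (use signed_integral_diff[OF h, of a _ s, symmetric] in auto)
qed

text \<open>In the sup norm weighted by \<open>exp (- 2 K \<bar>t - s\<bar>)\<close> the Picard operator is a contraction on the
  whole real line.\<close>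

theorem ex_caratheodory_solution: "\<exists>x. caratheodory_solution UNIV f x \<and> x s = x0"
proof -
  \<comment> \<open>The unknown is \<open>y\<close> with \<open>x = e y\<close>: solutions may grow
    exponentially, but with the weight divided out the Picard iterates remain bounded continuous
    functions, which form a complete space.\<close>
  define e where "e t = exp (2 * K * \<bar>t - s\<bar>)" for t
  define h where "h y r = f r (e r *\<^sub>R apply_bcontfun y r)" for y :: "real \<Rightarrow>\<^sub>C 'a" and r
  define P0 where "P0 y t = inverse (e t) *\<^sub>R (x0 + signed_integral (h y) s t)" for y t
  have e1: "e t \<ge> 1" for t unfolding e_def using K_pos by simp
  then have e0: "e t > 0" for t by (metis less_le_trans zero_less_one)
  have e_cont: "continuous_on UNIV e" unfolding e_def by (intro continuous_intros)
  have h_ai: "h y absolutely_integrable_on {a..b}" for y a b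
    unfolding h_def by (intro absolutely_integrable continuous_intros e_cont) auto
  then have h_int: "h y integrable_on {a..b}" for y a b
    by (auto simp: absolutely_integrable_on_def)
  have bcont: "P0 y \<in> bcontfun" for y
  proof -
    obtain N where N: "\<And>t. norm (apply_bcontfun y t) \<le> N"
      using bounded_apply_bcontfun[of y] by (auto simp: bounded_iff)
    have N0: "N \<ge> 0" using order_trans[OF norm_ge_zero N] .
    have hb: "norm (h y r) \<le> (1 + N) * K * exp (2 * K * \<bar>r - s\<bar>)" for r
    proof -
      have "norm (h y r) \<le> K * (1 + e r * norm (apply_bcontfun y r))"
        using norm_le[of r "e r *\<^sub>R apply_bcontfun y r"] e0[of r] by (simp add: h_def)
      also have "\<dots> \<le> K * (e r + e r * N)"
        using K_pos e1[of r] e0[of r] N[of r] by (intro mult_left_mono add_mono) auto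
      finally show ?thesis by (simp add: e_def algebra_simps)
    qed
    have "norm (P0 y t) \<le> norm x0 + (1 + N) / 2" for t
    proof -
      have "norm (x0 + signed_integral (h y) s t) \<le> norm x0 + (1 + N) / 2 * e t"
        using signed_integral_bound[OF h_int _ hb] N0 unfolding e_def
        by (intro order_trans[OF norm_triangle_ineq] add_left_mono) auto
      also have "\<dots> \<le> e t * (norm x0 + (1 + N) / 2)"
        using e1[of t] mult_right_mono[OF e1[of t], of "norm x0"] by (simp add: algebra_simps)
      finally show ?thesis
        using e0[of t] by (simp add: P0_def pos_divide_le_eq mult.commute flip: divide_inverse_commute del: scaleR_right_distrib)
    qed
    then have "bounded (range (P0 y))" by (auto simp: bounded_iff)
    moreover have "continuous_on UNIV (P0 y)"
      unfolding P0_def using e0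
      by (intro continuous_intros e_cont signed_integral_continuous h_int) (metis less_irrefl)
    ultimately show ?thesis by (simp add: bcontfun_def)
  qed
  define P where "P y = Bcontfun (P0 y)" for y
  have P_app: "apply_bcontfun (P y) = P0 y" for y
    unfolding P_def using bcont by (simp add: Bcontfun_inverse)
  have contr: "dist (P y) (P z) \<le> 1/2 * dist y z" for y z
  proof (rule dist_bound)
    fix t
    have hb: "norm (h y r - h z r) \<le> dist y z * K * exp (2 * K * \<bar>r - s\<bar>)" for r
    proof -
      have "norm (h y r - h z r) \<le> K * (e r * norm (apply_bcontfun y r - apply_bcontfun z r))"
        using lip[of r "e r *\<^sub>R apply_bcontfun y r" "e r *\<^sub>R apply_bcontfun z r"] e0[of r]
        by (simp add: h_def flip: scaleR_diff_right)
      also have "\<dots> \<le> K * (e r * dist y z)"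
        using K_pos e0[of r] dist_bounded[of y r z] by (intro mult_left_mono) (auto simp: dist_norm)
      finally show ?thesis by (simp add: e_def algebra_simps)
    qed
    have "signed_integral (h y) s t - signed_integral (h z) s t
        = signed_integral (\<lambda>r. h y r - h z r) s t"
      unfolding signed_integral_def by (simp add: integral_diff h_int)
    also have "norm \<dots> \<le> dist y z / 2 * exp (2 * K * \<bar>t - s\<bar>)"
      by (intro signed_integral_bound hb integrable_diff h_int) auto
    finally have *: "norm (signed_integral (h y) s t - signed_integral (h z) s t) \<le> dist y z / 2 * e t"
      by (simp add: e_def)
    have "dist (P0 y t) (P0 z t) = inverse (e t) * norm (signed_integral (h y) s t - signed_integral (h z) s t)"
      using e0[of t] by (simp add: P0_def dist_norm flip: scaleR_diff_right)
    also have "\<dots> \<le> inverse (e t) * (dist y z / 2 * e t)"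
      using * e0[of t] by (intro mult_left_mono) auto
    also have "\<dots> = 1/2 * dist y z" using e0[of t] by (simp add: field_simps)
    finally show "dist (P y t) (P z t) \<le> 1/2 * dist y z" by (simp add: P_app)
  qed
  obtain y where y: "P y = y"
    using banach_fix_type[of "1/2" P] contr by auto
  define x where "x t = e t *\<^sub>R apply_bcontfun y t" for t
  have x_eq: "x t = x0 + signed_integral (h y) s t" for t
    using P_app[of y] e0[of t] by (simp add: x_def y P0_def)
  have h_eq: "(\<lambda>r. f r (x r)) = h y" by (simp add: h_def x_def fun_eq_iff)
  have "x b = x a + integral {a..b} (h y)" if "a \<le> b" for a b
  proof -
    have "signed_integral (h y) s b = signed_integral (h y) s a + integral {a..b} (h y)"
      by (rule signed_integral_diff[OF h_int that])
    then show ?thesis unfolding x_eq[of a] x_eq[of b] by simp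
  qed
  then have "caratheodory_solution UNIV f x"
    unfolding caratheodory_solution_def h_eq using h_ai by blast
  moreover have "x s = x0" by (simp add: x_eq signed_integral_def)
  ultimately show ?thesis by blast
qed

end

section \<open>Control sets of abstract control systems\<close>

lemma reachable_set_eq: "reachable_set Adm \<phi> x = {\<phi> t x w | t w. t \<ge> 0 \<and> w \<in> Adm}"
proof -
  have "\<exists>S>0. t \<le> S" if "t \<ge> 0" for t :: real
    using that by (intro exI[of _ "t + 1"]) auto
  then show ?thesis
    unfolding reachable_set_def reachable_upto_def by fastforce
qed

text \<open>Openness of the set of points that can be steered into a given open set replaces continuity
  of the individual maps \<open>\<phi> t _ w\<close>.\<close>

locale control_system =
  fixes X :: "'s topology" and Adm :: "'c set" and \<phi> :: "real \<Rightarrow> 's \<Rightarrow> 'c \<Rightarrow> 's"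
  assumes in_space: "p \<in> topspace X \<Longrightarrow> t \<ge> 0 \<Longrightarrow> w \<in> Adm \<Longrightarrow> \<phi> t p w \<in> topspace X"
    and zero: "p \<in> topspace X \<Longrightarrow> w \<in> Adm \<Longrightarrow> \<phi> 0 p w = p"
    and shift: "p \<in> topspace X \<Longrightarrow> w \<in> Adm \<Longrightarrow> t \<ge> 0 \<Longrightarrow>
      \<exists>w'\<in>Adm. \<forall>s\<ge>0. \<phi> s (\<phi> t p w) w' = \<phi> (t + s) p w"
    and concat: "p \<in> topspace X \<Longrightarrow> w1 \<in> Adm \<Longrightarrow> w2 \<in> Adm \<Longrightarrow> t \<ge> 0 \<Longrightarrow>
      \<exists>w\<in>Adm. (\<forall>s\<in>{0..t}. \<phi> s p w = \<phi> s p w1) \<and> (\<forall>s\<ge>0. \<phi> (t + s) p w = \<phi> s (\<phi> t p w1) w2)"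
    and open_pre: "openin X G \<Longrightarrow> openin X {p \<in> topspace X. \<exists>t\<ge>0. \<exists>w\<in>Adm. \<phi> t p w \<in> G}"
begin

abbreviation R :: "'s \<Rightarrow> 's set" where "R \<equiv> reachable_set Adm \<phi>"

lemma reachI: "t \<ge> 0 \<Longrightarrow> w \<in> Adm \<Longrightarrow> \<phi> t p w \<in> R p"
  by (auto simp: reachable_set_eq)

lemma reachE:
  assumes "q \<in> R p" obtains t w where "t \<ge> 0" "w \<in> Adm" "q = \<phi> t p w"
  using assms by (auto simp: reachable_set_eq)

lemma reach_in_space: "p \<in> topspace X \<Longrightarrow> q \<in> R p \<Longrightarrow> q \<in> topspace X"
  by (elim reachE) (simp add: in_space)

lemma reach_trans:
  assumes p: "p \<in> topspace X" and q: "q \<in> R p" and r: "r \<in> R q"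
  shows "r \<in> R p"
proof -
  obtain t w1 where 1: "t \<ge> 0" "w1 \<in> Adm" "q = \<phi> t p w1" using q by (rule reachE)
  obtain s w2 where 2: "s \<ge> 0" "w2 \<in> Adm" "r = \<phi> s q w2" using r by (rule reachE)
  obtain w where "w \<in> Adm" "\<forall>s\<ge>0. \<phi> (t + s) p w = \<phi> s (\<phi> t p w1) w2"
    using concat[OF p 1(2) 2(2) 1(1)] by blast
  then have "r = \<phi> (t + s) p w" using 1 2 by simp
  then show ?thesis using reachI[of "t + s" w p] 1 2 \<open>w \<in> Adm\<close> by simp
qed

text \<open>The points that can be steered into a neighbourhood \<open>G\<close> of \<open>r\<close>
  form an open set by \<open>open_pre\<close>, and \<open>q\<close> is one of them. So
  \<open>R p\<close> meets this set, and from the point met there is a continuation into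
  \<open>G\<close>.\<close>

lemma closure_of_reach_trans:
  assumes p: "p \<in> topspace X" and q: "q \<in> X closure_of R p" and r: "r \<in> X closure_of R q"
  shows "r \<in> X closure_of R p"
  unfolding in_closure_of
proof (intro conjI allI impI)
  show "r \<in> topspace X" using r by (simp add: in_closure_of)
  fix G assume G: "r \<in> G \<and> openin X G"
  define P where "P = {p \<in> topspace X. \<exists>t\<ge>0. \<exists>w\<in>Adm. \<phi> t p w \<in> G}"
  obtain y where "y \<in> R q" "y \<in> G" using r G unfolding in_closure_of by blast
  then have "q \<in> P" using q by (auto simp: P_def in_closure_of elim!: reachE)
  moreover have "openin X P" unfolding P_def using G by (intro open_pre) blast
  ultimately obtain z where z: "z \<in> R p" "z \<in> P" using q unfolding in_closure_of by blast
  then obtain y' where "y' \<in> R z" "y' \<in> G" unfolding P_def using reachI by fastforce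
  then show "\<exists>y. y \<in> R p \<and> y \<in> G" using reach_trans[OF p z(1)] by blast
qed

section \<open>Pre-control sets and maximality\<close>

abbreviation pre :: "'s set \<Rightarrow> bool" where "pre \<equiv> pre_control_set X Adm \<phi>"

text \<open>Reachability between different members is routed through the common point
  \<open>z\<close>: from \<open>p\<close> approximately to \<open>z\<close>, and from
  \<open>z\<close> approximately to \<open>q\<close>.\<close>

lemma pre_control_set_Union:
  assumes C: "\<And>P. P \<in> \<C> \<Longrightarrow> pre P" "\<And>P. P \<in> \<C> \<Longrightarrow> z \<in> P" and ne: "\<C> \<noteq> {}"
  shows "pre (\<Union>\<C>)"
  unfolding pre_control_set_def
proof (intro conjI ballI)
  have z: "z \<in> topspace X" and z_in: "z \<in> \<Union>\<C>"
    using C ne unfolding pre_control_set_def by blast+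
  from z_in show "\<Union>\<C> \<noteq> {}" by blast
  show "\<Union>\<C> \<subseteq> topspace X" using C(1) unfolding pre_control_set_def by blast
  fix p assume "p \<in> \<Union>\<C>"
  then obtain P where P: "P \<in> \<C>" "p \<in> P" by blast
  show "\<exists>w\<in>Adm. \<forall>t\<ge>0. \<phi> t p w \<in> \<Union>\<C>"
    using C(1)[OF P(1)] P unfolding pre_control_set_def by blast
  show "\<Union>\<C> \<subseteq> X closure_of R p"
  proof
    fix q assume "q \<in> \<Union>\<C>"
    then obtain Q where Q: "Q \<in> \<C>" "q \<in> Q" by blast
    have "z \<in> X closure_of R p" "p \<in> topspace X"
      using C[OF P(1)] P(2) unfolding pre_control_set_def by blast+
    moreover have "q \<in> X closure_of R z"
      using C[OF Q(1)] Q(2) unfolding pre_control_set_def by blast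
    ultimately show "q \<in> X closure_of R p" by (meson closure_of_reach_trans)
  qed
qed

text \<open>Pre-control sets through a common point are closed under arbitrary unions, so the union
  of all of them is already maximal; no chain argument is involved.\<close>

lemma ex_control_set_superset:
  assumes P: "pre P"
  obtains D where "control_set X Adm \<phi> D" "P \<subseteq> D"
proof -
  obtain z where z: "z \<in> P" using P unfolding pre_control_set_def by blast
  define D where "D = \<Union>{Q. pre Q \<and> z \<in> Q}"
  have "pre D" unfolding D_def by (rule pre_control_set_Union) (use P z in auto)
  moreover have "P \<subseteq> D" using P z by (auto simp: D_def)
  moreover have "D' = D" if "pre D'" "D \<subseteq> D'" for D'
    using that z \<open>P \<subseteq> D\<close> unfolding D_def by blast
  ultimately have "control_set X Adm \<phi> D" unfolding control_set_def by blast
  with \<open>P \<subseteq> D\<close> show ?thesis by (rule that[rotated])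
qed

lemma control_set_eqI:
  assumes D: "control_set X Adm \<phi> D" "control_set X Adm \<phi> D'" and z: "z \<in> D" "z \<in> D'"
  shows "D = D'"
proof -
  have "pre (\<Union>{D, D'})"
    by (rule pre_control_set_Union[of _ z]) (use D z in \<open>auto simp: control_set_def\<close>)
  then have "D \<union> D' = D" "D \<union> D' = D'"
    using D unfolding control_set_def by simp_all
  then show ?thesis by simp
qed

section \<open>Classes of mutually reachable points\<close>

definition core :: "'s \<Rightarrow> 's set" where "core z = {p \<in> R z. z \<in> R p}"

lemma coreI: "p \<in> R z \<Longrightarrow> z \<in> R p \<Longrightarrow> p \<in> core z"
  by (simp add: core_def)

lemma core_subset_topspace: "z \<in> topspace X \<Longrightarrow> core z \<subseteq> topspace X"
  by (auto simp: core_def intro: reach_in_space)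

text \<open>A trajectory goes from \<open>p\<close> to \<open>z\<close> and continues there with
  \<open>w0\<close>. Points on the first leg stay in the core because they come from
  \<open>z\<close> through \<open>p\<close> and lead to \<open>z\<close> by the rest of the
  leg.\<close>

lemma pre_control_set_core:
  assumes z: "z \<in> topspace X" and w0: "w0 \<in> Adm" and rest: "\<And>t. t \<ge> 0 \<Longrightarrow> \<phi> t z w0 \<in> core z"
  shows "pre (core z)"
  unfolding pre_control_set_def
proof (intro conjI ballI)
  show "core z \<noteq> {}" using rest[of 0] by auto
  show "core z \<subseteq> topspace X" by (rule core_subset_topspace[OF z])
  fix p assume p: "p \<in> core z"
  then have p_top: "p \<in> topspace X" using core_subset_topspace[OF z] by blast
  show "core z \<subseteq> X closure_of R p"
  proof
    fix q assume "q \<in> core z"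
    with p have "q \<in> R p" using reach_trans[OF p_top, of z q] by (auto simp: core_def)
    moreover have "R p \<subseteq> topspace X" using reach_in_space[OF p_top] by blast
    ultimately show "q \<in> X closure_of R p" using closure_of_subset by blast
  qed
  obtain t w1 where 1: "t \<ge> 0" "w1 \<in> Adm" "z = \<phi> t p w1"
    using p by (auto simp: core_def elim: reachE)
  obtain w where w: "w \<in> Adm" "\<forall>s\<in>{0..t}. \<phi> s p w = \<phi> s p w1"
      "\<forall>s\<ge>0. \<phi> (t + s) p w = \<phi> s (\<phi> t p w1) w0"
    using concat[OF p_top 1(2) w0 1(1)] by blast
  have "\<phi> s p w \<in> core z" if s: "s \<ge> 0" for s
  proof (cases "s \<le> t")
    case True
    obtain w' where w': "w' \<in> Adm" "\<forall>r\<ge>0. \<phi> r (\<phi> s p w1) w' = \<phi> (s + r) p w1"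
      using shift[OF p_top 1(2) s] by blast
    have "z = \<phi> (t - s) (\<phi> s p w1) w'" using w' True 1 by auto
    then have "z \<in> R (\<phi> s p w1)" using reachI[of "t - s" w' "\<phi> s p w1"] w' True by simp
    moreover have "\<phi> s p w1 \<in> R z"
      using reach_trans[OF z _ reachI[OF s 1(2)], of p] p by (auto simp: core_def)
    ultimately show ?thesis using w(2) True s by (auto intro: coreI)
  next
    case False
    then have "\<phi> s p w = \<phi> (s - t) z w0" using w(3)[rule_format, of "s - t"] 1 by simp
    then show ?thesis using rest[of "s - t"] False by simp
  qed
  then show "\<exists>w\<in>Adm. \<forall>t\<ge>0. \<phi> t p w \<in> core z" using w(1) by blast
qed

text \<open>Openness turns approximate into exact reachability in one direction: every point near
  \<open>p\<close> can be steered into \<open>G\<close>, hence to \<open>z\<close>. In the other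
  direction \<open>R z\<close> comes arbitrarily close to \<open>p\<close>. The points of
  \<open>R z\<close> near \<open>p\<close> therefore belong to the core.\<close>

lemma pre_control_set_subset_closure_core:
  assumes z: "z \<in> D" and D: "pre D" and G: "openin X G" "G \<noteq> {}" "G \<subseteq> core z" "G \<subseteq> D"
  shows "D \<subseteq> X closure_of core z"
proof
  fix p assume p: "p \<in> D"
  have top: "p \<in> topspace X" "z \<in> topspace X" using D p z unfolding pre_control_set_def by blast+
  define P where "P = {p \<in> topspace X. \<exists>t\<ge>0. \<exists>w\<in>Adm. \<phi> t p w \<in> G}"
  obtain g where g: "g \<in> G" "g \<in> X closure_of R p"
    using D p G unfolding pre_control_set_def by blast
  then obtain y where "y \<in> R p" "y \<in> G" using G(1) unfolding in_closure_of by blast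
  then have pP: "p \<in> P" using top by (auto simp: P_def elim!: reachE)
  have oP: "openin X P" unfolding P_def by (rule open_pre[OF G(1)])
  have P_C: "z \<in> R q" if q: "q \<in> P" for q
  proof -
    obtain y where "y \<in> R q" "y \<in> G" using q reachI unfolding P_def by fastforce
    then show ?thesis using reach_trans[of q y z] q G(3) by (auto simp: P_def core_def)
  qed
  have pz: "p \<in> X closure_of R z" using D p z unfolding pre_control_set_def by blast
  show "p \<in> X closure_of core z"
    unfolding in_closure_of
  proof (intro conjI allI impI top)
    fix W assume "p \<in> W \<and> openin X W"
    then have "p \<in> W \<inter> P \<and> openin X (W \<inter> P)" using pP oP by blast
    then obtain y where "y \<in> R z" "y \<in> W \<inter> P" using pz unfolding in_closure_of by metis
    then show "\<exists>y. y \<in> core z \<and> y \<in> W" using P_C by (auto intro: coreI)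
  qed
qed

text \<open>Both control systems are treated by this one criterion. The core lies in some control
  set, and distinct control sets are disjoint, so any control set that meets the core is that one.
  Apart from a resting control at \<open>z\<close>, only \<open>int\<close> and \<open>meet\<close>
  remain to be checked in each case.\<close>

theorem unique_control_set_interior:
  assumes z: "z \<in> topspace X" and w0: "w0 \<in> Adm" and rest: "\<And>t. t \<ge> 0 \<Longrightarrow> \<phi> t z w0 \<in> core z"
    and int: "X interior_of core z \<noteq> {}"
    and meet: "\<And>D. control_set X Adm \<phi> D \<Longrightarrow> X interior_of D \<noteq> {} \<Longrightarrow> D \<inter> core z \<noteq> {}"
  shows "\<exists>D. control_set X Adm \<phi> D \<and> core z \<subseteq> D \<and> D \<subseteq> X closure_of core z \<and>
    X interior_of D \<noteq> {} \<and>
    (\<forall>D'. control_set X Adm \<phi> D' \<and> X interior_of D' \<noteq> {} \<longrightarrow> D' = D)"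
proof -
  obtain D where D: "control_set X Adm \<phi> D" "core z \<subseteq> D"
    using ex_control_set_superset[OF pre_control_set_core[OF z w0 rest]] by metis
  have zD: "z \<in> D" using rest[of 0] zero[OF z w0] D(2) by auto
  show ?thesis
  proof (intro exI[of _ D] conjI allI impI D)
    show "D \<subseteq> X closure_of core z"
      using D(1) zD int interior_of_subset[of X "core z"] D(2)
      by (intro pre_control_set_subset_closure_core[of _ _ "X interior_of core z"])
        (auto simp: control_set_def)
    show "X interior_of D \<noteq> {}" using int interior_of_mono[OF D(2), of X] by blast
    fix D' assume D': "control_set X Adm \<phi> D' \<and> X interior_of D' \<noteq> {}"
    then obtain y where "y \<in> D'" "y \<in> core z" using meet by blast
    then show "D' = D" using control_set_eqI[OF _ D(1)] D' D(2) by blast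
  qed
qed

end

section \<open>The autonomized state space\<close>

lemma rmod_eqE:
  assumes "x rmod T = y rmod T"
  obtains n :: int where "x = y + of_int n * T"
proof -
  have "[y = x] (rmod T)" using assms by (simp add: rcong_def)
  then show ?thesis using that by (auto simp: rcong_altdef)
qed

lemma rmod_add_multiple [simp]: "(x + of_int n * T) rmod T = x rmod T"
proof -
  have "[x = x + of_int n * T] (rmod T)" unfolding rcong_altdef by blast
  then show ?thesis by (simp add: rcong_def)
qed

lemma openin_circle_topology_rmod_image:
  assumes T: "T > 0" and I: "open I"
  shows "openin (circle_topology T) ((\<lambda>t. t rmod T) ` I)"
  unfolding openin_circle_topology
proof
  show "(\<lambda>t. t rmod T) ` I \<subseteq> {0..<T}" using T by (auto simp: rmod_nonneg rmod_less)
  have "{t. t rmod T \<in> (\<lambda>t. t rmod T) ` I} = (\<Union>n::int. (\<lambda>t. of_int n * T + t) ` I)"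
  proof (intro set_eqI iffI)
    fix t assume "t \<in> {t. t rmod T \<in> (\<lambda>t. t rmod T) ` I}"
    then obtain i where i: "i \<in> I" "t rmod T = i rmod T" by auto
    then obtain n :: int where "t = i + of_int n * T" by (metis rmod_eqE)
    then show "t \<in> (\<Union>n::int. (\<lambda>t. of_int n * T + t) ` I)" using i by (auto simp: algebra_simps)
  next
    fix t assume "t \<in> (\<Union>n::int. (\<lambda>t. of_int n * T + t) ` I)"
    then obtain n :: int and i where "i \<in> I" "t = i + of_int n * T" by (auto simp: algebra_simps)
    then show "t \<in> {t. t rmod T \<in> (\<lambda>t. t rmod T) ` I}" by auto
  qed
  then show "open {t. t rmod T \<in> (\<lambda>t. t rmod T) ` I}"
    using open_translation[OF I] by auto
qed

lemma topspace_autonomized_space: "T > 0 \<Longrightarrow> topspace (autonomized_space T) = {0..<T} \<times> UNIV"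
  by (simp add: autonomized_space_def topspace_circle_topology)

text \<open>The circle is handled through periodic lifts: openness is tested for the preimage in the
  product of the real line with the state space, where balls and continuity of trajectories are
  available. The converse direction uses that reduction modulo \<open>T\<close> is an open
  map.\<close>

lemma openin_autonomized_space:
  fixes W :: "(real \<times> (real^'d)) set"
  assumes T: "T > 0"
  shows "openin (autonomized_space T) W \<longleftrightarrow>
    W \<subseteq> {0..<T} \<times> UNIV \<and> open {(t, x). (t rmod T, x) \<in> W}"
proof
  assume W: "openin (autonomized_space T) W"
  then have sub: "W \<subseteq> {0..<T} \<times> UNIV"
    using openin_subset[OF W] topspace_autonomized_space[OF T] by auto
  have "open {(t, x). (t rmod T, x) \<in> W}"
    unfolding open_prod_def
  proof
    fix z assume "z \<in> {(t, x). (t rmod T, x) \<in> W}"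
    then obtain t x where z: "z = (t, x)" "(t rmod T, x) \<in> W" by auto
    then obtain C J where CJ: "openin (circle_topology T) C" "open J" "t rmod T \<in> C" "x \<in> J" "C \<times> J \<subseteq> W"
      using W unfolding autonomized_space_def openin_prod_topology_alt by force
    then have "open {t. t rmod T \<in> C}" by (simp add: openin_circle_topology)
    then show "\<exists>A B. open A \<and> open B \<and> z \<in> A \<times> B \<and> A \<times> B \<subseteq> {(t, x). (t rmod T, x) \<in> W}"
      using CJ z by (intro exI[of _ "{t. t rmod T \<in> C}"] exI[of _ J]) auto
  qed
  with sub show "W \<subseteq> {0..<T} \<times> UNIV \<and> open {(t, x). (t rmod T, x) \<in> W}" by blast
next
  assume W: "W \<subseteq> {0..<T} \<times> UNIV \<and> open {(t, x). (t rmod T, x) \<in> W}"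
  show "openin (autonomized_space T) W"
    unfolding autonomized_space_def openin_prod_topology_alt
  proof (intro allI impI)
    fix t x assume tx: "(t, x) \<in> W"
    then have t: "t rmod T = t" using W by auto
    then have "(t, x) \<in> {(t, x). (t rmod T, x) \<in> W}" using tx by simp
    then obtain I J where IJ: "open I" "open J" "t \<in> I" "x \<in> J" "I \<times> J \<subseteq> {(t, x). (t rmod T, x) \<in> W}"
      using W unfolding open_prod_def by force
    show "\<exists>U V. openin (circle_topology T) U \<and> openin euclidean V \<and> t \<in> U \<and> x \<in> V \<and> U \<times> V \<subseteq> W"
    proof (intro exI conjI)
      show "openin (circle_topology T) ((\<lambda>t. t rmod T) ` I)"
        by (rule openin_circle_topology_rmod_image[OF T IJ(1)])
      show "t \<in> (\<lambda>t. t rmod T) ` I" using IJ(3) t by (metis imageI)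
      show "(\<lambda>t. t rmod T) ` I \<times> J \<subseteq> W" using IJ(5) by auto
    qed (use IJ in auto)
  qed
qed

lemma openin_autonomized_space_image:
  fixes G :: "(real \<times> (real^'d)) set"
  assumes T: "T > 0" and G: "open G"
  shows "openin (autonomized_space T) ((\<lambda>(t, x). (t rmod T, x)) ` G)" (is "openin _ ?W")
proof -
  have "{(t, x). (t rmod T, x) \<in> ?W} = (\<Union>n::int. (\<lambda>p. (of_int n * T, 0) + p) ` G)"
  proof (intro set_eqI iffI)
    fix z assume "z \<in> {(t, x). (t rmod T, x) \<in> ?W}"
    then obtain t s x where z: "z = (t, x)" "(s, x) \<in> G" "t rmod T = s rmod T" by auto
    then obtain n :: int where "t = s + of_int n * T" by (metis rmod_eqE)
    then have "z = (of_int n * T, 0) + (s, x)" using z by simp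
    then show "z \<in> (\<Union>n::int. (\<lambda>p. (of_int n * T, 0) + p) ` G)" using z by blast
  next
    fix z assume "z \<in> (\<Union>n::int. (\<lambda>p. (of_int n * T, 0) + p) ` G)"
    then obtain n :: int and t x where "z = (t + of_int n * T, x)" "(t, x) \<in> G"
      by (auto simp: algebra_simps)
    then show "z \<in> {(t, x). (t rmod T, x) \<in> ?W}" by force
  qed
  then have "open {(t, x). (t rmod T, x) \<in> ?W}" using open_translation[OF G] by auto
  moreover have "?W \<subseteq> {0..<T} \<times> UNIV" using T by (auto simp: rmod_nonneg rmod_less)
  ultimately show ?thesis unfolding openin_autonomized_space[OF T] by blast
qed

text \<open>Staying away from phase 0, where neighbourhoods wrap around to phases near
  \<open>T\<close>, lets an ordinary open set be used directly.\<close>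

lemma openin_autonomized_space_open:
  fixes G :: "(real \<times> (real^'d)) set"
  assumes T: "T > 0" and G: "open G" "G \<subseteq> {0<..<T} \<times> UNIV"
  shows "openin (autonomized_space T) G"
proof -
  have "(\<lambda>(t, x). (t rmod T, x)) z = z" if "z \<in> G" for z
    using G(2) that by (cases z) auto
  then have "(\<lambda>(t, x). (t rmod T, x)) ` G = G" by (simp cong: image_cong)
  then show ?thesis using openin_autonomized_space_image[OF T G(1)] by simp
qed

section \<open>Controls\<close>

lemma AE_lebesgue_iff_negligible: "(AE t in lebesgue. P t) \<longleftrightarrow> negligible {t. \<not> P t}"
proof
  assume "AE t in lebesgue. P t"
  then obtain N where "N \<in> null_sets lebesgue" "{t. \<not> P t} \<subseteq> N"
    unfolding eventually_ae_filter by auto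
  then show "negligible {t. \<not> P t}"
    using negligible_subset by (auto simp: negligible_iff_null_sets)
next
  assume "negligible {t. \<not> P t}"
  then show "AE t in lebesgue. P t" by (intro AE_I') (auto simp: negligible_iff_null_sets)
qed

lemma AE_lebesgue_shift:
  fixes c :: "'a::euclidean_space"
  assumes "AE t in lebesgue. P t" shows "AE t in lebesgue. P (t + c)"
proof -
  have "{t. \<not> P (t + c)} = (+) (- c) ` {t. \<not> P t}"
  proof (intro set_eqI iffI)
    fix t assume "t \<in> {t. \<not> P (t + c)}"
    then show "t \<in> (+) (- c) ` {t. \<not> P t}" by (intro image_eqI[of _ _ "t + c"]) auto
  qed auto
  then show ?thesis
    using assms negligible_translation[of "{t. \<not> P t}" "- c"] by (simp add: AE_lebesgue_iff_negligible)
qed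

lemma AE_lebesgue_neq: "AE t in lebesgue. t \<noteq> (c::'a::euclidean_space)"
  by (simp add: AE_lebesgue_iff_negligible)

lemma borel_measurable_lebesgue_shift:
  fixes f :: "real \<Rightarrow> 'a::euclidean_space"
  assumes "f \<in> borel_measurable lebesgue" shows "(\<lambda>t. f (t + c)) \<in> borel_measurable lebesgue"
proof -
  have "(\<lambda>t. c + (\<Sum>j\<in>Basis. (1 * (t \<bullet> j)) *\<^sub>R j)) \<in> lebesgue \<rightarrow>\<^sub>M (lebesgue :: real measure)"
    by (rule lebesgue_affine_measurable) simp
  then have "(\<lambda>t. t + c) \<in> lebesgue \<rightarrow>\<^sub>M (lebesgue :: real measure)" by (simp add: add.commute)
  from measurable_comp[OF this assms] show ?thesis by (simp add: o_def)
qed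

lemma L_infinity_UNIV:
  "u \<in> L_infinity UNIV \<longleftrightarrow> u \<in> borel_measurable lebesgue \<and> (\<exists>C. AE t in lebesgue. norm (u t) \<le> C)"
  unfolding L_infinity_def lebesgue_on_UNIV_eq by simp

lemma controls_iff:
  assumes "bounded S"
  shows "u \<in> controls S \<longleftrightarrow> u \<in> borel_measurable lebesgue \<and> (AE t in lebesgue. u t \<in> S)"
proof -
  obtain C where C: "\<And>x. x \<in> S \<Longrightarrow> norm x \<le> C" using assms by (auto simp: bounded_iff)
  have "AE t in lebesgue. norm (u t) \<le> C" if "AE t in lebesgue. u t \<in> S"
    using that by eventually_elim (rule C)
  then show ?thesis unfolding controls_def by (auto simp: L_infinity_UNIV)
qed

lemma controls_L_infinity: "u \<in> controls S \<Longrightarrow> u \<in> L_infinity UNIV"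
  by (simp add: controls_def)

lemma controls_const: "x \<in> S \<Longrightarrow> (\<lambda>_. x) \<in> controls S"
  by (auto simp: controls_def L_infinity_UNIV)

lemma L_infinity_shift: "u \<in> L_infinity UNIV \<Longrightarrow> (\<lambda>t. u (t + c)) \<in> L_infinity UNIV"
  unfolding L_infinity_UNIV using AE_lebesgue_shift[of "\<lambda>t. norm (u t) \<le> _" c]
  by (auto intro: borel_measurable_lebesgue_shift)

lemma controls_shift: "u \<in> controls S \<Longrightarrow> (\<lambda>t. u (t + c)) \<in> controls S"
  unfolding controls_def using AE_lebesgue_shift[of "\<lambda>t. u t \<in> S" c] by (auto intro: L_infinity_shift)

lemma controls_shift': "u \<in> controls S \<Longrightarrow> (\<lambda>t. u (c + t)) \<in> controls S"
  using controls_shift[of u S c] by (simp add: add.commute)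

lemma L_infinity_add:
  assumes "u \<in> L_infinity UNIV" "w \<in> L_infinity UNIV" shows "(\<lambda>t. u t + w t) \<in> L_infinity UNIV"
proof -
  obtain C D where "AE t in lebesgue. norm (u t) \<le> C" "AE t in lebesgue. norm (w t) \<le> D"
    using assms by (auto simp: L_infinity_UNIV)
  then have "AE t in lebesgue. norm (u t + w t) \<le> C + D"
    by eventually_elim (metis add_mono norm_triangle_ineq order_trans)
  then show ?thesis using assms by (auto simp: L_infinity_UNIV)
qed

lemma L_infinity_scaleR:
  assumes "u \<in> L_infinity UNIV" shows "(\<lambda>t. c *\<^sub>R u t) \<in> L_infinity UNIV"
proof -
  obtain C where "AE t in lebesgue. norm (u t) \<le> C"
    using assms by (auto simp: L_infinity_UNIV)
  then have "AE t in lebesgue. norm (c *\<^sub>R u t) \<le> \<bar>c\<bar> * C"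
    by eventually_elim (simp add: mult_left_mono)
  then show ?thesis using assms by (auto simp: L_infinity_UNIV)
qed

lemma controls_glue:
  assumes "bounded S" "u \<in> controls S" "w \<in> controls S"
  shows "(\<lambda>t. if t < c then u t else w t) \<in> controls S"
proof -
  have "AE t in lebesgue. u t \<in> S" "AE t in lebesgue. w t \<in> S"
    using assms by (auto simp: controls_def)
  then have "AE t in lebesgue. (if t < c then u t else w t) \<in> S" by eventually_elim auto
  moreover have "(\<lambda>t. if t < c then u t else w t) \<in> borel_measurable lebesgue"
    using assms by (intro measurable_If) (auto simp: controls_def L_infinity_UNIV simp flip: lessThan_def)
  ultimately show ?thesis using assms(1) by (simp add: controls_iff)
qed

text \<open>Reduction modulo \<open>T\<close> is a translation on each of countably many intervals,
  and translations preserve Lebesgue measurability and null sets. The intervals are numbered by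
  natural numbers through \<open>int_decode\<close>, as the piecewise criterion for measurability
  requires.\<close>

lemma controls_periodize:
  assumes S: "bounded S" and u: "u \<in> controls S" and T: "T > 0"
  shows "(\<lambda>t. u (t rmod T)) \<in> controls S"
proof -
  define k where "k n = real_of_int (int_decode n) * T" for n
  have rmod_eq: "t rmod T = t + - k n" if "t \<in> {k n ..< k n + T}" for t n
    using that T by (intro rmod_unique[of _ _ _ "int_decode n"]) (auto simp: k_def)
  have cover: "\<exists>n. t \<in> {k n ..< k n + T}" for t
  proof -
    have "t \<in> {k (int_encode \<lfloor>t / T\<rfloor>) ..< k (int_encode \<lfloor>t / T\<rfloor>) + T}"
      using floor_divide_lower[OF T, of t] floor_divide_upper[OF T, of t] by (auto simp: k_def algebra_simps)
    then show ?thesis by blast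
  qed
  have um: "u \<in> borel_measurable lebesgue" using u by (simp add: controls_def L_infinity_UNIV)
  have "(\<lambda>t. u (t rmod T)) \<in> borel_measurable lebesgue"
  proof (rule measurable_piecewise_restrict2)
    show "{k n ..< k n + T} \<in> sets lebesgue" for n by simp
    show "space lebesgue = (\<Union>n. {k n ..< k n + T})" using cover by auto
    show "\<exists>h\<in>borel_measurable lebesgue. \<forall>t\<in>{k n ..< k n + T}. u (t rmod T) = h t" for n
      using borel_measurable_lebesgue_shift[OF um, of "- k n"] rmod_eq
      by (intro bexI[of _ "\<lambda>t. u (t + - k n)"]) auto
  qed
  moreover have "AE t in lebesgue. \<forall>n. u (t + - k n) \<in> S"
    unfolding AE_all_countable
    using u AE_lebesgue_shift[of "\<lambda>t. u t \<in> S"] by (simp add: controls_def del: add_uminus_conv_diff)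
  then have "AE t in lebesgue. u (t rmod T) \<in> S"
    by eventually_elim (metis cover rmod_eq)
  ultimately show ?thesis using S by (simp add: controls_iff)
qed

section \<open>Periodic coefficients and their phase\<close>

lemma periodic_control_shift:
  assumes "periodic_control T v" shows "periodic_control T (\<lambda>t. v (c + t))"
  using assms AE_lebesgue_shift[of "\<lambda>t. v (t + T) = v t" c]
  by (auto simp: periodic_control_def algebra_simps)

lemma periodic_control_AE_nat:
  assumes "periodic_control T v" shows "AE t in lebesgue. v (t + real n * T) = v t"
proof (induction n)
  case (Suc n)
  have "AE t in lebesgue. v (t + real n * T + T) = v (t + real n * T)"
    using assms AE_lebesgue_shift[of "\<lambda>t. v (t + T) = v t" "real n * T"]
    by (auto simp: periodic_control_def)
  with Suc show ?case by eventually_elim (simp add: algebra_simps)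
qed simp

lemma periodic_control_AE_int:
  assumes "periodic_control T v" shows "AE t in lebesgue. v (t + of_int n * T) = v t"
proof (cases n)
  case (nonneg k)
  then show ?thesis using periodic_control_AE_nat[OF assms, of k] by simp
next
  case (neg k)
  have n: "of_int n * T = - (real (Suc k) * T)" unfolding neg by (simp add: algebra_simps)
  have "AE t in lebesgue. v (t + - (real (Suc k) * T) + real (Suc k) * T) = v (t + - (real (Suc k) * T))"
    by (rule AE_lebesgue_shift[OF periodic_control_AE_nat[OF assms]])
  then show ?thesis unfolding n by eventually_elim (simp add: algebra_simps)
qed

text \<open>The autonomized system sees only the phase. Shifts of \<open>v\<close> by two times of
  equal phase agree almost everywhere but not everywhere, since periodicity itself is imposed almost
  everywhere.\<close>

lemma periodic_control_AE_rmod: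
  assumes "periodic_control T v" "s rmod T = t rmod T"
  shows "AE r in lebesgue. v (s + r) = v (t + r)"
proof -
  obtain n :: int where "s = t + of_int n * T" using assms(2) by (rule rmod_eqE)
  then show ?thesis
    using AE_lebesgue_shift[OF periodic_control_AE_int[OF assms(1), of n], of t]
    by (simp add: algebra_simps)
qed

lemma periodic_control_multiple:
  assumes "periodic_control T v" "n > 0" shows "periodic_control (real n * T) v"
  using assms periodic_control_AE_nat[OF assms(1), of n] by (auto simp: periodic_control_def)

lemma periodic_control_periodize: "T > 0 \<Longrightarrow> periodic_control T (\<lambda>t. v (t rmod T))"
  using rmod_add_multiple[of _ 1 T] by (simp add: periodic_control_def)

section \<open>Trajectories of the quasi-affine system\<close>

lemma bounded_bilinear_matrix_vector_mult:
  "bounded_bilinear (\<lambda>(M::real^'n^'m) (x::real^'n). M *v x)"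
proof -
  have "bilinear (\<lambda>(M::real^'n^'m) (x::real^'n). M *v x)"
    unfolding bilinear_def
    by (auto intro!: linearI simp: matrix_vector_right_distrib matrix_vector_mult_add_rdistrib
        matrix_vector_mult_scaleR scaleR_matrix_vector_assoc)
  then show ?thesis by (simp add: bilinear_conv_bounded_bilinear)
qed

lemma caratheodory_solution_shift:
  assumes sol: "caratheodory_solution {a..b} f x"
  shows "caratheodory_solution {a - c..b - c} (\<lambda>t. f (t + c)) (\<lambda>t. x (t + c))"
  unfolding caratheodory_solution_def
proof (intro ballI impI)
  fix s t assume st: "s \<in> {a - c..b - c}" "t \<in> {a - c..b - c}" "s \<le> t"
  have "s + c \<in> {a..b}" "t + c \<in> {a..b}" "s + c \<le> t + c" using st by auto
  note D = caratheodory_solutionD[OF sol this]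
  have "(\<lambda>r. f (r + c) (x (r + c))) absolutely_integrable_on {s..t}"
    using D(1) integrable_on_shift_Icc_real[of "\<lambda>r. f r (x r)" c s t]
      integrable_on_shift_Icc_real[of "\<lambda>r. norm (f r (x r))" c s t]
    by (simp add: absolutely_integrable_on_def o_def add.commute)
  moreover have "integral {s..t} (\<lambda>r. f (r + c) (x (r + c))) = integral {s + c..t + c} (\<lambda>r. f r (x r))"
    using integral_shift_Icc_real[of s t "\<lambda>r. f r (x r)" c] by (simp add: o_def add.commute)
  ultimately show "(\<lambda>r. f (r + c) (x (r + c))) absolutely_integrable_on {s..t} \<and>
       x (t + c) = x (s + c) + integral {s..t} (\<lambda>r. f (r + c) (x (r + c)))"
    using D(3) by simp
qed

locale quasi_affine =
  fixes A :: "real^'p \<Rightarrow> real^'d^'d" and B :: "real^'p \<Rightarrow> real^'m^'d"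
    and U :: "(real^'m) set" and V :: "(real^'p) set"
  assumes A_cont: "continuous_on UNIV A" and B_cont: "continuous_on V B"
    and U_compact: "compact U" and U_convex: "convex U" and U_nbhd: "0 \<in> interior U"
    and V_compact: "compact V" and V_0: "0 \<in> V"
begin

abbreviation sol :: "real \<Rightarrow> real \<Rightarrow> (real \<Rightarrow> real^'m) \<Rightarrow> (real \<Rightarrow> real^'p) \<Rightarrow> (real \<Rightarrow> real^'d) \<Rightarrow> bool"
  where "sol a b u v x \<equiv> caratheodory_solution {a..b} (rhs A B u v) x"

abbreviation traj :: "(real \<Rightarrow> real^'m) \<Rightarrow> (real \<Rightarrow> real^'p) \<Rightarrow> (real \<Rightarrow> real^'d) \<Rightarrow> bool"
  where "traj u v x \<equiv> caratheodory_solution UNIV (rhs A B u v) x"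

lemma traj_sol: "traj u v x \<Longrightarrow> sol a b u v x"
  by (simp add: caratheodory_solution_UNIV_iff)

lemma U_bounded: "bounded U" and V_bounded: "bounded V"
  using U_compact V_compact by (auto intro: compact_imp_bounded)

lemma U_0: "0 \<in> U" using U_nbhd interior_subset by blast

lemma ex_rate: "\<exists>L>0. (\<forall>v\<in>V. \<forall>x. norm (A v *v x) \<le> L * norm x) \<and> (\<forall>v\<in>V. \<forall>u. norm (B v *v u) \<le> L * norm u)"
proof -
  interpret bA: bounded_bilinear "\<lambda>(M::real^'d^'d) (x::real^'d). M *v x"
    by (rule bounded_bilinear_matrix_vector_mult)
  interpret bB: bounded_bilinear "\<lambda>(M::real^'m^'d) (x::real^'m). M *v x"
    by (rule bounded_bilinear_matrix_vector_mult)
  obtain KA where KA: "KA > 0" "\<And>M x. norm (M *v x :: real^'d) \<le> norm (M::real^'d^'d) * norm x * KA"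
    using bA.pos_bounded by blast
  obtain KB where KB: "KB > 0" "\<And>M x. norm (M *v x :: real^'d) \<le> norm (M::real^'m^'d) * norm x * KB"
    using bB.pos_bounded by blast
  have "bounded (A ` V)" "bounded (B ` V)"
    using V_compact A_cont B_cont
    by (auto intro!: compact_imp_bounded compact_continuous_image intro: continuous_on_subset)
  then obtain a b where ab: "\<And>v. v \<in> V \<Longrightarrow> norm (A v) \<le> a" "\<And>v. v \<in> V \<Longrightarrow> norm (B v) \<le> b"
    unfolding bounded_iff by (metis imageI)
  then have ab0: "a \<ge> 0" "b \<ge> 0" using V_0 norm_ge_zero order_trans by blast+
  define L where "L = a * KA + b * KB + 1"
  have "norm (A v *v x) \<le> L * norm x" if "v \<in> V" for v x
  proof -
    have "norm (A v *v x) \<le> norm (A v) * norm x * KA" by (rule KA)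
    also have "\<dots> \<le> a * norm x * KA" using ab(1)[OF that] KA by (intro mult_right_mono) auto
    also have "\<dots> = (a * KA) * norm x" by simp
    also have "\<dots> \<le> L * norm x" unfolding L_def using ab0 KB by (intro mult_right_mono) auto
    finally show ?thesis .
  qed
  moreover have "norm (B v *v u) \<le> L * norm u" if "v \<in> V" for v u
  proof -
    have "norm (B v *v u) \<le> norm (B v) * norm u * KB" by (rule KB)
    also have "\<dots> \<le> b * norm u * KB" using ab(2)[OF that] KB by (intro mult_right_mono) auto
    also have "\<dots> = (b * KB) * norm u" by simp
    also have "\<dots> \<le> L * norm u" unfolding L_def using ab0 KA by (intro mult_right_mono) auto
    finally show ?thesis .
  qed
  moreover have "L > 0" unfolding L_def using ab0 KA KB by (intro add_nonneg_pos add_nonneg_nonneg) auto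
  ultimately show ?thesis by blast
qed

text \<open>One constant for both coefficient matrices, depending on \<open>A\<close>,
  \<open>B\<close> and \<open>V\<close> alone; the exponential estimates below are therefore uniform
  in the controls.\<close>

definition rate :: real where
  "rate = (SOME L. L > 0 \<and> (\<forall>v\<in>V. \<forall>x. norm (A v *v x) \<le> L * norm x) \<and> (\<forall>v\<in>V. \<forall>u. norm (B v *v u) \<le> L * norm u))"

lemma rate: "rate > 0" "v \<in> V \<Longrightarrow> norm (A v *v x) \<le> rate * norm x" "v \<in> V \<Longrightarrow> norm (B v *v u) \<le> rate * norm u"
  using someI_ex[OF ex_rate[unfolded Bex_def], folded rate_def] by auto

text \<open>Changing the controls on a null set makes the bounds on the right-hand side hold everywhere.\<close>

lemma regular_rhs:
  assumes u: "u \<in> borel_measurable lebesgue" "AE t in lebesgue. norm (u t) \<le> C" and v: "v \<in> controls V"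
  obtains f where "lipschitz_field f (rate * (1 + \<bar>C\<bar>))"
    and "\<forall>r x y. norm (f r x - f r y) \<le> rate * norm (x - y)"
    and "\<forall>r x. norm (f r x) \<le> rate * (norm x + \<bar>C\<bar>)"
    and "AE t in lebesgue. \<forall>x. rhs A B u v t x = f t x"
proof -
  define u' where "u' t = (if norm (u t) \<le> C then u t else 0)" for t
  define v' where "v' t = (if v t \<in> V then v t else 0)" for t
  \<comment> \<open>\<open>B\<close> is continuous only on \<open>V\<close>; cutting it off outside
    makes it a Borel function on the whole space, which can be composed with a measurable
    control.\<close>
  define B' where "B' w = indicator V w *\<^sub>R B w" for w
  have v_meas: "v \<in> borel_measurable lebesgue" and v_ae: "AE t in lebesgue. v t \<in> V"
    using v by (auto simp: controls_def L_infinity_UNIV)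
  have v'V: "v' t \<in> V" for t using V_0 by (simp add: v'_def)
  have u'C: "norm (u' t) \<le> \<bar>C\<bar>" for t by (simp add: u'_def abs_if)
  have V_borel: "V \<in> sets borel" using V_compact by (simp add: compact_imp_closed)
  have [measurable]: "u' \<in> borel_measurable lebesgue"
    unfolding u'_def using u(1) by measurable
  have [measurable]: "v' \<in> borel_measurable lebesgue"
    unfolding v'_def using v_meas V_borel by (intro measurable_If measurable_sets_Collect[OF v_meas]) auto
  have B'_meas: "B' \<in> borel_measurable borel"
    unfolding B'_def using V_borel B_cont by (rule borel_measurable_continuous_on_indicator)
  have A_meas: "A \<in> borel_measurable borel" using A_cont by (rule borel_measurable_continuous_onI)
  define f where "f = rhs A B u' v'"
  have f_diff: "f r x - f r y = A (v' r) *v (x - y)" for r x y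
    by (simp add: f_def rhs_def matrix_vector_mult_diff_distrib)
  have lip: "norm (f r x - f r y) \<le> rate * norm (x - y)" for r x y
    unfolding f_diff using rate(2)[OF v'V] .
  have bnd: "norm (f r x) \<le> rate * (norm x + \<bar>C\<bar>)" for r x
  proof -
    have "norm (f r x) \<le> rate * norm x + rate * norm (u' r)"
      unfolding f_def rhs_def by (intro order_trans[OF norm_triangle_ineq] add_mono rate v'V)
    also have "\<dots> \<le> rate * norm x + rate * \<bar>C\<bar>"
      using u'C[of r] rate(1) by (intro add_left_mono mult_left_mono) auto
    finally show ?thesis by (simp add: algebra_simps)
  qed
  have "lipschitz_field f (rate * (1 + \<bar>C\<bar>))"
  proof
    show "rate * (1 + \<bar>C\<bar>) > 0" using rate(1) by (intro mult_pos_pos) auto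
    show "norm (f r x - f r y) \<le> rate * (1 + \<bar>C\<bar>) * norm (x - y)" for r x y
      by (rule order_trans[OF lip]) (use rate(1) in \<open>intro mult_right_mono, auto simp: algebra_simps\<close>)
    show "norm (f r 0) \<le> rate * (1 + \<bar>C\<bar>)" for r
      by (rule order_trans[OF bnd]) (use rate(1) in \<open>auto simp: algebra_simps\<close>)
    fix x :: "real \<Rightarrow> real^'d" assume "continuous_on UNIV x"
    then have "x \<in> borel_measurable borel" by (rule borel_measurable_continuous_onI)
    then have [measurable]: "x \<in> borel_measurable lebesgue"
      by (simp add: measurable_completion)
    have [measurable]: "(\<lambda>r. A (v' r)) \<in> borel_measurable lebesgue"
      by (rule measurable_compose[OF _ A_meas]) measurable
    have [measurable]: "(\<lambda>r. B' (v' r)) \<in> borel_measurable lebesgue"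
      by (rule measurable_compose[OF _ B'_meas]) measurable
    have "(\<lambda>r. A (v' r) *v x r) \<in> borel_measurable lebesgue"
      by (rule borel_measurable_continuous_Pair)
        (auto intro!: bounded_bilinear.continuous_on[OF bounded_bilinear_matrix_vector_mult] continuous_intros)
    moreover have "(\<lambda>r. B' (v' r) *v u' r) \<in> borel_measurable lebesgue"
      by (rule borel_measurable_continuous_Pair)
        (auto intro!: bounded_bilinear.continuous_on[OF bounded_bilinear_matrix_vector_mult] continuous_intros)
    moreover have "f r (x r) = A (v' r) *v x r + B' (v' r) *v u' r" for r
      using v'V[of r] by (simp add: f_def rhs_def B'_def)
    ultimately show "(\<lambda>r. f r (x r)) \<in> borel_measurable lebesgue" by simp
  qed
  moreover have "AE t in lebesgue. \<forall>x. rhs A B u v t x = f t x"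
    using u(2) v_ae by eventually_elim (simp add: f_def rhs_def u'_def v'_def)
  ultimately show ?thesis using that lip bnd by blast
qed

lemma sol_iff_regular:
  assumes "AE t in lebesgue. \<forall>x. rhs A B u v t x = f t x"
  shows "sol a b u v x \<longleftrightarrow> caratheodory_solution {a..b} f x"
proof -
  have 1: "AE t in lebesgue. t \<in> {a..b} \<longrightarrow> rhs A B u v t (x t) = f t (x t)"
    using assms by eventually_elim auto
  have 2: "AE t in lebesgue. t \<in> {a..b} \<longrightarrow> f t (x t) = rhs A B u v t (x t)"
    using assms by eventually_elim auto
  show ?thesis
    using caratheodory_solution_cong[of a b "rhs A B u v" x x f] caratheodory_solution_cong[of a b f x x "rhs A B u v"]
      1 2 by blast
qed

lemma traj_iff_regular:
  assumes "AE t in lebesgue. \<forall>x. rhs A B u v t x = f t x"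
  shows "traj u v x \<longleftrightarrow> caratheodory_solution UNIV f x"
  unfolding caratheodory_solution_UNIV_iff sol_iff_regular[OF assms] ..

lemma regular_rhsE:
  assumes "u \<in> L_infinity UNIV" and v: "v \<in> controls V"
  obtains f K where "lipschitz_field f K" "\<forall>r x y. norm (f r x - f r y) \<le> rate * norm (x - y)"
    "AE t in lebesgue. \<forall>x. rhs A B u v t x = f t x"
proof -
  obtain C where "u \<in> borel_measurable lebesgue" "AE t in lebesgue. norm (u t) \<le> C"
    using assms by (auto simp: L_infinity_UNIV)
  then obtain f where "lipschitz_field f (rate * (1 + \<bar>C\<bar>))"
    "\<forall>r x y. norm (f r x - f r y) \<le> rate * norm (x - y)"
    "\<forall>r x. norm (f r x) \<le> rate * (norm x + \<bar>C\<bar>)"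
    "AE t in lebesgue. \<forall>x. rhs A B u v t x = f t x"
    by (rule regular_rhs[OF _ _ v]) (rule that)
  then show ?thesis by (intro that)
qed

lemma ex_traj:
  assumes "u \<in> L_infinity UNIV" "v \<in> controls V"
  obtains x where "traj u v x" "x s = x0"
proof -
  obtain f K where f: "lipschitz_field f K" "\<forall>r x y. norm (f r x - f r y) \<le> rate * norm (x - y)"
    "AE t in lebesgue. \<forall>x. rhs A B u v t x = f t x"
    by (rule regular_rhsE[OF assms]) (rule that)
  obtain x where "caratheodory_solution UNIV f x" "x s = x0"
    using lipschitz_field.ex_caratheodory_solution[OF f(1), of s x0] by blast
  then show ?thesis using that traj_iff_regular[OF f(3)] by blast
qed

lemma sol_estimate:
  assumes uv: "u \<in> L_infinity UNIV" "v \<in> controls V"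
    and x: "sol a b u v x" and y: "sol a b u v y" and s: "s \<in> {a..b}" and t: "t \<in> {a..b}"
  shows "norm (x t - y t) \<le> 2 * norm (x s - y s) * exp (2 * rate * \<bar>t - s\<bar>)"
proof -
  obtain f K where "lipschitz_field f K" and "\<forall>r x y. norm (f r x - f r y) \<le> rate * norm (x - y)"
    and ae: "AE t in lebesgue. \<forall>x. rhs A B u v t x = f t x"
    by (rule regular_rhsE[OF uv]) (rule that)
  then have lip: "\<And>r x y. norm (f r x - f r y) \<le> rate * norm (x - y)" by blast
  note reg = sol_iff_regular[OF ae]
  show ?thesis
  proof (cases "s \<le> t")
    case True
    have "{s..t} \<subseteq> {a..b}" using s t by auto
    then have "caratheodory_solution {s..t} f x" "caratheodory_solution {s..t} f y"
      using x y unfolding reg by (blast intro: caratheodory_solution_subset)+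
    from caratheodory_forward_estimate[OF this rate(1) lip, of t] True show ?thesis by simp
  next
    case False
    have "{t..s} \<subseteq> {a..b}" using s t by auto
    then have "caratheodory_solution {t..s} f x" "caratheodory_solution {t..s} f y"
      using x y unfolding reg by (blast intro: caratheodory_solution_subset)+
    from caratheodory_backward_estimate[OF this rate(1) lip, of t] False show ?thesis by simp
  qed
qed

lemma sol_unique:
  assumes "u \<in> L_infinity UNIV" "v \<in> controls V"
    and "sol a b u v x" "sol a b u v y" "s \<in> {a..b}" "t \<in> {a..b}" "x s = y s"
  shows "x t = y t"
  using sol_estimate[OF assms(1-6)] assms(7) by simp

lemma traj_estimate:
  assumes "u \<in> L_infinity UNIV" "v \<in> controls V" and "traj u v x" "traj u v y"
  shows "norm (x t - y t) \<le> 2 * norm (x s - y s) * exp (2 * rate * \<bar>t - s\<bar>)"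
  by (rule sol_estimate[OF assms(1,2) traj_sol[OF assms(3)] traj_sol[OF assms(4)], of _ "min s t" "max s t"]) auto

lemma traj_unique:
  assumes "u \<in> L_infinity UNIV" "v \<in> controls V" and "traj u v x" "traj u v y" "x s = y s"
  shows "x = y"
  using traj_estimate[OF assms(1-4), of _ s] assms(5) by (auto simp: fun_eq_iff)

text \<open>The bound is in terms of the terminal point \<open>x t\<close>, hence the time reversal:
  it applies at once to all points that can be steered to a given point in a short time.\<close>

lemma traj_displacement:
  assumes u: "u \<in> controls U" and v: "v \<in> controls V" and C: "\<And>w. w \<in> U \<Longrightarrow> norm w \<le> C"
    and x: "traj u v x" and t: "t \<ge> 0"
  shows "norm (x 0 - x t) \<le> 2 * (rate * (norm (x t) + \<bar>C\<bar>) * t) * exp (2 * rate * t)"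
proof -
  have u': "u \<in> borel_measurable lebesgue" "AE t in lebesgue. norm (u t) \<le> C"
    using u C by (auto simp: controls_def L_infinity_UNIV)
  obtain f where "lipschitz_field f (rate * (1 + \<bar>C\<bar>))"
    and "\<forall>r x y. norm (f r x - f r y) \<le> rate * norm (x - y)"
    and "\<forall>r x. norm (f r x) \<le> rate * (norm x + \<bar>C\<bar>)"
    and ae: "AE t in lebesgue. \<forall>x. rhs A B u v t x = f t x"
    by (rule regular_rhs[OF u' v]) (rule that)
  then have lip: "\<And>r x y. norm (f r x - f r y) \<le> rate * norm (x - y)"
    and bnd: "\<And>r x. norm (f r x) \<le> rate * (norm x + \<bar>C\<bar>)" by blast+
  have "caratheodory_solution {0..t} f x" using traj_sol[OF x] unfolding sol_iff_regular[OF ae] .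
  from caratheodory_solution_reflect[OF this]
  have sol': "caratheodory_solution {-t..0} (\<lambda>r y. - f (- r) y) (\<lambda>r. x (- r))" by simp
  have "norm (- f (- r) p) \<le> rate * (norm (x t) + \<bar>C\<bar>) + rate * norm (p - x (- (- t)))" for r p
    using norm_triangle_sub[of "f (-r) p" "f (-r) (x t)"] lip[of "-r" p "x t"] bnd[of "-r" "x t"] by simp
  from caratheodory_displacement_estimate[OF sol' rate(1) this, of 0] t show ?thesis by simp
qed

section \<open>Changing, shifting, adding and gluing trajectories\<close>

lemma sol_cong:
  assumes "sol a b u v x" and "\<And>t. t \<in> {a..b} \<Longrightarrow> x t = y t"
    and "AE t in lebesgue. t \<in> {a..b} \<longrightarrow> u t = u' t \<and> v t = v' t"
  shows "sol a b u' v' y"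
  using assms(1,2)
proof (rule caratheodory_solution_cong)
  show "AE t in lebesgue. t \<in> {a..b} \<longrightarrow> rhs A B u v t (y t) = rhs A B u' v' t (y t)"
    using assms(3) by eventually_elim (auto simp: rhs_def)
qed

lemma traj_cong:
  assumes "traj u v x" and "AE t in lebesgue. u t = u' t" "AE t in lebesgue. v t = v' t"
  shows "traj u' v' x"
  unfolding caratheodory_solution_UNIV_iff
proof (intro allI)
  fix a b
  have "AE t in lebesgue. t \<in> {a..b} \<longrightarrow> u t = u' t \<and> v t = v' t"
    using assms(2,3) by eventually_elim auto
  then show "sol a b u' v' x" using traj_sol[OF assms(1)] by (rule sol_cong[rotated 2]) auto
qed

lemma sol_shift:
  assumes "sol a b u v x"
  shows "sol (a - c) (b - c) (\<lambda>t. u (t + c)) (\<lambda>t. v (t + c)) (\<lambda>t. x (t + c))"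
proof -
  have "(\<lambda>t. rhs A B u v (t + c)) = rhs A B (\<lambda>t. u (t + c)) (\<lambda>t. v (t + c))"
    by (simp add: rhs_def fun_eq_iff)
  then show ?thesis using caratheodory_solution_shift[OF assms, of c] by simp
qed

lemma traj_shift:
  assumes "traj u v x" shows "traj (\<lambda>t. u (t + c)) (\<lambda>t. v (t + c)) (\<lambda>t. x (t + c))"
  unfolding caratheodory_solution_UNIV_iff
proof (intro allI)
  fix a b show "sol a b (\<lambda>t. u (t + c)) (\<lambda>t. v (t + c)) (\<lambda>t. x (t + c))"
    using sol_shift[OF traj_sol[OF assms, of "a + c" "b + c"], of c] by simp
qed

lemma traj_add:
  assumes x: "traj u v x" and y: "traj w v y"
  shows "traj (\<lambda>t. u t + w t) v (\<lambda>t. x t + y t)"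
  unfolding caratheodory_solution_def
proof (intro ballI impI)
  fix s t :: real assume st: "s \<le> t"
  note Dx = caratheodory_solutionD[OF x _ _ st, simplified] and Dy = caratheodory_solutionD[OF y _ _ st, simplified]
  have eq: "rhs A B (\<lambda>t. u t + w t) v r (x r + y r) = rhs A B u v r (x r) + rhs A B w v r (y r)" for r
    by (simp add: rhs_def matrix_vector_right_distrib)
  show "(\<lambda>r. rhs A B (\<lambda>t. u t + w t) v r (x r + y r)) absolutely_integrable_on {s..t} \<and>
       x t + y t = x s + y s + integral {s..t} (\<lambda>r. rhs A B (\<lambda>t. u t + w t) v r (x r + y r))"
    unfolding eq using set_integral_add(1)[OF Dx(1) Dy(1)] Dx(2,3) Dy(2,3) by (simp add: integral_add)
qed

lemma traj_scaleR:
  assumes x: "traj u v x"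
  shows "traj (\<lambda>t. c *\<^sub>R u t) v (\<lambda>t. c *\<^sub>R x t)"
  unfolding caratheodory_solution_def
proof (intro ballI impI)
  fix s t :: real assume st: "s \<le> t"
  note D = caratheodory_solutionD[OF x _ _ st, simplified]
  have eq: "rhs A B (\<lambda>t. c *\<^sub>R u t) v r (c *\<^sub>R x r) = c *\<^sub>R rhs A B u v r (x r)" for r
    by (simp add: rhs_def matrix_vector_mult_scaleR scaleR_right_distrib)
  show "(\<lambda>r. rhs A B (\<lambda>t. c *\<^sub>R u t) v r (c *\<^sub>R x r)) absolutely_integrable_on {s..t} \<and>
       c *\<^sub>R x t = c *\<^sub>R x s + integral {s..t} (\<lambda>r. rhs A B (\<lambda>t. c *\<^sub>R u t) v r (c *\<^sub>R x r))"
    unfolding eq using D by (auto simp: absolutely_integrable_on_scaleR_iff scaleR_right_distrib)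
qed

lemma traj_zero: "traj (\<lambda>_. 0) v (\<lambda>_. 0)"
  by (auto simp: caratheodory_solution_def rhs_def)

lemma traj_glue:
  assumes x: "traj u v x" and y: "traj u' v' y" and c: "x c = y c"
  shows "traj (\<lambda>t. if t < c then u t else u' t) (\<lambda>t. if t < c then v t else v' t) (\<lambda>t. if t < c then x t else y t)"
    (is "traj ?u ?v ?x")
proof -
  have *: "sol a b ?u ?v ?x" if "a \<le> c" "c \<le> b" for a b
  proof (rule caratheodory_solution_combine[OF _ _ that])
    have ae: "AE t in lebesgue. t \<in> {a..c} \<longrightarrow> u t = ?u t \<and> v t = ?v t"
      using AE_lebesgue_neq[of c] by eventually_elim auto
    have "x t = ?x t" if "t \<in> {a..c}" for t using that c by (cases "t = c") auto
    then show "sol a c ?u ?v ?x" by (rule sol_cong[OF traj_sol[OF x] _ ae])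
    from sol_cong[OF traj_sol[OF y], of c b ?x ?u ?v] show "sol c b ?u ?v ?x" by auto
  qed
  show ?thesis
    unfolding caratheodory_solution_UNIV_iff
  proof (intro allI)
    \<comment> \<open>An interval that does not contain \<open>c\<close> is enlarged to one that
      does, and the solution is restricted afterwards.\<close>
    fix a b show "sol a b ?u ?v ?x"
      using *[of "min a c" "max b c"] by (rule caratheodory_solution_subset) auto
  qed
qed

lemma psi_eq:
  assumes "u \<in> L_infinity UNIV" "v \<in> controls V" and x: "traj u v x" and "x 0 = x0"
  shows "psi A B t x0 (u, v) = x t"
proof -
  have "(THE x. traj u v x \<and> x 0 = x0) = x"
    using assms traj_unique[OF assms(1,2)] by (intro the_equality) blast+
  then show ?thesis by (simp add: psi_def)
qed

lemma psiE:
  assumes "u \<in> L_infinity UNIV" "v \<in> controls V"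
  obtains x where "traj u v x" "x 0 = x0" "\<And>t. psi A B t x0 (u, v) = x t"
proof -
  obtain x where "traj u v x" "x 0 = x0" using ex_traj[OF assms] by metis
  then show ?thesis using that psi_eq[OF assms] by blast
qed

end

context quasi_affine
begin

section \<open>Steering along periodic coefficients\<close>

lemma traj_sum:
  assumes "finite I" "\<And>i. i \<in> I \<Longrightarrow> traj (u i) v (x i)"
  shows "traj (\<lambda>t. \<Sum>i\<in>I. c i *\<^sub>R u i t) v (\<lambda>t. \<Sum>i\<in>I. c i *\<^sub>R x i t)"
  using assms
proof (induction I rule: finite_induct)
  case empty
  then show ?case using traj_zero by simp
next
  case (insert i I)
  then have "traj (\<lambda>t. c i *\<^sub>R u i t + (\<Sum>i\<in>I. c i *\<^sub>R u i t)) v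
      (\<lambda>t. c i *\<^sub>R x i t + (\<Sum>i\<in>I. c i *\<^sub>R x i t))"
    by (intro traj_add traj_scaleR) auto
  then show ?case using insert by simp
qed

lemma L_infinity_sum:
  assumes "finite I" "\<And>i. i \<in> I \<Longrightarrow> u i \<in> L_infinity UNIV"
  shows "(\<lambda>t. \<Sum>i\<in>I. c i *\<^sub>R u i t) \<in> L_infinity UNIV"
  using assms
proof (induction I rule: finite_induct)
  case empty
  show ?case using controls_L_infinity[OF controls_const[of 0 "{0}"]] by simp
next
  case (insert i I)
  then have "(\<lambda>t. c i *\<^sub>R u i t + (\<Sum>i\<in>I. c i *\<^sub>R u i t)) \<in> L_infinity UNIV"
    by (intro L_infinity_add L_infinity_scaleR) auto
  then show ?case using insert by simp
qed

text \<open>Controllability provides a control on one time interval only. Continued by 0 it keeps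
  the state at 0 once this is reached, so that trajectories with different arrival times can be
  superposed at a common later time.\<close>

lemma steer_to_zero:
  assumes v: "v \<in> controls V" and ctrl: "controllable_unconstrained A B v"
  shows "\<exists>t1>0. \<exists>u\<in>L_infinity UNIV. \<exists>y. traj u v y \<and> y 0 = h \<and> (\<forall>t\<ge>t1. y t = 0)"
proof -
  obtain t1 u x where t1: "t1 > 0" and u: "u \<in> L_infinity {0..t1}"
    and x: "sol 0 t1 u v x" "x 0 = h" "x t1 = 0"
    using ctrl[unfolded controllable_unconstrained_def, rule_format, of 0 h 0] by blast
  define u0 where "u0 t = indicat_real {0..t1} t *\<^sub>R u t" for t
  obtain C where C: "AE t in lebesgue_on {0..t1}. norm (u t) \<le> C"
    using u by (auto simp: L_infinity_def)
  have "AE t in lebesgue. t \<in> {0..t1} \<longrightarrow> norm (u t) \<le> C"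
    using C by (subst (asm) AE_restrict_space_iff) auto
  then have "AE t in lebesgue. norm (u0 t) \<le> \<bar>C\<bar>"
    by eventually_elim (auto simp: u0_def indicator_def)
  moreover have "u0 \<in> borel_measurable lebesgue"
    using u unfolding L_infinity_def u0_def by (simp add: borel_measurable_restrict_space_iff)
  ultimately have u0: "u0 \<in> L_infinity UNIV" by (auto simp: L_infinity_UNIV)
  obtain y where y: "traj u0 v y" "y 0 = h" using ex_traj[OF u0 v] by metis
  have "sol 0 t1 u0 v x"
    using x(1) by (rule sol_cong) (auto simp: u0_def)
  from sol_unique[OF u0 v this traj_sol[OF y(1)], of 0 t1] have y1: "y t1 = 0"
    using t1 x y by simp
  have "y t = 0" if t: "t \<ge> t1" for t
  proof -
    have ae: "AE r in lebesgue. r \<in> {t1..t} \<longrightarrow> (0::real^'m) = u0 r \<and> v r = v r"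
      using AE_lebesgue_neq[of t1] by eventually_elim (auto simp: u0_def)
    have "sol t1 t u0 v (\<lambda>_. 0)" by (rule sol_cong[OF traj_sol[OF traj_zero] _ ae]) simp
    from sol_unique[OF u0 v traj_sol[OF y(1)] this, of t1 t] show ?thesis using t y1 by simp
  qed
  then show ?thesis using t1 u0 y by blast
qed

text \<open>Controllability bounds neither the time nor the size of the control. Steering the
  finitely many basis vectors to 0 and superposing yields a common time and a control linear in the
  initial value. A general target \<open>k\<close> is reduced to this: with the uncontrolled
  trajectory \<open>z\<close> that ends at \<open>k\<close>, the difference \<open>h - z 0\<close>
  is steered to 0 and \<open>z\<close> is added.\<close>

lemma uniform_steering:
  assumes v: "v \<in> controls V" and ctrl: "controllable_unconstrained A B v"
  shows "\<exists>t0>0. \<forall>t1\<ge>t0. \<exists>C\<ge>0. \<forall>h k. \<exists>u\<in>L_infinity UNIV. \<exists>y.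
    (AE t in lebesgue. norm (u t) \<le> C * (norm h + norm k)) \<and> traj u v y \<and> y 0 = h \<and> y t1 = k"
proof -
  obtain \<tau> u y where \<tau>: "\<And>h::real^'d. \<tau> h > (0::real)" and u: "\<And>h. u h \<in> L_infinity UNIV"
    and y: "\<And>h. traj (u h) v (y h)" "\<And>h. y h 0 = h" "\<And>h t. t \<ge> \<tau> h \<Longrightarrow> y h t = 0"
    using steer_to_zero[OF v ctrl] by metis
  have "\<exists>C\<ge>0. AE t in lebesgue. norm (u h t) \<le> C" for h
  proof -
    obtain C where "AE t in lebesgue. norm (u h t) \<le> C" using u[of h] by (auto simp: L_infinity_UNIV)
    then have "AE t in lebesgue. norm (u h t) \<le> \<bar>C\<bar>" by eventually_elim auto
    then show ?thesis by (intro exI[of _ "\<bar>C\<bar>"]) simp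
  qed
  then obtain c where c: "\<And>h. c h \<ge> 0" "\<And>h. AE t in lebesgue. norm (u h t) \<le> c h" by metis
  \<comment> \<open>The sum dominates the arrival time of each basis vector.\<close>
  define t0 where "t0 = (\<Sum>b\<in>Basis. \<tau> (b::real^'d)) + 1"
  have t0: "t0 > 0" "b \<in> Basis \<Longrightarrow> \<tau> b \<le> t0" for b
  proof -
    have "(\<Sum>b\<in>Basis. \<tau> (b::real^'d)) \<ge> 0" using \<tau> by (intro sum_nonneg) (simp add: less_imp_le)
    then show "t0 > 0" by (simp add: t0_def)
    assume "b \<in> Basis"
    then have "\<tau> b \<le> (\<Sum>b\<in>Basis. \<tau> b)" using \<tau> by (intro member_le_sum) (auto simp: less_imp_le)
    then show "\<tau> b \<le> t0" by (simp add: t0_def)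
  qed
  define c0 where "c0 = (\<Sum>b\<in>Basis. c (b::real^'d))"
  have c0: "c0 \<ge> 0" unfolding c0_def using c by (intro sum_nonneg) auto
  have to_0: "\<exists>u'\<in>L_infinity UNIV. \<exists>y'. (AE t in lebesgue. norm (u' t) \<le> c0 * norm h) \<and>
      traj u' v y' \<and> y' 0 = h \<and> (\<forall>t\<ge>t0. y' t = 0)" for h :: "real^'d"
  proof (intro bexI exI conjI allI impI)
    show "(\<lambda>t. \<Sum>b\<in>Basis. (h \<bullet> b) *\<^sub>R u b t) \<in> L_infinity UNIV"
      using u by (intro L_infinity_sum) auto
    show "traj (\<lambda>t. \<Sum>b\<in>Basis. (h \<bullet> b) *\<^sub>R u b t) v (\<lambda>t. \<Sum>b\<in>Basis. (h \<bullet> b) *\<^sub>R y b t)"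
      using y(1) by (intro traj_sum) auto
    show "(\<Sum>b\<in>Basis. (h \<bullet> b) *\<^sub>R y b 0) = h" by (simp add: y(2) euclidean_representation)
    show "(\<Sum>b\<in>Basis. (h \<bullet> b) *\<^sub>R y b t) = 0" if "t \<ge> t0" for t
      using that t0(2) y(3) by (intro sum.neutral) (metis order_trans scaleR_zero_right)
    have "AE t in lebesgue. \<forall>b\<in>Basis. norm (u b t) \<le> c b"
      using c by (intro AE_finite_allI) auto
    then show "AE t in lebesgue. norm (\<Sum>b\<in>Basis. (h \<bullet> b) *\<^sub>R u b t) \<le> c0 * norm h"
    proof eventually_elim
      case (elim t)
      have "norm (\<Sum>b\<in>Basis. (h \<bullet> b) *\<^sub>R u b t) \<le> (\<Sum>b\<in>Basis. norm h * c b)"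
        using elim by (intro sum_norm_le) (auto intro!: mult_mono simp: Basis_le_norm)
      also have "\<dots> = c0 * norm h" by (simp add: c0_def sum_distrib_left sum_distrib_right mult.commute)
      finally show ?case .
    qed
  qed
  show ?thesis
  proof (rule exI[of _ t0], intro conjI t0(1) allI impI)
    fix t1 assume t1: "t1 \<ge> t0"
    \<comment> \<open>Bound for the uncontrolled flow backwards from \<open>t1\<close> to 0, that
      is, for \<open>norm (z 0)\<close> in terms of \<open>norm k\<close>; as
      \<open>e \<ge> 1\<close>, it also absorbs the coefficient 1 of \<open>norm h\<close>.\<close>
    define e where "e = 2 * exp (2 * rate * t1)"
    have "exp (2 * rate * t1) \<ge> 1" using t1 t0(1) rate(1) by simp
    then have e: "e \<ge> 1" unfolding e_def by linarith
    show "\<exists>C\<ge>0. \<forall>h k. \<exists>u\<in>L_infinity UNIV. \<exists>y.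
      (AE t in lebesgue. norm (u t) \<le> C * (norm h + norm k)) \<and> traj u v y \<and> y 0 = h \<and> y t1 = k"
    proof (intro exI[of _ "c0 * e"] conjI allI)
      show "c0 * e \<ge> 0" using c0 e by simp
      fix h k :: "real^'d"
      have zero: "(\<lambda>_. 0::real^'m) \<in> L_infinity UNIV"
        by (rule controls_L_infinity[OF controls_const[of 0 "{0}"]]) simp
      obtain z where z: "traj (\<lambda>_. 0) v z" "z t1 = k" using ex_traj[OF zero v] by metis
      have "norm (z 0 - 0) \<le> 2 * norm (z t1 - 0) * exp (2 * rate * \<bar>0 - t1\<bar>)"
        by (rule traj_estimate[OF zero v z(1) traj_zero])
      then have z0: "norm (z 0) \<le> e * norm k" using z(2) t1 t0(1) by (simp add: e_def mult.commute)
      obtain u' y' where u': "u' \<in> L_infinity UNIV"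
        "AE t in lebesgue. norm (u' t) \<le> c0 * norm (h - z 0)"
        and y': "traj u' v y'" "y' 0 = h - z 0" "\<And>t. t \<ge> t0 \<Longrightarrow> y' t = 0"
        using to_0[of "h - z 0"] by blast
      have "norm (h - z 0) \<le> e * (norm h + norm k)"
        using norm_triangle_ineq4[of h "z 0"] z0 mult_right_mono[OF e norm_ge_zero[of h]]
        by (simp add: algebra_simps)
      then have "c0 * norm (h - z 0) \<le> c0 * e * (norm h + norm k)"
        using mult_left_mono[OF _ c0] by (simp add: mult.assoc)
      then have "AE t in lebesgue. norm (u' t) \<le> c0 * e * (norm h + norm k)"
        using u'(2) by (auto elim!: eventually_mono)
      moreover have "traj u' v (\<lambda>t. y' t + z t)" using traj_add[OF y'(1) z(1)] by simp
      ultimately show "\<exists>u\<in>L_infinity UNIV. \<exists>y. (AE t in lebesgue. norm (u t) \<le> c0 * e * (norm h + norm k)) \<and>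
          traj u v y \<and> y 0 = h \<and> y t1 = k"
        using u'(1) y'(2,3) t1 z(2) by (intro bexI[of _ u'] exI[of _ "\<lambda>t. y' t + z t"]) auto
    qed
  qed
qed

text \<open>Only whole numbers of periods are allowed, so that a periodic \<open>v\<close> is back
  at its initial phase on arrival; this makes the relation transitive with \<open>v\<close> kept
  fixed.\<close>

definition steer :: "real \<Rightarrow> (real \<Rightarrow> real^'p) \<Rightarrow> real^'d \<Rightarrow> real^'d \<Rightarrow> bool" where
  "steer T v y z \<longleftrightarrow> (\<exists>n::nat. \<exists>u\<in>controls U. \<exists>\<zeta>. traj u v \<zeta> \<and> \<zeta> 0 = y \<and> \<zeta> (real n * T) = z)"

lemma controls_0: "(\<lambda>_. 0) \<in> controls U" "(\<lambda>_. 0) \<in> controls V"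
  using U_0 V_0 by (auto intro: controls_const)

lemma steer_refl:
  assumes "v \<in> controls V" shows "steer T v y y"
proof -
  obtain \<zeta> where "traj (\<lambda>_. 0) v \<zeta>" "\<zeta> 0 = y"
    using ex_traj[OF controls_L_infinity[OF controls_0(1)] assms] by metis
  then show ?thesis unfolding steer_def using controls_0 by (intro exI[of _ 0]) auto
qed

lemma steer_trans:
  assumes per: "periodic_control T v" and yz: "steer T v y z" and zw: "steer T v z w"
  shows "steer T v y w"
proof -
  obtain n u \<zeta> where 1: "u \<in> controls U" "traj u v \<zeta>" "\<zeta> 0 = y" "\<zeta> (real n * T) = z"
    using yz unfolding steer_def by blast
  obtain m u' \<zeta>' where 2: "u' \<in> controls U" "traj u' v \<zeta>'" "\<zeta>' 0 = z" "\<zeta>' (real m * T) = w"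
    using zw unfolding steer_def by blast
  define c where "c = real n * T"
  have T: "T > 0" using per by (simp add: periodic_control_def)
  then have c0: "c \<ge> 0" by (simp add: c_def)
  have ae: "AE t in lebesgue. v (t + - c) = v t"
    using periodic_control_AE_int[OF per, of "- int n"] by (simp add: c_def)
  have "traj (\<lambda>t. u' (t + - c)) v (\<lambda>t. \<zeta>' (t + - c))"
    using traj_cong[OF traj_shift[OF 2(2), of "- c"] _ ae] by simp
  from traj_glue[OF 1(2) this, of c]
  have "traj (\<lambda>t. if t < c then u t else u' (t + - c)) v (\<lambda>t. if t < c then \<zeta> t else \<zeta>' (t + - c))"
    using 1 2 by (simp add: c_def)
  moreover have "(\<lambda>t. if t < c then u t else u' (t + - c)) \<in> controls U"
    by (intro controls_glue U_bounded 1 controls_shift 2)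
  moreover have "(if 0 < c then \<zeta> 0 else \<zeta>' (0 + - c)) = y"
    using c0 1 2 by (cases "c = 0") (auto simp: c_def)
  moreover have "real (n + m) * T = c + real m * T" by (simp add: c_def algebra_simps)
  then have "(if real (n + m) * T < c then \<zeta> (real (n + m) * T) else \<zeta>' (real (n + m) * T + - c)) = w"
    using T 2 by (simp add: not_less[symmetric] mult_less_0_iff)
  ultimately show ?thesis unfolding steer_def by blast
qed

text \<open>Uniqueness replaces the gluing of infinitely many pieces: \<open>y\<close> agrees with
  \<open>x\<close> on one period, so \<open>y\<close> shifted by \<open>T\<close> solves the same
  equation with the same initial value and coincides with \<open>y\<close>.\<close>

lemma periodize_traj:
  assumes u: "u \<in> controls U" and v: "v \<in> controls V" and x: "traj u v x" "x T = x 0" and T: "T > 0"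
  obtains y where "traj (\<lambda>t. u (t rmod T)) (\<lambda>t. v (t rmod T)) y" "\<And>n. y (real n * T) = x 0"
proof -
  let ?u = "\<lambda>t. u (t rmod T)" and ?v = "\<lambda>t. v (t rmod T)"
  have uv: "?u \<in> L_infinity UNIV" "?v \<in> controls V"
    using controls_periodize[OF U_bounded u T] controls_periodize[OF V_bounded v T]
    by (auto intro: controls_L_infinity)
  obtain y where y: "traj ?u ?v y" "y 0 = x 0" using ex_traj[OF uv] by metis
  have "AE t in lebesgue. t \<in> {0..T} \<longrightarrow> u t = ?u t \<and> v t = ?v t"
    using AE_lebesgue_neq[of T] by eventually_elim auto
  then have "sol 0 T ?u ?v x" by (rule sol_cong[OF traj_sol[OF x(1)] refl])
  from sol_unique[OF uv this traj_sol[OF y(1)], of 0 T] have yT: "y T = x 0"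
    using T x y by simp
  have "(t + T) rmod T = t rmod T" for t using rmod_add_multiple[of t 1 T] by simp
  then have "traj ?u ?v (\<lambda>t. y (t + T))" using traj_shift[OF y(1), of T] by simp
  then have shift: "(\<lambda>t. y (t + T)) = y"
    by (rule traj_unique[OF uv _ y(1), of _ 0]) (simp add: yT y)
  have "y (real n * T) = x 0" for n
  proof (induction n)
    case (Suc n)
    then show ?case using fun_cong[OF shift, of "real n * T"] by (simp add: algebra_simps)
  qed (simp add: y)
  then show ?thesis using that y(1) by blast
qed

text \<open>Here \<open>v\<close> is periodic already and agrees almost everywhere with its
  reduction modulo \<open>T\<close>. Hence only \<open>u\<close> changes, and the trajectory is one
  for \<open>v\<close> itself.\<close>

lemma periodize_traj_u:
  assumes u: "u \<in> controls U" and v: "v \<in> controls V" "periodic_control T v"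
    and x: "traj u v x" "x T = x 0"
  obtains w y where "w \<in> controls U" "traj w v y" "\<And>n. y (real n * T) = x 0"
proof -
  have T: "T > 0" using v(2) by (simp add: periodic_control_def)
  obtain y where y: "traj (\<lambda>t. u (t rmod T)) (\<lambda>t. v (t rmod T)) y" "\<And>n. y (real n * T) = x 0"
    using periodize_traj[OF u v(1) x T] by metis
  have "AE t in lebesgue. \<forall>n. v (t + of_int n * T) = v t"
    unfolding AE_all_countable using periodic_control_AE_int[OF v(2)] by blast
  then have "AE t in lebesgue. v (t rmod T) = v t"
  proof eventually_elim
    case (elim t)
    obtain n :: int where "t rmod T = t + of_int n * T"
      using rmod_eqE[of "t rmod T" T t] by (metis rmod_rmod)
    then show ?case using elim by simp
  qed
  then have "traj (\<lambda>t. u (t rmod T)) v y" by (intro traj_cong[OF y(1)]) auto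
  then show ?thesis using that controls_periodize[OF U_bounded u T] y(2) by blast
qed

text \<open>The point is the convex combination of \<open>p\<close> and \<open>w / (1 - c)\<close>
  with weights \<open>c\<close> and \<open>1 - c\<close>, and the latter point lies in the ball
  because (1 - \<alpha>) r \<le> (1 - c) r. One bound on \<open>w\<close> thus serves for all
  \<open>c\<close> up to \<alpha>.\<close>

lemma scaled_control:
  assumes ball: "ball 0 r \<subseteq> U" and p: "p \<in> U" and c: "0 \<le> c" "c \<le> \<alpha>" "\<alpha> < 1"
    and w: "norm w < (1 - \<alpha>) * r"
  shows "c *\<^sub>R p + w \<in> U"
proof -
  have "r > 0" using w c by (metis less_le_trans mult_pos_pos diff_gt_0_iff_gt norm_ge_zero
        le_less_trans zero_less_mult_pos)
  then have "(1 - \<alpha>) * r \<le> (1 - c) * r" using c by (intro mult_right_mono) auto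
  then have "norm (w /\<^sub>R (1 - c)) < r" using w c by (simp add: field_simps)
  then have "w /\<^sub>R (1 - c) \<in> U" using ball by auto
  from convexD[OF U_convex p this, of c "1 - c"] show ?thesis using c by simp
qed

text \<open>Scaling a periodic trajectory by \<open>c \<le> \<alpha> < 1\<close> leaves room in \<open>U\<close> for small corrections, which
  move the initial value from \<open>c x\<close> to \<open>c' x\<close> for nearby \<open>c, c'\<close>; a chain of such steps joins
  \<open>0\<close> and \<open>\<alpha> x\<close>.\<close>

lemma steer_scaled_periodic:
  assumes v: "v \<in> controls V" "periodic_control T v" and ctrl: "controllable_unconstrained A B v"
    and u: "u \<in> controls U" and x: "traj u v x" "x T = x 0" and \<alpha>: "0 \<le> \<alpha>" "\<alpha> < 1"
  shows "\<exists>\<eta>>0. \<forall>y. norm (y - \<alpha> *\<^sub>R x 0) < \<eta> \<longrightarrow> steer T v y 0 \<and> steer T v 0 y"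
proof -
  have T: "T > 0" using v(2) by (simp add: periodic_control_def)
  obtain w \<xi> where w: "w \<in> controls U" and \<xi>: "traj w v \<xi>" "\<And>n. \<xi> (real n * T) = x 0"
    using periodize_traj_u[OF u v x] by metis
  obtain t0 where t0: "t0 > 0" and steering: "\<And>t1. t1 \<ge> t0 \<Longrightarrow> \<exists>C\<ge>0. \<forall>h k. \<exists>u\<in>L_infinity UNIV. \<exists>y.
    (AE t in lebesgue. norm (u t) \<le> C * (norm h + norm k)) \<and> traj u v y \<and> y 0 = h \<and> y t1 = k"
    using uniform_steering[OF v(1) ctrl] by blast
  obtain m :: nat where m: "t0 \<le> real m * T"
    using T by (metis less_imp_le reals_Archimedean3)
  obtain C where C: "C \<ge> 0" and st: "\<And>h k. \<exists>u\<in>L_infinity UNIV. \<exists>y.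
    (AE t in lebesgue. norm (u t) \<le> C * (norm h + norm k)) \<and> traj u v y \<and> y 0 = h \<and> y (real m * T) = k"
    using steering[OF m] by blast
  obtain r where r: "r > 0" "ball 0 r \<subseteq> U" using U_nbhd by (auto simp: mem_interior)
  \<comment> \<open>Both end points may be off by \<rho>, so a correction costs at most 2 C \<rho>;
    the additional 1 in the denominator makes this strictly smaller than (1 - \<alpha>) r, also for
    \<open>C = 0\<close>.\<close>
  define \<rho> where "\<rho> = (1 - \<alpha>) * r / (2 * C + 1)"
  have \<rho>: "\<rho> > 0" unfolding \<rho>_def using r \<alpha> C by (intro divide_pos_pos mult_pos_pos) auto
  have \<rho>_eq: "(2 * C + 1) * \<rho> = (1 - \<alpha>) * r" unfolding \<rho>_def using C by simp
  have step: "steer T v y z"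
    if c: "0 \<le> c" "c \<le> \<alpha>" and y: "norm (y - c *\<^sub>R x 0) < \<rho>" and z: "norm (z - c *\<^sub>R x 0) < \<rho>" for c y z
  proof -
    obtain u' y' where u': "u' \<in> L_infinity UNIV"
      and bd: "AE t in lebesgue. norm (u' t) \<le> C * (norm (y - c *\<^sub>R x 0) + norm (z - c *\<^sub>R x 0))"
      and y': "traj u' v y'" "y' 0 = y - c *\<^sub>R x 0" "y' (real m * T) = z - c *\<^sub>R x 0"
      using st by metis
    have "C * (norm (y - c *\<^sub>R x 0) + norm (z - c *\<^sub>R x 0)) \<le> C * (2 * \<rho>)"
      using y z C by (intro mult_left_mono) auto
    also have "\<dots> < (1 - \<alpha>) * r" unfolding \<rho>_eq[symmetric] using \<rho> by (simp add: algebra_simps)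
    finally have small: "C * (norm (y - c *\<^sub>R x 0) + norm (z - c *\<^sub>R x 0)) < (1 - \<alpha>) * r" .
    have wU: "AE t in lebesgue. w t \<in> U" using w by (simp add: controls_def)
    have "AE t in lebesgue. c *\<^sub>R w t + u' t \<in> U"
      using bd wU by eventually_elim (use small c \<alpha> in \<open>intro scaled_control[OF r(2)], auto\<close>)
    then have "(\<lambda>t. c *\<^sub>R w t + u' t) \<in> controls U"
      unfolding controls_def using u' controls_L_infinity[OF w]
      by (auto intro!: L_infinity_add L_infinity_scaleR)
    \<comment> \<open>Superposition of the scaled periodic trajectory, which is at
      \<open>c *\<^sub>R x 0\<close> at both ends, with the correction, which supplies the two
      deviations.\<close>
    moreover have "traj (\<lambda>t. c *\<^sub>R w t + u' t) v (\<lambda>t. c *\<^sub>R \<xi> t + y' t)"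
      by (intro traj_add traj_scaleR \<xi> y')
    moreover have "c *\<^sub>R \<xi> 0 + y' 0 = y" using \<xi>(2)[of 0] y' by simp
    moreover have "c *\<^sub>R \<xi> (real m * T) + y' (real m * T) = z" using \<xi>(2)[of m] y' by simp
    ultimately show ?thesis unfolding steer_def by blast
  qed
  \<comment> \<open>Enough steps for consecutive points of the chain to be closer than
    \<rho>.\<close>
  obtain N :: nat where N: "norm (x 0) / \<rho> < real N" using reals_Archimedean2 by blast
  have N0: "N > 0" using N \<rho> by (metis divide_nonneg_pos gr0I linorder_not_less norm_ge_zero of_nat_0)
  define c where "c k = real k * \<alpha> / real N" for k
  have c_le: "0 \<le> c k" "k \<le> N \<Longrightarrow> c k \<le> \<alpha>" for k
    unfolding c_def using \<alpha> N0 by (auto simp: field_simps mult_left_mono)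
  have c_diff: "norm (c (Suc k) *\<^sub>R x 0 - c k *\<^sub>R x 0) < \<rho>" for k
  proof -
    have "c (Suc k) - c k = \<alpha> / real N" by (simp add: c_def algebra_simps flip: diff_divide_distrib)
    then have "norm (c (Suc k) *\<^sub>R x 0 - c k *\<^sub>R x 0) = \<alpha> / real N * norm (x 0)"
      using \<alpha> by (simp flip: scaleR_diff_left)
    also have "\<dots> \<le> 1 / real N * norm (x 0)"
      using \<alpha> N0 by (intro mult_right_mono divide_right_mono) auto
    also have "\<dots> < \<rho>" using N N0 \<rho> by (simp add: field_simps)
    finally show ?thesis .
  qed
  have chain: "steer T v 0 (c k *\<^sub>R x 0) \<and> steer T v (c k *\<^sub>R x 0) 0" if "k \<le> N" for k
    using that
  proof (induction k)
    case 0
    then show ?case using steer_refl[OF v(1)] by (simp add: c_def)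
  next
    case (Suc k)
    have "steer T v (c k *\<^sub>R x 0) (c (Suc k) *\<^sub>R x 0)" "steer T v (c (Suc k) *\<^sub>R x 0) (c k *\<^sub>R x 0)"
      using c_le[of k] c_diff[of k] Suc.prems \<rho> by (auto intro!: step[of "c k"])
    then show ?case using Suc steer_trans[OF v(2)] by (meson Suc_leD)
  qed
  have cN: "c N = \<alpha>" using N0 by (simp add: c_def)
  show ?thesis
  proof (intro exI[of _ \<rho>] conjI[OF \<rho>] allI impI)
    fix y assume "norm (y - \<alpha> *\<^sub>R x 0) < \<rho>"
    then have "steer T v y (\<alpha> *\<^sub>R x 0)" "steer T v (\<alpha> *\<^sub>R x 0) y"
      using \<alpha> \<rho> by (auto intro!: step[of \<alpha>])
    moreover have "steer T v 0 (\<alpha> *\<^sub>R x 0)" "steer T v (\<alpha> *\<^sub>R x 0) 0"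
      using chain[of N] cN by simp_all
    ultimately show "steer T v y 0 \<and> steer T v 0 y"
      by (blast intro: steer_trans[OF v(2)])
  qed
qed

section \<open>The two control systems\<close>

lemma psi_shift:
  assumes w: "w \<in> controls U \<times> controls V"
  obtains x where "traj (fst w) (snd w) x" "x 0 = p" "\<forall>t. psi A B t p w = x t"
    "\<forall>s t. psi A B s (x t) (\<lambda>r. fst w (r + t), \<lambda>r. snd w (r + t)) = x (t + s)"
proof -
  obtain u v where w_eq: "w = (u, v)" "u \<in> controls U" "v \<in> controls V" using w by auto
  obtain x where x: "traj u v x" "x 0 = p" "\<And>t. psi A B t p (u, v) = x t"
    using psiE[OF controls_L_infinity[OF w_eq(2)] w_eq(3)] by metis
  have "psi A B s (x t) (\<lambda>r. u (r + t), \<lambda>r. v (r + t)) = x (s + t)" for s t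
    using psi_eq[OF controls_L_infinity[OF controls_shift[OF w_eq(2)]] controls_shift[OF w_eq(3)]
        traj_shift[OF x(1), of t], of "x t" s] by simp
  then show ?thesis using that[of x] x w_eq by (simp add: add.commute)
qed

lemma psi_lipschitz:
  assumes w: "w \<in> controls U \<times> controls V"
  shows "norm (psi A B t p w - psi A B t q w) \<le> 2 * norm (p - q) * exp (2 * rate * \<bar>t\<bar>)"
proof -
  obtain u v where w_eq: "w = (u, v)" "u \<in> L_infinity UNIV" "v \<in> controls V"
    using w controls_L_infinity by auto
  obtain x y where "traj u v x" "x 0 = p" "\<And>t. psi A B t p (u, v) = x t"
    and "traj u v y" "y 0 = q" "\<And>t. psi A B t q (u, v) = y t"
    using psiE[OF w_eq(2,3)] by metis
  then show ?thesis using traj_estimate[OF w_eq(2,3), of x y t 0] w_eq by simp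
qed

lemma psi_continuous:
  assumes w: "w \<in> controls U \<times> controls V" shows "continuous_on UNIV (\<lambda>p. psi A B t p w)"
proof -
  have "(2 * exp (2 * rate * \<bar>t\<bar>))-lipschitz_on UNIV (\<lambda>p. psi A B t p w)"
    using psi_lipschitz[OF w] by (intro lipschitz_onI) (auto simp: dist_norm algebra_simps)
  then show ?thesis by (rule lipschitz_on_continuous_on)
qed

text \<open>Shifts and concatenations are inherited from trajectories. The openness axiom holds
  because, for each time and control, the end point is Lipschitz in the initial point, so the set in
  question is a union of open preimages.\<close>

lemma control_system_psi: "control_system euclidean (controls U \<times> controls V) (psi A B)"
proof
  fix p t w assume w: "w \<in> controls U \<times> controls V"
  show "psi A B t p w \<in> topspace euclidean" by simp
  show "psi A B 0 p w = p" using psi_shift[OF w, of p] by metis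
  fix t :: real assume t: "t \<ge> 0"
  show "\<exists>w'\<in>controls U \<times> controls V. \<forall>s\<ge>0. psi A B s (psi A B t p w) w' = psi A B (t + s) p w"
  proof -
    obtain x where "\<forall>t. psi A B t p w = x t"
      "\<forall>s t. psi A B s (x t) (\<lambda>r. fst w (r + t), \<lambda>r. snd w (r + t)) = x (t + s)"
      by (rule psi_shift[OF w, of p]) (rule that)
    moreover have "fst w \<in> controls U" "snd w \<in> controls V" using w by auto
    then have "(\<lambda>r. fst w (r + t), \<lambda>r. snd w (r + t)) \<in> controls U \<times> controls V"
      by (intro SigmaI controls_shift)
    ultimately show ?thesis by (intro bexI) auto
  qed
  fix w2 assume w2: "w2 \<in> controls U \<times> controls V"
  obtain u1 v1 u2 v2 where eq: "w = (u1, v1)" "w2 = (u2, v2)"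
    and c: "u1 \<in> controls U" "v1 \<in> controls V" "u2 \<in> controls U" "v2 \<in> controls V"
    using w w2 by auto
  have "fst w = u1" "snd w = v1" "fst w2 = u2" "snd w2 = v2" by (simp_all add: eq)
  note fs = this
  obtain x where x: "traj u1 v1 x" "x 0 = p" "\<forall>t. psi A B t p w = x t"
    by (rule psi_shift[OF w, of p, unfolded fs]) (rule that)
  obtain y where y: "traj u2 v2 y" "y 0 = x t" "\<forall>s. psi A B s (x t) w2 = y s"
    by (rule psi_shift[OF w2, of "x t", unfolded fs]) (rule that)
  define u v z where "u r = (if r < t then u1 r else u2 (r + - t))"
    and "v r = (if r < t then v1 r else v2 (r + - t))"
    and "z r = (if r < t then x r else y (r + - t))" for r
  have uv: "u \<in> controls U" "v \<in> controls V"
    unfolding u_def[abs_def] v_def[abs_def] by (intro controls_glue U_bounded V_bounded controls_shift c)+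
  have z: "traj u v z" unfolding u_def[abs_def] v_def[abs_def] z_def[abs_def]
    by (intro traj_glue x traj_shift y) (use y in simp)
  have z0: "z 0 = p" using t x y by (cases "t = 0") (auto simp: z_def)
  have psi_z: "psi A B s p (u, v) = z s" for s
    using psi_eq[OF controls_L_infinity[OF uv(1)] uv(2) z z0] .
  show "\<exists>w'\<in>controls U \<times> controls V. (\<forall>s\<in>{0..t}. psi A B s p w' = psi A B s p w) \<and>
      (\<forall>s\<ge>0. psi A B (t + s) p w' = psi A B s (psi A B t p w) w2)"
    using uv y(2) by (intro bexI[of _ "(u, v)"]) (auto simp: psi_z x(3) y(3) z_def)
next
  fix G :: "(real^'d) set" assume "openin euclidean G"
  then have G: "open G" by simp
  have "{p \<in> topspace euclidean. \<exists>t\<ge>0. \<exists>w\<in>controls U \<times> controls V. psi A B t p w \<in> G}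
      = (\<Union>t\<in>{0..}. \<Union>w\<in>controls U \<times> controls V. (\<lambda>p. psi A B t p w) -` G)" by auto
  moreover have "open \<dots>" using psi_continuous G by (intro open_UN ballI) (blast intro: open_vimage)
  ultimately show "openin euclidean {p \<in> topspace euclidean. \<exists>t\<ge>0. \<exists>w\<in>controls U \<times> controls V. psi A B t p w \<in> G}"
    by simp
qed

end

section \<open>The autonomized system\<close>

locale periodic_quasi_affine = quasi_affine A B U V
  for A :: "real^'p \<Rightarrow> real^'d^'d" and B :: "real^'p \<Rightarrow> real^'m^'d" and U V +
  fixes T :: real and v :: "real \<Rightarrow> real^'p"
  assumes v: "v \<in> controls V" and per: "periodic_control T v"
begin

lemma T_pos: "T > 0" using per by (simp add: periodic_control_def)

abbreviation aut :: "real \<Rightarrow> real \<times> (real^'d) \<Rightarrow> (real \<Rightarrow> real^'m) \<Rightarrow> real \<times> (real^'d)"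
  where "aut \<equiv> psi_autonomized A B T v"

lemma aut_traj:
  assumes u: "u \<in> controls U" and x: "traj u v x"
  shows "aut t (s rmod T, x s) (\<lambda>r. u (s + r)) = ((s + t) rmod T, x (s + t))"
proof -
  have ae: "AE r in lebesgue. v (s + r) = v (s rmod T + r)"
    by (rule periodic_control_AE_rmod[OF per]) simp
  have "traj (\<lambda>r. u (s + r)) (\<lambda>r. v (s + r)) (\<lambda>r. x (s + r))"
    using traj_shift[OF x, of s] by (simp add: add.commute)
  then have "traj (\<lambda>r. u (s + r)) (\<lambda>r. v (s rmod T + r)) (\<lambda>r. x (s + r))"
    by (rule traj_cong[OF _ _ ae]) simp
  then have "psi A B t (x s) (\<lambda>r. u (s + r), \<lambda>r. v (s rmod T + r)) = x (s + t)"
    using psi_eq[OF controls_L_infinity[OF controls_shift'[OF u]] controls_shift'[OF v], of s "s rmod T"]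
    by simp
  moreover have "(t + s rmod T) rmod T = (s + t) rmod T"
    using rmod_add[of t T "s rmod T"] rmod_add[of s T t] by (metis add.commute rmod_add rmod_rmod)
  ultimately show ?thesis by (simp add: psi_autonomized_def)
qed

lemma aut_trajE:
  assumes u: "u \<in> controls U"
  obtains x where "traj (\<lambda>r. u (r - s)) v x" "x s = y"
    "\<And>t. aut t (s rmod T, y) u = ((s + t) rmod T, x (s + t))"
proof -
  have u': "(\<lambda>r. u (r - s)) \<in> controls U" using controls_shift[OF u, of "- s"] by simp
  obtain x where x: "traj (\<lambda>r. u (r - s)) v x" "x s = y"
    using ex_traj[OF controls_L_infinity[OF u'] v] by metis
  show ?thesis using that[OF x] aut_traj[OF u' x(1), of _ s] x(2) by simp
qed

lemma topspace_rmod: "p \<in> topspace (autonomized_space T) \<Longrightarrow> fst p rmod T = fst p"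
  unfolding topspace_autonomized_space[OF T_pos] using T_pos by (cases p) auto

lemma rmod_in_topspace: "(s rmod T, y) \<in> topspace (autonomized_space T)"
  unfolding topspace_autonomized_space[OF T_pos] using T_pos by (auto simp: rmod_nonneg rmod_less)

text \<open>In the openness axiom a perturbed initial point also has another phase and hence meets
  other coefficients. The comparison is made in real time: the same control is applied up to the
  same absolute instant \<open>t1\<close>, so that only the duration changes and both trajectories
  solve one and the same equation.\<close>

lemma control_system_aut: "control_system (autonomized_space T) (controls U) aut"
proof
  fix p :: "real \<times> (real^'d)" and t u assume p: "p \<in> topspace (autonomized_space T)" and u: "u \<in> controls U"
  define s where "s = fst p"
  have p_eq: "p = (s rmod T, snd p)" using topspace_rmod[OF p] by (simp add: s_def)
  obtain x where x: "traj (\<lambda>r. u (r - s)) v x" "x s = snd p"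
    "\<And>t. aut t p u = ((s + t) rmod T, x (s + t))"
    using aut_trajE[OF u, of s "snd p"] p_eq by metis
  have u': "(\<lambda>r. u (r - s)) \<in> controls U" using controls_shift[OF u, of "- s"] by simp
  show "aut t p u \<in> topspace (autonomized_space T)" using x(3) rmod_in_topspace by simp
  show "aut 0 p u = p" using x(2,3) p_eq by simp
  fix t :: real assume t: "t \<ge> 0"
  show "\<exists>w'\<in>controls U. \<forall>r\<ge>0. aut r (aut t p u) w' = aut (t + r) p u"
    using aut_traj[OF u' x(1), of _ "s + t"] controls_shift'[OF u', of "s + t"] x(3)
    by (intro bexI[of _ "\<lambda>r. u (s + t + r - s)"]) (auto simp: add.assoc)
  fix w assume w: "w \<in> controls U"
  obtain y where y: "traj (\<lambda>r. w (r - (s + t))) v y" "y (s + t) = x (s + t)"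
    "\<And>r. aut r ((s + t) rmod T, x (s + t)) w = ((s + t + r) rmod T, y (s + t + r))"
    using aut_trajE[OF w, of "s + t" "x (s + t)"] by metis
  define g z where "g r = (if r < s + t then u (r - s) else w (r - (s + t)))"
    and "z r = (if r < s + t then x r else y r)" for r
  have g: "g \<in> controls U"
    unfolding g_def[abs_def] using controls_shift[OF w, of "- (s + t)"]
    by (intro controls_glue U_bounded u') (simp only: add_uminus_conv_diff)
  have z: "traj g v z" unfolding g_def[abs_def] z_def[abs_def]
    using traj_glue[OF x(1) y(1), of "s + t"] y(2) by simp
  have zs: "z s = snd p" using t x y by (cases "t = 0") (auto simp: z_def)
  have aut_z: "aut r p (\<lambda>r. g (s + r)) = ((s + r) rmod T, z (s + r))" for r
    using aut_traj[OF g z, of r s] zs p_eq by simp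
  show "\<exists>w'\<in>controls U. (\<forall>r\<in>{0..t}. aut r p w' = aut r p u) \<and>
      (\<forall>r\<ge>0. aut (t + r) p w' = aut r (aut t p u) w)"
    using controls_shift'[OF g, of s] y(2)
    by (intro bexI[of _ "\<lambda>r. g (s + r)"]) (auto simp: aut_z x(3) y(3) z_def add.assoc)
next
  fix G assume G: "openin (autonomized_space T) (G :: (real \<times> (real^'d)) set)"
  define P where "P = {p \<in> topspace (autonomized_space T). \<exists>t\<ge>0. \<exists>w\<in>controls U. aut t p w \<in> G}"
  have oG: "open {(t, x). (t rmod T, x) \<in> G}" using G openin_autonomized_space[OF T_pos] by blast
  have "\<exists>N. open N \<and> z \<in> N \<and> N \<subseteq> {(t, x). (t rmod T, x) \<in> P}"
    if z: "z \<in> {(t, x). (t rmod T, x) \<in> P}" for z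
  proof -
    obtain s y where sy: "z = (s, y)" "(s rmod T, y) \<in> P" using z by auto
    then obtain t u where t: "t \<ge> 0" and u: "u \<in> controls U" and hit: "aut t (s rmod T, y) u \<in> G"
      by (auto simp: P_def)
    obtain x where x: "traj (\<lambda>r. u (r - s)) v x" "x s = y"
      "\<And>t. aut t (s rmod T, y) u = ((s + t) rmod T, x (s + t))"
      using aut_trajE[OF u, of s y] by metis
    have u': "(\<lambda>r. u (r - s)) \<in> controls U" using controls_shift[OF u, of "- s"] by simp
    show ?thesis
    proof (cases "t = 0")
      \<comment> \<open>With \<open>t = 0\<close> there is no later instant at which perturbed
        trajectories could be compared; the lift of \<open>G\<close> itself is the
        neighbourhood.\<close>
      case True
      then have "z \<in> {(t, x). (t rmod T, x) \<in> G}" using hit x sy by simp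
      moreover have "{(t, x). (t rmod T, x) \<in> G} \<subseteq> {(t, x). (t rmod T, x) \<in> P}"
      proof clarify
        fix t x assume tx: "(t rmod T, x) \<in> G"
        obtain x' where "x' t = x" "\<And>r. aut r (t rmod T, x) (\<lambda>_. 0) = ((t + r) rmod T, x' (t + r))"
          using aut_trajE[OF controls_0(1), of t x] by metis
        then have "aut 0 (t rmod T, x) (\<lambda>_. 0) \<in> G" using tx by simp
        then show "(t rmod T, x) \<in> P" using controls_0 rmod_in_topspace by (auto simp: P_def)
      qed
      ultimately show ?thesis using oG by blast
    next
      case False
      define t1 where "t1 = s + t"
      have s_t1: "s < t1" using False t by (simp add: t1_def)
      have "(t1, x t1) \<in> {(t, x). (t rmod T, x) \<in> G}" using hit x by (simp add: t1_def)
      then obtain \<epsilon> where \<epsilon>: "\<epsilon> > 0" "ball (t1, x t1) \<epsilon> \<subseteq> {(t, x). (t rmod T, x) \<in> G}"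
        using oG open_contains_ball by metis
      define N where "N = {p::real \<times> (real^'d). fst p < t1 \<and>
        2 * norm (snd p - x (fst p)) * exp (2 * rate * (t1 - fst p)) < \<epsilon>}"
      have xc: "continuous_on UNIV (\<lambda>p::real \<times> (real^'d). x (fst p))"
        using caratheodory_solution_continuous_on_UNIV[OF x(1)]
        by (rule continuous_on_compose2) (auto intro: continuous_intros)
      have "open N"
        unfolding N_def by (intro open_Collect_conj open_Collect_less continuous_intros xc)
      moreover have "z \<in> N" using sy s_t1 x(2) \<epsilon>(1) by (simp add: N_def)
      moreover have "N \<subseteq> {(t, x). (t rmod T, x) \<in> P}"
      proof clarify
        fix s' y' assume N': "(s', y') \<in> N"
        obtain x' where x': "traj (\<lambda>r. u (r - s)) v x'" "x' s' = y'"
          using ex_traj[OF controls_L_infinity[OF u'] v] by metis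
        have "norm (x' t1 - x t1) < \<epsilon>"
          using traj_estimate[OF controls_L_infinity[OF u'] v x'(1) x(1), of t1 s'] N' x'(2)
          by (simp add: N_def)
        then have "(t1, x' t1) \<in> ball (t1, x t1) \<epsilon>"
          by (simp add: dist_Pair_Pair dist_norm norm_minus_commute)
        then have "(t1 rmod T, x' t1) \<in> G" using \<epsilon>(2) by auto
        then have "aut (t1 - s') (s' rmod T, y') (\<lambda>r. u (s' + r - s)) \<in> G"
          using aut_traj[OF u' x'(1), of "t1 - s'" s'] x'(2) by simp
        moreover have "(\<lambda>r. u (s' + r - s)) \<in> controls U" using controls_shift'[OF u', of s'] by simp
        moreover have "t1 - s' \<ge> 0" using N' by (simp add: N_def)
        ultimately show "(s' rmod T, y') \<in> P" using rmod_in_topspace[of s' y'] unfolding P_def by blast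
      qed
      ultimately show ?thesis by blast
    qed
  qed
  then have "open {(t, x). (t rmod T, x) \<in> P}" by (subst open_subopen) blast
  moreover have "P \<subseteq> {0..<T} \<times> UNIV" unfolding P_def topspace_autonomized_space[OF T_pos] by blast
  ultimately show "openin (autonomized_space T)
      {p \<in> topspace (autonomized_space T). \<exists>t\<ge>0. \<exists>w\<in>controls U. aut t p w \<in> G}"
    unfolding P_def openin_autonomized_space[OF T_pos] by blast
qed

end

section \<open>Control sets of the autonomized system\<close>

lemma (in quasi_affine) steer_multiple:
  assumes "steer (real k * T) v y z" shows "steer T v y z"
proof -
  obtain n u \<zeta> where "u \<in> controls U" "traj u v \<zeta>" "\<zeta> 0 = y" "\<zeta> (real (n * k) * T) = z"
    using assms unfolding steer_def by (auto simp: mult.assoc)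
  then show ?thesis unfolding steer_def by blast
qed

text \<open>Two successive scalings are provided for: one makes room for closing a nearly closed
  trajectory, the other for joining the closed one to 0. With \<open>c = 1 - d\<close> the error of
  both together is \<open>d * (2 - d) * norm x\<close>, whence the factor 2 in the choice of
  \<open>d\<close>.\<close>

lemma ex_scaling_factor:
  fixes x :: "'a::real_normed_vector"
  assumes "\<epsilon> > 0"
  obtains c where "0 \<le> c" "c < 1" "norm (c *\<^sub>R x - x) < \<epsilon>" "norm (c *\<^sub>R c *\<^sub>R x - x) < \<epsilon>"
proof -
  define d where "d = min 1 (\<epsilon> / (2 * (norm x + 1)))"
  have d: "0 < d" "d \<le> 1" using assms by (auto simp: d_def intro!: divide_pos_pos add_nonneg_pos)
  have pos: "2 * (norm x + 1) > 0" by (simp add: add_nonneg_pos)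
  have "d \<le> \<epsilon> / (2 * (norm x + 1))" by (simp add: d_def)
  then have "d * (2 * (norm x + 1)) \<le> \<epsilon>" using pos by (simp only: pos_le_divide_eq)
  then have small: "2 * d * norm x < \<epsilon>" using d by (simp add: algebra_simps)
  have "(1 - d) *\<^sub>R x - x = (- d) *\<^sub>R x" by (simp add: algebra_simps)
  then have 1: "norm ((1 - d) *\<^sub>R x - x) = d * norm x" using d by simp
  have "(1 - d) *\<^sub>R (1 - d) *\<^sub>R x - x = ((1 - d) * (1 - d) - 1) *\<^sub>R x"
    by (simp only: scaleR_scaleR scaleR_diff_left[of _ 1] scaleR_one)
  also have "(1 - d) * (1 - d) - 1 = - (d * (2 - d))" by (simp add: algebra_simps)
  finally have "norm ((1 - d) *\<^sub>R (1 - d) *\<^sub>R x - x) = d * (2 - d) * norm x" using d by simp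
  also have "\<dots> \<le> 2 * d * norm x" using d by (intro mult_right_mono) auto
  finally have "norm ((1 - d) *\<^sub>R (1 - d) *\<^sub>R x - x) < \<epsilon>" using small by simp
  moreover have "0 \<le> d * norm x" using d by simp
  then have "norm ((1 - d) *\<^sub>R x - x) < \<epsilon>" unfolding 1 using small by linarith
  ultimately show ?thesis using d by (intro that[of "1 - d"]) simp_all
qed

context periodic_quasi_affine
begin

sublocale P: control_system "autonomized_space T" "controls U" aut
  by (rule control_system_aut)

lemma steer_reach_aut:
  assumes "steer T (\<lambda>r. v (s + r)) y z"
  shows "(s rmod T, z) \<in> P.R (s rmod T, y)"
proof -
  obtain n u \<zeta> where u: "u \<in> controls U" and \<zeta>: "traj u (\<lambda>r. v (s + r)) \<zeta>" "\<zeta> 0 = y" "\<zeta> (real n * T) = z"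
    using assms unfolding steer_def by blast
  have u': "(\<lambda>r. u (r + - s)) \<in> controls U" by (rule controls_shift[OF u])
  have "traj (\<lambda>r. u (r + - s)) v (\<lambda>r. \<zeta> (r + - s))"
    using traj_shift[OF \<zeta>(1), of "- s"] by simp
  from aut_traj[OF u' this, of "real n * T" s]
  have "aut (real n * T) (s rmod T, y) u = ((s + real n * T) rmod T, z)"
    using \<zeta> by simp
  then show ?thesis
    using P.reachI[OF _ u, of "real n * T" "(s rmod T, y)"] rmod_add_multiple[of s "int n" T] T_pos by simp
qed

lemma traj_reach_aut:
  assumes u: "u \<in> controls U" and x: "traj u v x" and "s \<le> t"
  shows "(t rmod T, x t) \<in> P.R (s rmod T, x s)"
  using P.reachI[OF _ controls_shift'[OF u, of s], of "t - s" "(s rmod T, x s)"]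
    aut_traj[OF u x, of "t - s" s] assms(3) by simp

text \<open>At the state 0 with control 0 only the phase moves, so all phases over 0 reach one
  another by waiting.\<close>

lemma rest_reach: "(t rmod T, 0) \<in> P.R (s rmod T, 0)"
proof -
  obtain n :: nat where "(s - t) / T < real n" using reals_Archimedean2 by blast
  then have "s \<le> t + real n * T" using T_pos by (simp add: field_simps)
  from traj_reach_aut[OF controls_0(1) traj_zero this] show ?thesis
    using rmod_add_multiple[of t "int n" T] by simp
qed

lemma in_core_0I:
  assumes "steer T (\<lambda>r. v (s + r)) y 0" "steer T (\<lambda>r. v (s + r)) 0 y"
  shows "(s rmod T, y) \<in> P.core (0, 0)"
proof (rule P.coreI)
  have 0: "(0, 0) \<in> topspace (autonomized_space T)" using rmod_in_topspace[of 0] by simp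
  show "(s rmod T, y) \<in> P.R (0, 0)"
    using P.reach_trans[OF 0 _ steer_reach_aut[OF assms(2)]] rest_reach[of s 0] by simp
  show "(0, 0) \<in> P.R (s rmod T, y)"
    using P.reach_trans[OF rmod_in_topspace steer_reach_aut[OF assms(1)]] rest_reach[of 0 s] by simp
qed

lemma scaled_controls:
  assumes "u \<in> controls U" "0 \<le> c" "c \<le> 1" shows "(\<lambda>t. c *\<^sub>R u t) \<in> controls U"
proof -
  have "c *\<^sub>R p \<in> U" if "p \<in> U" for p
    using convexD[OF U_convex that U_0, of c "1 - c"] assms by simp
  moreover have "AE t in lebesgue. u t \<in> U" using assms by (simp add: controls_def)
  ultimately have "AE t in lebesgue. c *\<^sub>R u t \<in> U" by (auto elim!: eventually_mono)
  then show ?thesis using assms by (simp add: controls_def L_infinity_scaleR)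
qed

text \<open>Through a point close to the scaled trajectory at phase \<open>s\<close> runs a
  trajectory for the control \<alpha> u, followed back to phase 0 and on to \<open>T\<close>. At
  both ends it is close to \<open>\<alpha> *\<^sub>R x 0\<close>, where
  \<open>steer_scaled_periodic\<close> joins it to 0.\<close>

lemma tube_in_core:
  assumes ctrl: "controllable_unconstrained A B v"
    and u: "u \<in> controls U" and x: "traj u v x" "x T = x 0" and \<alpha>: "0 \<le> \<alpha>" "\<alpha> < 1"
  obtains G where "openin (autonomized_space T) G" "G \<subseteq> P.core (0, 0)"
    "\<And>s. 0 < s \<Longrightarrow> s < T \<Longrightarrow> (s, \<alpha> *\<^sub>R x s) \<in> G"
proof -
  obtain \<eta> where \<eta>: "\<eta> > 0"
    and steer: "\<forall>y. norm (y - \<alpha> *\<^sub>R x 0) < \<eta> \<longrightarrow> steer T v y 0 \<and> steer T v 0 y"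
    using steer_scaled_periodic[OF v per ctrl u x \<alpha>] by blast
  \<comment> \<open>Bounds the growth of deviations within one period, in either direction of
    time.\<close>
  define e where "e = 2 * exp (2 * rate * T)"
  have e: "e > 0" by (simp add: e_def)
  define G where "G = {p. 0 < fst p \<and> fst p < T \<and> norm (snd p - \<alpha> *\<^sub>R x (fst p)) < \<eta> / e}"
  have "continuous_on UNIV (\<lambda>p::real \<times> (real^'d). x (fst p))"
    using caratheodory_solution_continuous_on_UNIV[OF x(1)]
    by (rule continuous_on_compose2) (auto intro: continuous_intros)
  then have "open G"
    unfolding G_def by (intro open_Collect_conj open_Collect_less continuous_intros)
  then have "openin (autonomized_space T) G"
    by (intro openin_autonomized_space_open T_pos) (auto simp: G_def)
  moreover have "(s, z) \<in> P.core (0, 0)" if sz: "(s, z) \<in> G" for s z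
  proof -
    have s: "0 < s" "s < T" and z: "norm (z - \<alpha> *\<^sub>R x s) < \<eta> / e" using sz by (auto simp: G_def)
    have \<alpha>u: "(\<lambda>t. \<alpha> *\<^sub>R u t) \<in> controls U" using scaled_controls[OF u] \<alpha> by simp
    note \<alpha>x = traj_scaleR[OF x(1), of \<alpha>]
    obtain y where y: "traj (\<lambda>t. \<alpha> *\<^sub>R u t) v y" "y s = z"
      using ex_traj[OF controls_L_infinity[OF \<alpha>u] v] by metis
    have close: "norm (y t - \<alpha> *\<^sub>R x t) < \<eta>" if t: "0 \<le> t" "t \<le> T" for t
    proof -
      have "norm (y t - \<alpha> *\<^sub>R x t) \<le> 2 * norm (z - \<alpha> *\<^sub>R x s) * exp (2 * rate * \<bar>t - s\<bar>)"
        using traj_estimate[OF controls_L_infinity[OF \<alpha>u] v y(1) \<alpha>x, of t s] y(2) by simp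
      also have "\<dots> \<le> 2 * norm (z - \<alpha> *\<^sub>R x s) * exp (2 * rate * T)"
        using rate(1) s t by (intro mult_left_mono) auto
      also have "\<dots> = norm (z - \<alpha> *\<^sub>R x s) * e" by (simp add: e_def)
      also have "\<dots> < \<eta>" using z e by (simp add: pos_less_divide_eq)
      finally show ?thesis .
    qed
    have top: "(0, 0) \<in> topspace (autonomized_space T)" "(s, z) \<in> topspace (autonomized_space T)"
      using rmod_in_topspace[of 0 0] rmod_in_topspace[of s z] s by simp_all
    have "(0, y 0) \<in> P.R (0, 0)"
      using steer_reach_aut[of 0 0 "y 0"] steer[rule_format, of "y 0"] close[of 0] T_pos by simp
    moreover have "(s, z) \<in> P.R (0, y 0)"
      using traj_reach_aut[OF \<alpha>u y(1), of 0 s] s y(2) by simp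
    moreover have "(0, y T) \<in> P.R (s, z)"
      using traj_reach_aut[OF \<alpha>u y(1), of s T] s y(2) by simp
    moreover have "(0, 0) \<in> P.R (0, y T)"
      using steer_reach_aut[of 0 "y T" 0] steer[rule_format, of "y T"] close[of T] T_pos x(2) by simp
    ultimately show ?thesis
      by (intro P.coreI) (blast intro: P.reach_trans[OF top(1)] P.reach_trans[OF top(2)])+
  qed
  then have "G \<subseteq> P.core (0, 0)" by auto
  moreover have "(s, \<alpha> *\<^sub>R x s) \<in> G" if "0 < s" "s < T" for s
    using that \<eta> e by (simp add: G_def)
  ultimately show ?thesis using that by blast
qed

text \<open>The lower bound \<open>m\<close> reserves the last \<open>m\<close> periods of the
  returning trajectory for a later correction. It is achieved by first staying in \<open>D\<close>
  for \<open>m\<close> periods; the point \<open>z1\<close> reached is still in \<open>D\<close>,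
  and approximate reachability leads back from there.\<close>

lemma approximate_return:
  assumes D: "P.pre D" and I: "openin (autonomized_space T) I" "I \<subseteq> D" and p: "(\<tau>, x) \<in> I"
    and \<delta>: "\<delta> > 0"
  obtains k :: nat and w \<zeta> where "m \<le> k" "w \<in> controls U"
    "traj w (\<lambda>r. v (\<tau> + r)) \<zeta>" "\<zeta> 0 = x" "norm (\<zeta> (real k * T) - x) < \<delta>"
proof -
  have pD: "(\<tau>, x) \<in> D" and top: "(\<tau>, x) \<in> topspace (autonomized_space T)"
    using p I openin_subset[OF I(1)] by auto
  have \<tau>: "\<tau> rmod T = \<tau>" using topspace_rmod[OF top] by simp
  obtain w0 where w0: "w0 \<in> controls U" "\<And>t. t \<ge> 0 \<Longrightarrow> aut t (\<tau>, x) w0 \<in> D"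
    using D pD unfolding pre_control_set_def by blast
  define t0 where "t0 = real m * T"
  have t0: "t0 \<ge> 0" using T_pos by (simp add: t0_def)
  define z1 where "z1 = aut t0 (\<tau>, x) w0"
  have z1: "z1 \<in> D" using w0 t0 by (simp add: z1_def)
  then have z1_top: "z1 \<in> topspace (autonomized_space T)" using D unfolding pre_control_set_def by blast
  text \<open>\<open>N\<close> consists of the points from which the control \<open>0\<close> leads at phase \<open>\<tau>\<close> to a point close to
    \<open>x\<close>; passing through \<open>N\<close> makes the return time an exact multiple of the period.\<close>
  obtain y0 where y0: "traj (\<lambda>_. 0) v y0" "y0 \<tau> = x"
    using ex_traj[OF controls_L_infinity[OF controls_0(1)] v] by metis
  have y0c: "continuous_on UNIV y0" using caratheodory_solution_continuous_on_UNIV[OF y0(1)] .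
  define N where "N = {p::real \<times> (real^'d). fst p < \<tau> \<and>
    2 * norm (snd p - y0 (fst p)) * exp (2 * rate * (\<tau> - fst p)) < \<delta>}"
  have "continuous_on UNIV (\<lambda>p::real \<times> (real^'d). y0 (fst p))"
    using y0c by (rule continuous_on_compose2) (auto intro: continuous_intros)
  then have oN: "open N"
    unfolding N_def by (intro open_Collect_conj open_Collect_less continuous_intros)
  have oI: "open {(t, x). (t rmod T, x) \<in> I}" using I(1) openin_autonomized_space[OF T_pos] by blast
  have "open ((\<lambda>s. (s, y0 s)) -` {(t, x). (t rmod T, x) \<in> I})"
    by (intro open_vimage oI continuous_intros y0c)
  moreover have "\<tau> \<in> (\<lambda>s. (s, y0 s)) -` {(t, x). (t rmod T, x) \<in> I}" using p y0 \<tau> by simp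
  ultimately obtain \<epsilon> where \<epsilon>: "\<epsilon> > 0" "ball \<tau> \<epsilon> \<subseteq> (\<lambda>s. (s, y0 s)) -` {(t, x). (t rmod T, x) \<in> I}"
    by (meson open_contains_ball)
  \<comment> \<open>\<open>N\<close> contains only times before \<tau>, so (\<tau>, x) is not in it.
    The target is a slightly earlier point of the trajectory \<open>y0\<close>, still in
    \<open>I\<close> modulo \<open>T\<close>.\<close>
  define s0 where "s0 = \<tau> - \<epsilon> / 2"
  have "s0 \<in> ball \<tau> \<epsilon>" using \<epsilon>(1) by (simp add: s0_def dist_real_def)
  then have s0: "(s0 rmod T, y0 s0) \<in> I" using \<epsilon>(2) by auto
  have s0N: "(s0, y0 s0) \<in> N" using \<delta> \<epsilon>(1) by (simp add: N_def s0_def)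
  have "(s0 rmod T, y0 s0) \<in> autonomized_space T closure_of P.R z1"
    using D z1 s0 I(2) unfolding pre_control_set_def by blast
  moreover have "openin (autonomized_space T) ((\<lambda>(t, x). (t rmod T, x)) ` N)"
    by (rule openin_autonomized_space_image[OF T_pos oN])
  moreover have "(s0 rmod T, y0 s0) \<in> (\<lambda>(t, x). (t rmod T, x)) ` N" using s0N by force
  ultimately obtain z where "z \<in> P.R z1" "z \<in> (\<lambda>(t, x). (t rmod T, x)) ` N"
    unfolding in_closure_of by blast
  then obtain s' y' where s'y': "(s', y') \<in> N" "(s' rmod T, y') \<in> P.R z1" by auto
  obtain y'' where y'': "traj (\<lambda>_. 0) v y''" "y'' s' = y'"
    using ex_traj[OF controls_L_infinity[OF controls_0(1)] v] by metis
  have close: "norm (y'' \<tau> - x) < \<delta>"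
    using traj_estimate[OF controls_L_infinity[OF controls_0(1)] v y''(1) y0(1), of \<tau> s'] s'y'(1) y'' y0
    by (simp add: N_def)
  have "(\<tau>, y'' \<tau>) \<in> P.R (s' rmod T, y')"
    using traj_reach_aut[OF controls_0(1) y''(1), of s' \<tau>] s'y'(1) y'' \<tau> by (simp add: N_def)
  then have "(\<tau>, y'' \<tau>) \<in> P.R z1" using P.reach_trans[OF z1_top s'y'(2)] by blast
  then obtain t2 w2 where 2: "t2 \<ge> 0" "w2 \<in> controls U" "(\<tau>, y'' \<tau>) = aut t2 z1 w2"
    by (rule P.reachE)
  obtain w where w: "w \<in> controls U" "\<forall>s\<ge>0. aut (t0 + s) (\<tau>, x) w = aut s z1 w2"
    using P.concat[OF top w0(1) 2(2) t0] unfolding z1_def by blast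
  then have hit: "aut (t0 + t2) (\<tau>, x) w = (\<tau>, y'' \<tau>)" using 2 by simp
  define v' where "v' r = v (\<tau> + r)" for r
  have v': "v' \<in> controls V" unfolding v'_def[abs_def] by (rule controls_shift'[OF v])
  obtain \<zeta> where \<zeta>: "traj w v' \<zeta>" "\<zeta> 0 = x" "\<And>t. psi A B t x (w, v') = \<zeta> t"
    using psiE[OF controls_L_infinity[OF w(1)] v'] by metis
  have hit': "(t0 + t2 + \<tau>) rmod T = \<tau>" "\<zeta> (t0 + t2) = y'' \<tau>"
    using hit \<zeta>(3) unfolding psi_autonomized_def by (simp_all add: v'_def[abs_def])
  \<comment> \<open>Start and arrival have the same phase \<tau>, so the elapsed time is an integral
    multiple of \<open>T\<close>.\<close>
  from hit'(1) \<tau> obtain n :: int where "t0 + t2 + \<tau> = \<tau> + of_int n * T"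
    by (metis rmod_eqE)
  then have n: "t0 + t2 = of_int n * T" by simp
  have "real m * T \<le> of_int n * T" using n 2(1) by (simp add: t0_def)
  then have "int m \<le> n" using T_pos by (simp add: mult_le_cancel_right)
  then have "m \<le> nat n" "t0 + t2 = real (nat n) * T" using n by auto
  then show ?thesis
    using that[of "nat n" w \<zeta>] w(1) \<zeta>(1,2) hit'(2) close unfolding v'_def[abs_def] by simp
qed

text \<open>The nearly closed trajectory \<open>\<zeta>\<close> is multiplied by \<open>c\<close>,
  and a correction during its last \<open>m\<close> periods adds \<open>c *\<^sub>R (x - x')\<close>
  at the end, which closes it at \<open>c *\<^sub>R x\<close>. The second factor \<open>c\<close>
  brings this point into two-sided contact with 0. Since \<open>c\<close> is close to 1, the doubly
  scaled point has not left \<open>D\<close>.\<close>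

lemma control_set_meets_core:
  assumes ctrl: "\<And>s. controllable_unconstrained A B (\<lambda>r. v (s + r))"
    and D: "control_set (autonomized_space T) (controls U) aut D"
    and int: "autonomized_space T interior_of D \<noteq> {}"
  shows "D \<inter> P.core (0, 0) \<noteq> {}"
proof -
  define I where "I = autonomized_space T interior_of D"
  have I: "openin (autonomized_space T) I" "I \<subseteq> D"
    unfolding I_def by (auto simp: interior_of_subset)
  obtain \<tau> x where p: "(\<tau>, x) \<in> I" using int unfolding I_def by auto
  have \<tau>: "\<tau> rmod T = \<tau>" using topspace_rmod[of "(\<tau>, x)"] openin_subset[OF I(1)] p by auto
  have "open {(t, x). (t rmod T, x) \<in> I}" using I(1) openin_autonomized_space[OF T_pos] by blast
  moreover have "(\<tau>, x) \<in> {(t, x). (t rmod T, x) \<in> I}" using p \<tau> by simp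
  ultimately obtain \<epsilon> where \<epsilon>: "\<epsilon> > 0" "ball (\<tau>, x) \<epsilon> \<subseteq> {(t, x). (t rmod T, x) \<in> I}"
    by (meson open_contains_ball)
  obtain c where c: "0 \<le> c" "c < 1" "norm (c *\<^sub>R c *\<^sub>R x - x) < \<epsilon>"
    using ex_scaling_factor[OF \<epsilon>(1)] by metis
  then have "(\<tau>, c *\<^sub>R c *\<^sub>R x) \<in> ball (\<tau>, x) \<epsilon>"
    by (simp add: dist_Pair_Pair dist_norm norm_minus_commute)
  then have "(\<tau>, c *\<^sub>R c *\<^sub>R x) \<in> {(t, x). (t rmod T, x) \<in> I}" using \<epsilon>(2) by blast
  then have in_D: "(\<tau>, c *\<^sub>R c *\<^sub>R x) \<in> D" using I(2) \<tau> by auto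
  define v' where "v' r = v (\<tau> + r)" for r
  have v': "v' \<in> controls V" "periodic_control T v'" "controllable_unconstrained A B v'"
    unfolding v'_def[abs_def] by (rule controls_shift'[OF v] periodic_control_shift[OF per] ctrl)+
  obtain t0 where t0: "t0 > 0" and steering: "\<And>t1. t1 \<ge> t0 \<Longrightarrow> \<exists>C\<ge>0. \<forall>h k. \<exists>u\<in>L_infinity UNIV. \<exists>y.
    (AE t in lebesgue. norm (u t) \<le> C * (norm h + norm k)) \<and> traj u v' y \<and> y 0 = h \<and> y t1 = k"
    using uniform_steering[OF v'(1,3)] by blast
  obtain m :: nat where m: "t0 \<le> real m * T"
    using T_pos by (metis less_imp_le reals_Archimedean3)
  obtain C where C: "C \<ge> 0" and st: "\<And>h k. \<exists>u\<in>L_infinity UNIV. \<exists>y.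
    (AE t in lebesgue. norm (u t) \<le> C * (norm h + norm k)) \<and> traj u v' y \<and> y 0 = h \<and> y (real m * T) = k"
    using steering[OF m] by blast
  obtain r where r: "r > 0" "ball 0 r \<subseteq> U" using U_nbhd by (auto simp: mem_interior)
  \<comment> \<open>The correction has to produce a vector shorter than \<delta>, which costs at
    most C \<delta>, less than the room (1 - c) r left by the scaling.\<close>
  define \<delta> where "\<delta> = (1 - c) * r / (C + 1)"
  have \<delta>: "\<delta> > 0" unfolding \<delta>_def using r c C by (intro divide_pos_pos mult_pos_pos) auto
  have \<delta>_eq: "(C + 1) * \<delta> = (1 - c) * r" unfolding \<delta>_def using C by simp
  have pre: "P.pre D" using D by (simp add: control_set_def)
  obtain k w \<zeta> where k: "m \<le> k" and w: "w \<in> controls U"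
    and \<zeta>: "traj w v' \<zeta>" "\<zeta> 0 = x" "norm (\<zeta> (real k * T) - x) < \<delta>"
    using approximate_return[OF pre I p \<delta>, of m] unfolding v'_def[abs_def] by metis
  define x' where "x' = \<zeta> (real k * T)"
  obtain u y where u: "u \<in> L_infinity UNIV"
    and bd: "AE t in lebesgue. norm (u t) \<le> C * (norm (0::real^'d) + norm (c *\<^sub>R (x - x')))"
    and y: "traj u v' y" "y 0 = 0" "y (real m * T) = c *\<^sub>R (x - x')"
    using st by metis
  have "norm (c *\<^sub>R (x - x')) \<le> 1 * norm (x - x')"
    using c by (simp only: norm_scaleR, intro mult_right_mono) auto
  also have "\<dots> < \<delta>" using \<zeta>(3) by (simp add: x'_def norm_minus_commute)
  finally have "C * norm (c *\<^sub>R (x - x')) \<le> C * \<delta>" using C by (intro mult_left_mono) auto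
  then have small: "C * norm (c *\<^sub>R (x - x')) < (1 - c) * r"
    unfolding \<delta>_eq[symmetric] using \<delta> by (simp add: algebra_simps)
  \<comment> \<open>Start of the last \<open>m\<close> periods. As \<open>a\<close> is a multiple of
    \<open>T\<close>, the correction found for start time 0 can be shifted to \<open>a\<close>
    without changing \<open>v'\<close>.\<close>
  define a where "a = real (k - m) * T"
  have a0: "a \<ge> 0" using T_pos by (simp add: a_def)
  have ka: "real k * T = a + real m * T" using k by (simp add: a_def of_nat_diff algebra_simps)
  have ae: "AE t in lebesgue. v' (t + - a) = v' t"
    using periodic_control_AE_int[OF v'(2), of "- int (k - m)"] by (simp add: a_def)
  have "traj (\<lambda>t. u (t + - a)) v' (\<lambda>t. y (t + - a))"
    using traj_cong[OF traj_shift[OF y(1), of "- a"] _ ae] by simp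
  from traj_glue[OF traj_zero[of v'] this, of a]
  have late: "traj (\<lambda>t. if t < a then 0 else u (t + - a)) v' (\<lambda>t. if t < a then 0 else y (t + - a))"
    using y(2) by simp
  define g where "g t = c *\<^sub>R w t + (if t < a then 0 else u (t + - a))" for t
  define \<xi> where "\<xi> t = c *\<^sub>R \<zeta> t + (if t < a then 0 else y (t + - a))" for t
  have \<xi>: "traj g v' \<xi>" unfolding g_def[abs_def] \<xi>_def[abs_def]
    by (intro traj_add traj_scaleR \<zeta> late)
  have \<xi>0: "\<xi> 0 = c *\<^sub>R x" using a0 y(2) \<zeta>(2) by (cases "a = 0") (auto simp: \<xi>_def)
  have \<xi>k: "\<xi> (real k * T) = \<xi> 0"
    unfolding \<xi>0 using m t0 y(3) by (simp add: \<xi>_def ka x'_def[unfolded ka, symmetric] scaleR_diff_right)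
  have "AE t in lebesgue. norm (u (t + - a)) \<le> C * (norm (0::real^'d) + norm (c *\<^sub>R (x - x')))"
    by (rule AE_lebesgue_shift[OF bd])
  moreover have "AE t in lebesgue. w t \<in> U" using w by (simp add: controls_def)
  ultimately have gU: "AE t in lebesgue. g t \<in> U"
    unfolding g_def
    by eventually_elim (use small c C r in \<open>intro scaled_control[OF r(2)], auto simp: zero_less_mult_iff\<close>)
  have "(\<lambda>t. u (t + - a)) \<in> borel_measurable lebesgue" "w \<in> borel_measurable lebesgue"
    using borel_measurable_lebesgue_shift[of u "- a"] u w by (auto simp: controls_def L_infinity_UNIV)
  then have "g \<in> borel_measurable lebesgue"
    unfolding g_def[abs_def]
    by (intro borel_measurable_add borel_measurable_scaleR measurable_If borel_measurable_const)
      (simp_all flip: lessThan_def)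
  then have g: "g \<in> controls U" using gU by (simp add: controls_iff U_bounded)
  have k0: "k > 0" using m t0 T_pos k by (cases m) auto
  \<comment> \<open>The closed trajectory has length \<open>real k * T\<close>, which is taken as
    the period of \<open>v'\<close> here; whole numbers of it are whole numbers of \<open>T\<close>
    again.\<close>
  obtain \<eta> where "\<eta> > 0"
    "\<forall>y. norm (y - c *\<^sub>R \<xi> 0) < \<eta> \<longrightarrow> steer (real k * T) v' y 0 \<and> steer (real k * T) v' 0 y"
    using steer_scaled_periodic[OF v'(1) periodic_control_multiple[OF v'(2) k0] v'(3) g \<xi> \<xi>k c(1,2)] by blast
  then have "steer (real k * T) v' (c *\<^sub>R \<xi> 0) 0 \<and> steer (real k * T) v' 0 (c *\<^sub>R \<xi> 0)"
    by simp
  then have "steer T v' (c *\<^sub>R c *\<^sub>R x) 0" "steer T v' 0 (c *\<^sub>R c *\<^sub>R x)"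
    unfolding \<xi>0 by (blast intro: steer_multiple)+
  then have "(\<tau>, c *\<^sub>R c *\<^sub>R x) \<in> P.core (0, 0)"
    using in_core_0I[of \<tau>] \<tau> by (simp add: v'_def[abs_def])
  then show ?thesis using in_D by blast
qed

text \<open>The unique control set is constructed by the abstract criterion and only then identified
  with the definite description. The two inclusions enclose it between the core and its closure,
  which is all that is used of it later.\<close>

theorem periodic_control_set_core:
  assumes ctrl: "\<And>s. controllable_unconstrained A B (\<lambda>r. v (s + r))"
  shows "P.core (0, 0) \<subseteq> periodic_control_set A B U T v"
    and "periodic_control_set A B U T v \<subseteq> autonomized_space T closure_of P.core (0, 0)"
proof -
  have top: "(0, 0) \<in> topspace (autonomized_space T)" using rmod_in_topspace[of 0] by simp
  have rest: "aut t (0, 0) (\<lambda>_. 0) \<in> P.core (0, 0)" for t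
  proof -
    have "aut t (0, 0) (\<lambda>_. 0) = (t rmod T, 0)"
      using aut_traj[OF controls_0(1) traj_zero, of t 0] by simp
    then show ?thesis using rest_reach[of t 0] rest_reach[of 0 t] by (simp add: P.core_def)
  qed
  have ctrl0: "controllable_unconstrained A B v" using ctrl[of 0] by simp
  \<comment> \<open>The tube with \<alpha> = 0 around the trajectory resting at 0; the phase T / 2
    is just one strictly inside the period.\<close>
  obtain G where G: "openin (autonomized_space T) G" "G \<subseteq> P.core (0, 0)" "(T / 2, 0) \<in> G"
    using tube_in_core[OF ctrl0 controls_0(1) traj_zero _ order_refl] T_pos
    by (metis half_gt_zero field_sum_of_halves less_add_same_cancel1 scaleR_zero_right zero_less_one)
  then have "autonomized_space T interior_of P.core (0, 0) \<noteq> {}"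
    using interior_of_maximal[OF G(2,1)] by blast
  from P.unique_control_set_interior[OF top controls_0(1) rest this control_set_meets_core[OF ctrl]]
  obtain D where D: "control_set (autonomized_space T) (controls U) aut D" "P.core (0, 0) \<subseteq> D"
    "D \<subseteq> autonomized_space T closure_of P.core (0, 0)" "autonomized_space T interior_of D \<noteq> {}"
    "\<forall>D'. control_set (autonomized_space T) (controls U) aut D' \<and>
      autonomized_space T interior_of D' \<noteq> {} \<longrightarrow> D' = D" by blast
  have eq: "periodic_control_set A B U T v = D"
    unfolding periodic_control_set_def using D(1,4,5) by (intro the_equality) blast+
  show "P.core (0, 0) \<subseteq> periodic_control_set A B U T v"
    "periodic_control_set A B U T v \<subseteq> autonomized_space T closure_of P.core (0, 0)"
    unfolding eq by (rule D)+
qed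

end

section \<open>Control sets of the quasi-affine system\<close>

locale controllable_quasi_affine = quasi_affine A B U V
  for A :: "real^'p \<Rightarrow> real^'d^'d" and B :: "real^'p \<Rightarrow> real^'m^'d" and U V +
  assumes ctrl: "\<And>v T. v \<in> controls V \<Longrightarrow> periodic_control T v \<Longrightarrow> controllable_unconstrained A B v"
begin

sublocale S: control_system euclidean "controls U \<times> controls V" "psi A B"
  by (rule control_system_psi)

abbreviation E :: "(real^'d) set" where "E \<equiv> S.core 0"

lemma steer_reach:
  assumes v: "v \<in> controls V" "periodic_control T v" and "steer T v y z" shows "z \<in> S.R y"
proof -
  obtain n u \<zeta> where u: "u \<in> controls U" and \<zeta>: "traj u v \<zeta>" "\<zeta> 0 = y" "\<zeta> (real n * T) = z"
    using assms unfolding steer_def by blast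
  have "psi A B (real n * T) y (u, v) = z"
    using psi_eq[OF controls_L_infinity[OF u] v(1) \<zeta>(1,2)] \<zeta>(3) by simp
  moreover have "real n * T \<ge> 0" using v(2) by (simp add: periodic_control_def)
  ultimately show ?thesis using S.reachI[of "real n * T" "(u, v)" y] u v by simp
qed

lemma closed_orbit:
  assumes w: "w \<in> controls U \<times> controls V" and T: "T > 0" and loop: "psi A B T x w = x"
  obtains u v y where "u \<in> controls U" "v \<in> controls V" "periodic_control T v"
    "traj u v y" "y 0 = x" "y T = x"
proof -
  obtain y where y: "traj (fst w) (snd w) y" "y 0 = x" "\<forall>t. psi A B t x w = y t"
    by (rule psi_shift[OF w, of x]) (rule that)
  have uv: "fst w \<in> controls U" "snd w \<in> controls V" using w by auto
  have "y T = y 0" using loop y by simp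
  then obtain z where z: "traj (\<lambda>t. fst w (t rmod T)) (\<lambda>t. snd w (t rmod T)) z" "\<And>n. z (real n * T) = y 0"
    using periodize_traj[OF uv y(1) _ T] by metis
  show ?thesis
    using that[OF controls_periodize[OF U_bounded uv(1) T] controls_periodize[OF V_bounded uv(2) T]
        periodic_control_periodize[OF T] z(1)] z(2)[of 0] z(2)[of 1] y(2) by simp
qed

lemma scaled_closed_orbit_in_core:
  assumes w: "w \<in> controls U \<times> controls V" and T: "T > 0" and loop: "psi A B T x w = x"
    and c: "0 \<le> c" "c < 1"
  shows "\<exists>\<eta>>0. ball (c *\<^sub>R x) \<eta> \<subseteq> E"
proof -
  obtain u v y where u: "u \<in> controls U" and v: "v \<in> controls V" "periodic_control T v"
    and y: "traj u v y" "y 0 = x" "y T = x"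
    using closed_orbit[OF w T loop] by metis
  obtain \<eta> where "\<eta> > 0" "\<forall>z. norm (z - c *\<^sub>R x) < \<eta> \<longrightarrow> steer T v z 0 \<and> steer T v 0 z"
    using steer_scaled_periodic[OF v ctrl[OF v] u y(1) _ c] y by auto
  then show ?thesis
    using steer_reach[OF v] by (intro exI[of _ \<eta>]) (auto simp: dist_norm norm_minus_commute intro!: S.coreI)
qed

lemma psi_0: "psi A B t 0 (\<lambda>_. 0, \<lambda>_. 0) = 0"
  using psi_eq[OF controls_L_infinity[OF controls_0(1)] controls_0(2) traj_zero] by simp

lemma core_loop:
  assumes "x \<in> E"
  obtains w T where "w \<in> controls U \<times> controls V" "T > 0" "psi A B T x w = x"
proof -
  obtain t1 w1 where 1: "t1 \<ge> 0" "w1 \<in> controls U \<times> controls V" "x = psi A B t1 0 w1"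
    using assms unfolding S.core_def by (auto elim: S.reachE)
  obtain t2 w2 where 2: "t2 \<ge> 0" "w2 \<in> controls U \<times> controls V" "0 = psi A B t2 x w2"
    using assms unfolding S.core_def by (auto elim: S.reachE)
  obtain w where w: "w \<in> controls U \<times> controls V"
    "\<forall>s\<ge>0. psi A B (t2 + s) x w = psi A B s (psi A B t2 x w2) w1"
    using S.concat[OF _ 2(2) 1(2) 2(1), of x] by auto
  show ?thesis
  proof (cases "t2 + t1 > 0")
    case True
    then show ?thesis using that[OF w(1)] w(2) 1 2 by simp
  next
    \<comment> \<open>A loop without duration exists only at 0. Resting there for time 1 replaces
      it, since a period has to be positive.\<close>
    case False
    then have "t1 = 0" using 1 2 by simp
    then have "x = 0" using 1 S.zero[of 0] by simp
    then show ?thesis using that[of "(\<lambda>_. 0, \<lambda>_. 0)" 1] psi_0 controls_0 by simp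
  qed
qed

text \<open>The set of points that can be steered to \<open>x\<close> within time \<open>r\<close>
  has interior by accessibility, and for small \<open>r\<close> it lies in \<open>D\<close>. So
  \<open>R x\<close> comes arbitrarily close to a point of this interior, hence enters it, and from
  there \<open>x\<close> is reached exactly.\<close>

lemma accessible_return:
  assumes acc: "locally_accessible (controls U \<times> controls V) (psi A B)"
    and D: "S.pre D" and x: "x \<in> interior D"
  obtains w T where "w \<in> controls U \<times> controls V" "T > 0" "psi A B T x w = x"
proof -
  obtain \<epsilon> where \<epsilon>: "\<epsilon> > 0" "ball x \<epsilon> \<subseteq> D" using x by (auto simp: mem_interior)
  obtain C where C: "\<And>w. w \<in> U \<Longrightarrow> norm w \<le> C" using U_bounded by (auto simp: bounded_iff)
  \<comment> \<open>Displacement per unit of time for trajectories ending at \<open>x\<close>; the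
    factor \<open>exp (2 * rate)\<close> covers times up to 1, whence
    \<open>r \<le> 1\<close>.\<close>
  define M where "M = 2 * (rate * (norm x + \<bar>C\<bar>)) * exp (2 * rate)"
  have M: "M \<ge> 0" unfolding M_def using rate(1) by (intro mult_nonneg_nonneg) auto
  define r where "r = min 1 (\<epsilon> / (M + 1))"
  have r: "r > 0" "r \<le> 1" using \<epsilon> M by (auto simp: r_def)
  have "r \<le> \<epsilon> / (M + 1)" by (simp add: r_def)
  then have "r * (M + 1) \<le> \<epsilon>" using M by (simp add: pos_le_divide_eq)
  then have Mr: "M * r < \<epsilon>" using r by (simp add: algebra_simps)
  have near: "y \<in> ball x \<epsilon>" if hit: "y \<in> controllable_upto (controls U \<times> controls V) (psi A B) r x" for y
  proof -
    obtain t w where "t \<in> {0..r}" and w: "w \<in> controls U \<times> controls V" "psi A B t y w = x"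
      using hit unfolding controllable_upto_def by blast
    then have t: "0 \<le> t" "t \<le> r" by auto
    obtain z where z: "traj (fst w) (snd w) z" "z 0 = y" "\<forall>t. psi A B t y w = z t"
      by (rule psi_shift[OF w(1), of y]) (rule that)
    have "fst w \<in> controls U" "snd w \<in> controls V" using w by auto
    from traj_displacement[OF this C z(1) t(1)]
    have "norm (y - x) \<le> 2 * (rate * (norm x + \<bar>C\<bar>) * t) * exp (2 * rate * t)" using z w by simp
    also have "\<dots> \<le> 2 * (rate * (norm x + \<bar>C\<bar>) * r) * exp (2 * rate)"
      using t r rate(1) by (intro mult_mono) auto
    also have "\<dots> = M * r" by (simp add: M_def)
    finally show ?thesis using Mr by (simp add: dist_norm norm_minus_commute)
  qed
  \<comment> \<open>The point \<open>x\<close> is removed so that reaching \<open>Q\<close> from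
    \<open>x\<close> takes positive time; the rest is nonempty because a single point is not
    open.\<close>
  define Q where "Q = interior (controllable_upto (controls U \<times> controls V) (psi A B) r x) - {x}"
  have openQ: "open Q" by (simp add: Q_def open_Diff)
  have "Q \<noteq> {}"
  proof
    assume "Q = {}"
    then have "interior (controllable_upto (controls U \<times> controls V) (psi A B) r x) = {x}"
      using acc r(1) unfolding Q_def locally_accessible_def by blast
    then show False by (metis not_open_singleton open_interior)
  qed
  then obtain q where q: "q \<in> Q" by blast
  have "q \<in> D" using q near \<epsilon>(2) interior_subset unfolding Q_def by blast
  moreover have "x \<in> D" using x interior_subset by blast
  ultimately have "q \<in> closure (S.R x)" using D unfolding pre_control_set_def by auto
  then obtain y where y: "y \<in> S.R x" "y \<in> Q"
    using q openQ by (meson closure_iff_nhds_not_empty disjoint_iff order_refl)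
  obtain t1 w1 where 1: "t1 \<ge> 0" "w1 \<in> controls U \<times> controls V" "y = psi A B t1 x w1"
    using y(1) by (rule S.reachE)
  have "y \<in> controllable_upto (controls U \<times> controls V) (psi A B) r x"
    using y(2) interior_subset unfolding Q_def by blast
  then obtain t2 w2 where "t2 \<in> {0..r}" "w2 \<in> controls U \<times> controls V" "psi A B t2 y w2 = x"
    unfolding controllable_upto_def by blast
  then have 2: "t2 \<ge> 0" "w2 \<in> controls U \<times> controls V" "psi A B t2 y w2 = x" by auto
  have "y \<noteq> x" using y(2) by (simp add: Q_def)
  then have "t1 \<noteq> 0" using 1 S.zero[of x w1] by auto
  then have "t1 + t2 > 0" using 1 2 by simp
  moreover obtain w where "w \<in> controls U \<times> controls V"
    "\<forall>s\<ge>0. psi A B (t1 + s) x w = psi A B s (psi A B t1 x w1) w2"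
    using S.concat[OF _ 1(2) 2(2) 1(1), of x] by auto
  ultimately show ?thesis using that[of w "t1 + t2"] 1 2 by simp
qed

lemma unique_control_set:
  assumes acc: "locally_accessible (controls U \<times> controls V) (psi A B)"
  shows "\<exists>D. control_set euclidean (controls U \<times> controls V) (psi A B) D \<and> interior D \<noteq> {} \<and>
    (\<forall>D'. control_set euclidean (controls U \<times> controls V) (psi A B) D' \<and> interior D' \<noteq> {}
      \<longrightarrow> D' = D) \<and>
    closure D = closure E"
proof -
  have w0: "(\<lambda>_. 0, \<lambda>_. 0) \<in> controls U \<times> controls V" using controls_0 by simp
  \<comment> \<open>The loop resting at 0 for time 1, with scaling factor 0.\<close>
  obtain \<eta> where \<eta>: "\<eta> > 0" "ball 0 \<eta> \<subseteq> E"
    using scaled_closed_orbit_in_core[OF w0 zero_less_one psi_0 order_refl zero_less_one] by auto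
  then have "0 \<in> interior E" by (auto simp: mem_interior)
  then have int: "euclidean interior_of E \<noteq> {}" and z: "0 \<in> E"
    using interior_subset by auto
  have meet: "D \<inter> E \<noteq> {}"
    if D: "control_set euclidean (controls U \<times> controls V) (psi A B) D" "euclidean interior_of D \<noteq> {}" for D
  proof -
    obtain x where x: "x \<in> interior D" using D(2) by auto
    obtain \<epsilon> where \<epsilon>: "\<epsilon> > 0" "ball x \<epsilon> \<subseteq> D" using x by (auto simp: mem_interior)
    obtain w T where wT: "w \<in> controls U \<times> controls V" "T > 0" "psi A B T x w = x"
      using accessible_return[OF acc _ x] D(1) unfolding control_set_def by metis
    obtain c where c: "0 \<le> c" "c < 1" "norm (c *\<^sub>R x - x) < \<epsilon>"
      using ex_scaling_factor[OF \<epsilon>(1)] by metis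
    have "c *\<^sub>R x \<in> E" using scaled_closed_orbit_in_core[OF wT c(1,2)] by force
    moreover have "c *\<^sub>R x \<in> D" using \<epsilon>(2) c(3) by (auto simp: dist_norm norm_minus_commute)
    ultimately show ?thesis by blast
  qed
  have rest: "psi A B t 0 (\<lambda>_. 0, \<lambda>_. 0) \<in> E" for t using z psi_0 by simp
  from S.unique_control_set_interior[OF _ w0 rest int meet]
  obtain D where D: "control_set euclidean (controls U \<times> controls V) (psi A B) D"
    "E \<subseteq> D" "D \<subseteq> closure E" "interior D \<noteq> {}"
    "\<forall>D'. control_set euclidean (controls U \<times> controls V) (psi A B) D' \<and> interior D' \<noteq> {}
      \<longrightarrow> D' = D"
    unfolding euclidean_interior_of euclidean_closure_of topspace_euclidean by blast
  have "closure D = closure E"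
    using closure_mono[OF D(2)] D(3) by (simp add: closure_minimal subset_antisym)
  then show ?thesis using D by blast
qed

text \<open>Forgetting the phase turns trajectories of the autonomized system into trajectories of
  the quasi-affine one for a shifted \<open>v\<close>, so its core is mapped into \<open>E\<close>.
  This passes to closures because the cylinder over an open set of states is open.\<close>

lemma projected_control_set_subset:
  assumes vp: "v \<in> controls V" "periodic_control T v"
  shows "snd ` (autonomized_space T interior_of periodic_control_set A B U T v) \<subseteq> closure E"
proof -
  interpret periodic_quasi_affine A B U V T v by unfold_locales (rule vp)+
  have shifted: "controllable_unconstrained A B (\<lambda>r. v (s + r))" for s
    by (rule ctrl[OF controls_shift'[OF vp(1)] periodic_control_shift[OF vp(2)]])
  have core: "y \<in> E" if y: "(\<tau>, y) \<in> P.core (0, 0)" for \<tau> y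
  proof (rule S.coreI)
    obtain t u where "t \<ge> 0" "u \<in> controls U" "(\<tau>, y) = aut t (0, 0) u"
      using y unfolding P.core_def by (auto elim: P.reachE)
    then show "y \<in> S.R 0"
      using S.reachI[of t "(u, \<lambda>r. v (0 + r))" 0] vp by (simp add: psi_autonomized_def)
    obtain t u where "t \<ge> 0" "u \<in> controls U" "(0, 0) = aut t (\<tau>, y) u"
      using y unfolding P.core_def by (auto elim: P.reachE)
    then show "0 \<in> S.R y"
      using S.reachI[of t "(u, \<lambda>r. v (\<tau> + r))" y] controls_shift'[OF vp(1), of \<tau>]
      by (simp add: psi_autonomized_def)
  qed
  have proj: "y \<in> closure E" if y: "(\<tau>, y) \<in> autonomized_space T closure_of P.core (0, 0)" for \<tau> y
    unfolding closure_iff_nhds_not_empty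
  proof (intro allI impI)
    fix N W assume W: "W \<subseteq> N" "open W" "y \<in> W"
    have opn: "openin (autonomized_space T) ({0..<T} \<times> W)"
      using W(2) openin_topspace[of "circle_topology T"]
      by (simp add: autonomized_space_def openin_prod_Times_iff topspace_circle_topology T_pos)
    have mem: "(\<tau>, y) \<in> {0..<T} \<times> W"
      using y W(3) unfolding in_closure_of topspace_autonomized_space[OF T_pos] by blast
    have "\<forall>W. (\<tau>, y) \<in> W \<and> openin (autonomized_space T) W \<longrightarrow> (\<exists>z. z \<in> P.core (0, 0) \<and> z \<in> W)"
      using y unfolding in_closure_of by (rule conjunct2)
    from this[rule_format, OF conjI[OF mem opn]]
    obtain z where z: "z \<in> P.core (0, 0)" "z \<in> {0..<T} \<times> W" by blast
    have "snd z \<in> E" using z(1) core[of "fst z" "snd z"] by simp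
    moreover have "snd z \<in> W" using z(2) by (simp add: mem_Times_iff)
    ultimately show "E \<inter> N \<noteq> {}" using W(1) by blast
  qed
  have sub: "autonomized_space T interior_of periodic_control_set A B U T v
      \<subseteq> autonomized_space T closure_of P.core (0, 0)"
    using periodic_control_set_core(2)[OF shifted] interior_of_subset[of "autonomized_space T" "periodic_control_set A B U T v"]
    by (rule order_trans[rotated])
  show ?thesis
  proof
    fix y assume "y \<in> snd ` (autonomized_space T interior_of periodic_control_set A B U T v)"
    then obtain \<tau> where "(\<tau>, y) \<in> autonomized_space T interior_of periodic_control_set A B U T v"
      by auto
    then have "(\<tau>, y) \<in> autonomized_space T closure_of P.core (0, 0)" by (rule subsetD[OF sub])
    then show "y \<in> closure E" by (rule proj)
  qed
qed

text \<open>The tube of interior points covers only phases strictly between 0 and \<open>T\<close>,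
  while \<open>x\<close> sits at phase 0. So two approximations are combined: a factor
  \<open>c\<close> near 1, and a small phase \<open>s > 0\<close> along the scaled closed
  trajectory.\<close>

lemma core_subset_closure_projected:
  "E \<subseteq> closure (\<Union>(v, T) \<in> {(v, T). v \<in> controls V \<and> periodic_control T v}.
     snd ` (autonomized_space T interior_of periodic_control_set A B U T v))" (is "_ \<subseteq> closure ?P")
proof
  fix x assume "x \<in> E"
  then obtain w T where w: "w \<in> controls U \<times> controls V" and T: "T > 0" and loop: "psi A B T x w = x"
    by (rule core_loop)
  obtain u v y where u: "u \<in> controls U" and vp: "v \<in> controls V" "periodic_control T v"
    and y: "traj u v y" "y 0 = x" "y T = x"
    using closed_orbit[OF w T loop] by metis
  interpret periodic_quasi_affine A B U V T v by unfold_locales (rule vp)+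
  have shifted: "controllable_unconstrained A B (\<lambda>r. v (s + r))" for s
    by (rule ctrl[OF controls_shift'[OF vp(1)] periodic_control_shift[OF vp(2)]])
  show "x \<in> closure ?P"
    unfolding closure_approachable
  proof (intro allI impI)
    fix \<epsilon> :: real assume \<epsilon>: "\<epsilon> > 0"
    obtain c where c: "0 \<le> c" "c < 1" "norm (c *\<^sub>R x - x) < \<epsilon> / 2"
      using ex_scaling_factor[of "\<epsilon> / 2" x] \<epsilon> by (metis half_gt_zero)
    have "y T = y 0" using y by simp
    from tube_in_core[OF ctrl[OF vp] u y(1) this c(1,2)]
    obtain G where G: "openin (autonomized_space T) G" "G \<subseteq> P.core (0, 0)"
      "\<And>s. 0 < s \<Longrightarrow> s < T \<Longrightarrow> (s, c *\<^sub>R y s) \<in> G" by metis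
    have "isCont (\<lambda>s. c *\<^sub>R y s) 0"
      using caratheodory_solution_continuous_on_UNIV[OF y(1)]
      by (intro continuous_intros) (simp add: continuous_on_eq_continuous_at)
    then obtain d where d: "d > 0" "\<And>s. dist s 0 < d \<Longrightarrow> dist (c *\<^sub>R y s) (c *\<^sub>R y 0) < \<epsilon> / 2"
      using \<epsilon> unfolding continuous_at_eps_delta by (metis half_gt_zero)
    define s where "s = min d T / 2"
    have s: "0 < s" "s < T" "s < d" using d(1) T by (auto simp: s_def)
    have "dist (c *\<^sub>R y s) (c *\<^sub>R y 0) < \<epsilon> / 2" using d(2)[of s] s by simp
    then have near: "dist (c *\<^sub>R y s) x < \<epsilon>"
      using c(3) y(2) dist_triangle[of "c *\<^sub>R y s" x "c *\<^sub>R x"] by (simp add: dist_norm)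
    have "G \<subseteq> autonomized_space T interior_of periodic_control_set A B U T v"
      using G(1,2) periodic_control_set_core(1)[OF shifted] by (intro interior_of_maximal) auto
    then have "c *\<^sub>R y s \<in> snd ` (autonomized_space T interior_of periodic_control_set A B U T v)"
      using G(3)[OF s(1,2)] by force
    then have "c *\<^sub>R y s \<in> ?P" using vp by blast
    then show "\<exists>z\<in>?P. dist z x < \<epsilon>" using near by blast
  qed
qed

end

theorem theorem7p2:
  fixes A0 :: "real^'d^'d"
    and Ai :: "'p::finite \<Rightarrow> real^'d^'d"
    and A :: "real^'p \<Rightarrow> real^'d^'d"
    and B :: "real^'p \<Rightarrow> real^'m^'d"
    and U :: "(real^'m) set"
    and V :: "(real^'p) set"
  assumes A_affine: "\<And>v. A v = A0 + (\<Sum>i\<in>UNIV. (v $ i) *\<^sub>R Ai i)"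
    and B_cont: "continuous_on V B"
    and UV_compact: "compact (U \<times> V)"
    and UV_convex: "convex (U \<times> V)"
    and UV_nbhd: "(0, 0) \<in> interior (U \<times> V)"
    and periodic_controllable:
      "\<And>v T. v \<in> controls V \<Longrightarrow> periodic_control T v \<Longrightarrow> controllable_unconstrained A B v"
    and accessible: "locally_accessible (controls U \<times> controls V) (psi A B)"
    and hyperbolic:
      "\<And>v T \<rho>. v \<in> controls V \<Longrightarrow> periodic_control T v \<Longrightarrow> \<rho> \<in> floquet_exponents A T v \<Longrightarrow> \<rho> \<noteq> 0"
  shows "\<exists>D. control_set euclidean (controls U \<times> controls V) (psi A B) D \<and> interior D \<noteq> {} \<and>
           (\<forall>D'. control_set euclidean (controls U \<times> controls V) (psi A B) D' \<and> interior D' \<noteq> {}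
                  \<longrightarrow> D' = D) \<and>
           closure D =
             closure (\<Union>(v, T) \<in> {(v, T). v \<in> controls V \<and> periodic_control T v}.
                        snd ` (autonomized_space T interior_of periodic_control_set A B U T v))"
proof -
  have int: "0 \<in> interior U" "0 \<in> interior V" using UV_nbhd by (auto simp: interior_Times)
  then have ne: "0 \<in> U" "0 \<in> V" using interior_subset by blast+
  \<comment> \<open>Compactness and convexity pass from the product to its factors by projection,
    which recovers a factor because the other one is nonempty.\<close>
  then have proj: "fst ` (U \<times> V) = U" "snd ` (U \<times> V) = V" by auto
  interpret controllable_quasi_affine A B U V
  proof
    show "continuous_on UNIV A" unfolding A_affine by (intro continuous_intros)
    show "compact U" "compact V"
      using compact_continuous_image[OF continuous_on_fst[OF continuous_on_id] UV_compact]
        compact_continuous_image[OF continuous_on_snd[OF continuous_on_id] UV_compact]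
      by (simp_all only: proj)
    show "convex U" using convex_linear_image[OF linear_fst UV_convex] by (simp only: proj)
  qed (use B_cont int ne periodic_controllable in auto)
  let ?P = "\<Union>(v, T) \<in> {(v, T). v \<in> controls V \<and> periodic_control T v}.
    snd ` (autonomized_space T interior_of periodic_control_set A B U T v)"
  have "?P \<subseteq> closure E" using projected_control_set_subset by blast
  then have "closure E = closure ?P"
    using core_subset_closure_projected by (intro subset_antisym closure_minimal) auto
  then show ?thesis using unique_control_set[OF accessible] by simp
qed

end
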